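(* Let $(A,\{m^A_k\})$ be a finite-dimensional $A_\infty$-algebra over $\boldsymbol{k}$ with a strong homotopy inner product $\phi:A\to A^*$. Let $(B,\{m^B_k\})$ be a finite-dimensional cyclic $A_\infty$-algebra, with cyclic inner product $\langle\,,\rangle$ and associated $A_\infty$-bimodule map $\psi:B\to B^*$, and let $h:B\to A$ be an $A_\infty$-quasi-isomorphism such that $\psi=\widetilde h^{*}\circ\widehat\phi\circ\widehat{\widetilde h}$, i.e. $\psi=h^*\phi$. Then the potentials satisfy $$\Phi^{B}=h^{*}\Phi^{A}.$$
   Context: Conventions. $\boldsymbol{k}$ is a field of characteristic $0$; for a homogeneous element $x$ of a graded vector space $|x|'=|x|-1$ is the shifted degree. An $A_\infty$-algebra $(A,\{m_k\}_{k\ge1})$ is a graded vector space with multilinear maps $m_k:A^{\otimes k}\to A$ of degree $1$ for the shifted degree with $\sum_{i,j}(-1)^{|x_1|'+\cdots+|x_i|'}m_{n-j+1}(x_1,\dots,x_i,m_j(x_{i+1},\dots,x_{i+j}),\dots,x_n)=0$ for all $n\ge1$. $H^\bullet(A)$ is the cohomology of $m_1$ (assumed finite dimensional). An $A_\infty$-homomorphism $f:A\to B$ is a family $f_k:A^{\otimes k}\to B$, $k\ge1$, of shifted degree $0$ with $\sum m^B_r(f_{i_1}(x_1,\dots),\dots,f_{i_r}(\dots,x_n))=\sum(-1)^{|x_1|'+\cdots+|x_i|'}f(x_1,\dots,x_i,m^A_j(x_{i+1},\dots),\dots,x_n)$; it is an $A_\infty$-quasi-isomorphism if $f_1$ induces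 an isomorphism on cohomology. $\widehat f$ is the induced coalgebra map, $\widehat f(x_1\otimes\cdots\otimes x_n)=\sum f_{i_1}(x_1,\dots)\otimes\cdots\otimes f_{i_r}(\dots,x_n)$. Bimodule maps $A\to A^*$. An $A_\infty$-bimodule map $\phi:A\to A^*$ is a family $\phi_{p,q}:A^{\otimes p}\otimes\underline A\otimes A^{\otimes q}\to A^*$, $p,q\ge0$ (the underline marks the bimodule entry), such that for all $a_1,\dots,a_p,v,b_1,\dots,b_q,w\in A$ the following sum is $0$: the sum of all terms obtained by applying some $m_j$ to a consecutive string in $(a_1,\dots,a_p,v,b_1,\dots,b_q)$ (with sign $(-1)$ to the sum of the shifted degrees of the entries to the left of the string; the output is the new bimodule entry if the string contains $v$) and evaluating $\phi(\cdots)(w)$, plus $\sum_{0\le i\le p,\,0\le j\le q}(-1)^{\epsilon}\phi(a_{i+1},\dots,a_p,\underline v,b_1,\dots,b_j)\big(m(b_{j+1},\dots,b_q,w,a_1,\dots,a_i)\big)$, where $(-1)^\epsilon$ is the Koszul sign: $\epsilon=(\sum_{s\le i}|a_s|')(\sum_{s>i}|a_s|'+|v|'+\sum_s|b_s|'+|w|')+\sum_{s>i}|a_s|'+|v|'+\sum_{s\le j}|b_s|'$. Write $\langle x_1,\dots,x_p,\underline v,y_1,\dots,y_q\,|\,w\rangle_{p,q}=\phi_{p,q}(x_1,\dots,x_p,\underline v,y_1,\dots,y_q)(w)$. Strong homotopy inner product. This is an $A_\infty$-bimodule map $\phi:A\to A^*$ such that: (1) (skew symmetry) $\phi_{k,l}(\vec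 a,\underline v,\vec b)(w)=-(-1)^{K}\phi_{l,k}(\vec b,\underline w,\vec a)(v)$, $K=(\sum_{i=1}^k|a_i|'+|v|')(\sum_{j=1}^l|b_j|'+|w|')$; (2) (closedness) for every family $(a_1,\dots,a_n)$ and $1\le i<j<k\le n$, $[i,j]+[j,k]+[k,i]=0$, where for $r\ne s$ one puts $[r,s]=(-1)^{K_s}\phi(\dots,\underline{a_r},\dots)(a_s)$, the entries $(\dots,\underline{a_r},\dots;a_s)$ being the cyclic rotation $(a_{s+1},\dots,a_n,a_1,\dots,a_s)$ of the family and $K_s=(|a_1|'+\cdots+|a_s|')(|a_{s+1}|'+\cdots+|a_n|')$ the Koszul exponent of that rotation; (3) (homological non-degeneracy) for every nonzero $[a]\in H^\bullet(A)$ there is $[b]\in H^\bullet(A)$ with $\phi_{0,0}(a)(b)\ne0$. Pull-back. For an $A_\infty$-homomorphism $h:B\to A$, $h^*\phi=\widetilde h^*\circ\widehat\phi\circ\widehat{\widetilde h}:B\to B^*$ is given by $(h^*\phi)(\vec a,\underline v,\vec b)(w)=\sum\pm\,\phi\big(\widehat h(\vec a^{(2)}),\underline{h(\vec a^{(3)},v,\vec b^{(1)})},\widehat h(\vec b^{(2)})\big)\big(h(\vec b^{(3)},w,\vec a^{(1)})\big)$, the sum over all ways of splitting $\vec a=\vec a^{(1)}\otimes\vec a^{(2)}\otimes\vec a^{(3)}$ and $\vec b=\vec b^{(1)}\otimes\vec b^{(2)}\otimes\vec b^{(3)}$ into consecutive (possibly empty) strings, with the Koszul sign of moving $\vec a^{(1)}$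 past all the other entries (shifted degrees). Cyclic $A_\infty$-algebra. An $A_\infty$-algebra $B$ with a non-degenerate bilinear form $\langle\,,\rangle:B\otimes B\to\boldsymbol{k}$, skew symmetric ($\langle v,w\rangle=-(-1)^{|v|'|w|'}\langle w,v\rangle$), with $\langle m_k(x_1,\dots,x_k),x_{k+1}\rangle=(-1)^{|x_1|'(|x_2|'+\cdots+|x_{k+1}|')}\langle m_k(x_2,\dots,x_{k+1}),x_1\rangle$ for all $k\ge1$. Its associated bimodule map $\psi:B\to B^*$ has $\psi_{0,0}(v)(w)=\langle v,w\rangle$ and $\psi_{p,q}=0$ for $(p,q)\ne(0,0)$. Potentials. Let $\{e_i\}$ be a homogeneous basis of $A$, $x_i$ graded-commuting formal variables with $\deg x_i=-|e_i|'$, and $\boldsymbol{x}=\sum_ie_ix_i$ (so $\boldsymbol{x}$ has shifted degree $0$); all operations are extended linearly over formal power series in the $x_i$ by moving coefficients to the right with Koszul signs. Define $$\Phi^A(\boldsymbol{x})=\sum_{N\ge1}\ \sum_{\substack{p+q+k=N\\ p,q\ge0,\,k\ge1}}\frac1{N+1}\big\langle\boldsymbol{x}^{\otimes p},\underline{m^A_k(\boldsymbol{x},\dots,\boldsymbol{x})},\boldsymbol{x}^{\otimes q}\,\big|\,\boldsymbol{x}\big\rangle_{p,q}.$$ For the cyclic algebra $B$ with homogeneous basis $\{f_j\}$, corresponding variables $y_j$ and $\boldsymbol{y}=\sum_jf_jy_j$, $\Phi^B(\boldsymbol{y})=\sum_{k\ge1}\frac1{k+1}\langle m^B_k(\boldsymbol{y},\dots,\boldsymbol{y}),\boldsymbol{y}\rangle$.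 The pull-back $h^*\Phi^A$ is the power series in the $y_j$ obtained from $\Phi^A$ by the substitution $x_i\mapsto$ the coefficient of $e_i$ in $h(\boldsymbol{y}):=\sum_{k\ge1}h_k(\boldsymbol{y},\dots,\boldsymbol{y})$; that is, if $h_k(f_{j_1},\dots,f_{j_k})=\sum_ih^i_{j_1,\dots,j_k}e_i$, then $x_i\mapsto\sum_k\sum_{j_1,\dots,j_k}h^i_{j_1,\dots,j_k}y_{j_1}\cdots y_{j_k}$ (Koszul signs understood). *)

theory Defs
  imports Complex_Main "HOL-Library.Multiset" "HOL-Library.Groups_Big_Fun"
begin

section \<open>Graded vector spaces and multilinear operations\<close>

text \<open>
  A graded vector space is a vector space with its homogeneous components \<open>G d\<close>, where \<open>d\<close> is
  the unshifted degree. All degrees attached to elements below are shifted: an element \<open>x\<close> has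
  shifted degree \<open>d\<close> iff \<open>x \<in> G (d + 1)\<close>. Identities for homogeneous elements are quantified
  over the elements together with their shifted degrees; this only matters for the
  zero vector, for which every term of every identity vanishes.
\<close>

locale graded_vector_space = vector_space scale
  for scale :: "'k::field_char_0 \<Rightarrow> 'a::ab_group_add \<Rightarrow> 'a" +
  fixes G :: "int \<Rightarrow> 'a set"
  assumes subspace_component: "subspace (G d)"
    and direct_sum: "\<exists>!c. (\<forall>d. c d \<in> G d) \<and> finite {d. c d \<noteq> 0} \<and> v = (\<Sum>d | c d \<noteq> 0. c d)"

definition homogeneous :: "(int \<Rightarrow> 'a set) \<Rightarrow> 'a list \<Rightarrow> int list \<Rightarrow> bool" where
  "homogeneous G xs ds \<longleftrightarrow> list_all2 (\<lambda>x d. x \<in> G (d + 1)) xs ds"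

definition sgn_pow :: "int \<Rightarrow> 'k::ring_1" where
  "sgn_pow n = (if even n then 1 else - 1)"

text \<open>
  A family of operations \<open>f\<^sub>k\<close> on \<open>k\<close>-fold tensor powers is one function on lists, \<open>f\<^sub>k\<close> being its
  restriction to lists of length \<open>k\<close>.
\<close>

definition multilinear ::
  "('k::field \<Rightarrow> 'a::ab_group_add \<Rightarrow> 'a) \<Rightarrow> ('k \<Rightarrow> 'c::ab_group_add \<Rightarrow> 'c) \<Rightarrow> nat \<Rightarrow> ('a list \<Rightarrow> 'c) \<Rightarrow> bool" where
  "multilinear s t k f \<longleftrightarrow>
     (\<forall>us ws. length us + 1 + length ws = k \<longrightarrow> Vector_Spaces.linear s t (\<lambda>v. f (us @ v # ws)))"

section \<open>A-infinity algebras and homomorphisms\<close>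

locale A_infinity_algebra = graded_vector_space scale G
  for scale :: "'k::field_char_0 \<Rightarrow> 'a::ab_group_add \<Rightarrow> 'a" and G +
  fixes m :: "'a list \<Rightarrow> 'a"
  assumes multilinear_m: "1 \<le> k \<Longrightarrow> multilinear scale scale k m"
    and degree_m: "xs \<noteq> [] \<Longrightarrow> homogeneous G xs ds \<Longrightarrow> homogeneous G [m xs] [sum_list ds + 1]"
    and A_infinity_relation: "xs \<noteq> [] \<Longrightarrow> homogeneous G xs ds \<Longrightarrow>
      (\<Sum>i<length xs. \<Sum>j=1..length xs - i.
         scale (sgn_pow (sum_list (take i ds)))
           (m (take i xs @ m (take j (drop i xs)) # drop (i + j) xs))) = 0"

text \<open>All ways of cutting a list into consecutive nonempty pieces.\<close>

definition blocks :: "'a list \<Rightarrow> 'a list list set" where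
  "blocks xs = {yss. concat yss = xs \<and> [] \<notin> set yss}"

definition cocycles :: "('a::ab_group_add list \<Rightarrow> 'a) \<Rightarrow> 'a set" where
  "cocycles m = {x. m [x] = 0}"

definition cohomologous :: "('a::ab_group_add list \<Rightarrow> 'a) \<Rightarrow> ('a \<times> 'a) set" where
  "cohomologous m = {(x, y). x \<in> cocycles m \<and> y \<in> cocycles m \<and> x - y \<in> range (\<lambda>z. m [z])}"

definition cohomology :: "('a::ab_group_add list \<Rightarrow> 'a) \<Rightarrow> 'a set set" where
  "cohomology m = cocycles m // cohomologous m"

definition cohomology_class :: "('a::ab_group_add list \<Rightarrow> 'a) \<Rightarrow> 'a \<Rightarrow> 'a set" where
  "cohomology_class m x = cohomologous m `` {x}"

definition cohomology_map ::
  "('b::ab_group_add list \<Rightarrow> 'b) \<Rightarrow> ('a list \<Rightarrow> 'b) \<Rightarrow> 'a set \<Rightarrow> 'b set" where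
  "cohomology_map m' f C = cohomologous m' `` ((\<lambda>x. f [x]) ` C)"

locale A_infinity_hom =
  source: A_infinity_algebra scale G m + target: A_infinity_algebra scale' G' m'
  for scale :: "'k::field_char_0 \<Rightarrow> 'a::ab_group_add \<Rightarrow> 'a" and G m
    and scale' :: "'k \<Rightarrow> 'b::ab_group_add \<Rightarrow> 'b" and G' m' +
  fixes f :: "'a list \<Rightarrow> 'b"
  assumes multilinear_f: "1 \<le> k \<Longrightarrow> multilinear scale scale' k f"
    and degree_f: "xs \<noteq> [] \<Longrightarrow> homogeneous G xs ds \<Longrightarrow> homogeneous G' [f xs] [sum_list ds]"
    and hom_relation: "xs \<noteq> [] \<Longrightarrow> homogeneous G xs ds \<Longrightarrow>
      (\<Sum>yss\<in>blocks xs. m' (map f yss)) =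
      (\<Sum>i<length xs. \<Sum>j=1..length xs - i.
         scale' (sgn_pow (sum_list (take i ds)))
           (f (take i xs @ m (take j (drop i xs)) # drop (i + j) xs)))"

locale A_infinity_quasi_isomorphism = A_infinity_hom +
  assumes bij_cohomology: "bij_betw (cohomology_map m' f) (cohomology m) (cohomology m')"

section \<open>Bimodule maps to the dual and strong homotopy inner products\<close>

text \<open>
  \<open>\<phi> as v bs w\<close> is \<open>\<langle>as, v, bs | w\<rangle>\<close>, the value of \<open>\<phi>\<^sub>p\<^sub>,\<^sub>q(as, v, bs)\<close> at \<open>w\<close> with \<open>v\<close> the bimodule
  entry, \<open>p = length as\<close> and \<open>q = length bs\<close>. \<open>flat \<phi> p\<close> takes the entries as the single list
  \<open>as @ v # bs @ [w]\<close>.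
\<close>

type_synonym ('a, 'k) dual_bimodule_map = "'a list \<Rightarrow> 'a \<Rightarrow> 'a list \<Rightarrow> 'a \<Rightarrow> 'k"

definition flat :: "('a, 'k) dual_bimodule_map \<Rightarrow> nat \<Rightarrow> 'a list \<Rightarrow> 'k" where
  "flat \<phi> p zs = \<phi> (take p zs) (zs ! p) (drop (Suc p) (butlast zs)) (last zs)"

text \<open>
  The four sums of the bimodule equation: an \<open>m\<close> applied inside \<open>as\<close>, to a string containing \<open>v\<close>,
  inside \<open>bs\<close>, and to a cyclic string containing \<open>w\<close>.
\<close>

locale A_infinity_dual_bimodule_map = A_infinity_algebra scale G m
  for scale :: "'k::field_char_0 \<Rightarrow> 'a::ab_group_add \<Rightarrow> 'a" and G m +
  fixes \<phi> :: "('a, 'k) dual_bimodule_map"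
  assumes multilinear_\<phi>: "multilinear scale (*) (p + q + 2) (flat \<phi> p)"
    and bimodule_relation:
      "homogeneous G as das \<Longrightarrow> homogeneous G [v] [dv] \<Longrightarrow> homogeneous G bs dbs \<Longrightarrow>
       homogeneous G [w] [dw] \<Longrightarrow>
       (\<Sum>i<length as. \<Sum>j=1..length as - i.
          sgn_pow (sum_list (take i das)) *
            \<phi> (take i as @ m (take j (drop i as)) # drop (i + j) as) v bs w)
       + (\<Sum>i\<le>length as. \<Sum>j\<le>length bs.
          sgn_pow (sum_list (take i das)) *
            \<phi> (take i as) (m (drop i as @ v # take j bs)) (drop j bs) w)
       + (\<Sum>i<length bs. \<Sum>j=1..length bs - i.
          sgn_pow (sum_list das + dv + sum_list (take i dbs)) *
            \<phi> as v (take i bs @ m (take j (drop i bs)) # drop (i + j) bs) w)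
       + (\<Sum>i\<le>length as. \<Sum>j\<le>length bs.
          sgn_pow (sum_list (take i das) * (sum_list (drop i das) + dv + sum_list dbs + dw)
                    + sum_list (drop i das) + dv + sum_list (take j dbs)) *
            \<phi> (drop i as) v (take j bs) (m (drop j bs @ w # take i as))) = 0"

text \<open>
  The number \<open>[r,s]\<close> for a family \<open>xs\<close> with shifted degrees \<open>ds\<close>; positions are counted from 0.
  \<open>rotate (Suc s) xs\<close> ends with \<open>xs ! s\<close>, and \<open>xs ! r\<close> sits in it at index
  \<open>(r + length xs - Suc s) mod length xs\<close>.
\<close>

definition cyclic_bracket ::
  "('a, 'k::ring_1) dual_bimodule_map \<Rightarrow> 'a list \<Rightarrow> int list \<Rightarrow> nat \<Rightarrow> nat \<Rightarrow> 'k" where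
  "cyclic_bracket \<phi> xs ds r s =
     sgn_pow (sum_list (take (Suc s) ds) * sum_list (drop (Suc s) ds)) *
     flat \<phi> ((r + length xs - Suc s) mod length xs) (rotate (Suc s) xs)"

locale strong_homotopy_inner_product = A_infinity_dual_bimodule_map scale G m \<phi>
  for scale :: "'k::field_char_0 \<Rightarrow> 'a::ab_group_add \<Rightarrow> 'a" and G m \<phi> +
  assumes skew_symmetry:
      "homogeneous G as das \<Longrightarrow> homogeneous G [v] [dv] \<Longrightarrow> homogeneous G bs dbs \<Longrightarrow>
       homogeneous G [w] [dw] \<Longrightarrow>
       \<phi> as v bs w = - sgn_pow ((sum_list das + dv) * (sum_list dbs + dw)) * \<phi> bs w as v"
    and closedness:
      "homogeneous G xs ds \<Longrightarrow> i < j \<Longrightarrow> j < k \<Longrightarrow> k < length xs \<Longrightarrow>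
       cyclic_bracket \<phi> xs ds i j + cyclic_bracket \<phi> xs ds j k + cyclic_bracket \<phi> xs ds k i = 0"
    and homological_nondegeneracy:
      "a \<in> cocycles m \<Longrightarrow> cohomology_class m a \<noteq> cohomology_class m 0 \<Longrightarrow>
       \<exists>b\<in>cocycles m. \<phi> [] a [] b \<noteq> 0"

text \<open>
  The value of \<open>h\<^sup>*\<phi>\<close> at homogeneous entries with the given shifted degrees. The strings are cut
  at \<open>i \<le> j\<close> (for \<open>as\<close>) and \<open>k \<le> l\<close> (for \<open>bs\<close>).
\<close>

definition pullback_bimodule_map ::
  "('b list \<Rightarrow> 'a) \<Rightarrow> ('a, 'k::field_char_0) dual_bimodule_map \<Rightarrow>
   int list \<Rightarrow> int \<Rightarrow> int list \<Rightarrow> int \<Rightarrow> ('b, 'k) dual_bimodule_map" where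
  "pullback_bimodule_map h \<phi> das dv dbs dw as v bs w =
     (\<Sum>i\<le>length as. \<Sum>j=i..length as. \<Sum>k\<le>length bs. \<Sum>l=k..length bs.
        sgn_pow (sum_list (take i das) * (sum_list (drop i das) + dv + sum_list dbs + dw)) *
        (\<Sum>\<alpha>\<in>blocks (drop i (take j as)). \<Sum>\<beta>\<in>blocks (drop k (take l bs)).
           \<phi> (map h \<alpha>) (h (drop j as @ v # take k bs)) (map h \<beta>) (h (drop l bs @ w # take i as))))"

definition is_pullback ::
  "(int \<Rightarrow> 'b set) \<Rightarrow> ('b list \<Rightarrow> 'a) \<Rightarrow> ('a, 'k::field_char_0) dual_bimodule_map \<Rightarrow>
   ('b, 'k) dual_bimodule_map \<Rightarrow> bool" where
  "is_pullback G h \<phi> \<psi> \<longleftrightarrow>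
     (\<forall>as das v dv bs dbs w dw.
        homogeneous G as das \<longrightarrow> homogeneous G [v] [dv] \<longrightarrow>
        homogeneous G bs dbs \<longrightarrow> homogeneous G [w] [dw] \<longrightarrow>
        \<psi> as v bs w = pullback_bimodule_map h \<phi> das dv dbs dw as v bs w)"

section \<open>Cyclic A-infinity algebras\<close>

locale cyclic_A_infinity_algebra = A_infinity_algebra scale G m
  for scale :: "'k::field_char_0 \<Rightarrow> 'a::ab_group_add \<Rightarrow> 'a" and G m +
  fixes ip :: "'a \<Rightarrow> 'a \<Rightarrow> 'k"
  assumes linear_left: "Vector_Spaces.linear scale (*) (\<lambda>v. ip v w)"
    and linear_right: "Vector_Spaces.linear scale (*) (\<lambda>w. ip v w)"
    and nondegenerate_left: "v \<noteq> 0 \<Longrightarrow> \<exists>w. ip v w \<noteq> 0"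
    and nondegenerate_right: "w \<noteq> 0 \<Longrightarrow> \<exists>v. ip v w \<noteq> 0"
    and ip_skew_symmetry: "homogeneous G [v, w] [dv, dw] \<Longrightarrow> ip v w = - sgn_pow (dv * dw) * ip w v"
    and cyclicity: "homogeneous G (x # ys @ [z]) (dx # ds) \<Longrightarrow>
      ip (m (x # ys)) z = sgn_pow (dx * sum_list ds) * ip (m (ys @ [z])) x"

definition cyclic_bimodule_map :: "('a \<Rightarrow> 'a \<Rightarrow> 'k::zero) \<Rightarrow> ('a, 'k) dual_bimodule_map" where
  "cyclic_bimodule_map ip as v bs w = (if as = [] \<and> bs = [] then ip v w else 0)"

section \<open>Formal power series in graded-commuting variables\<close>

text \<open>
  Given the list \<open>ds\<close> of shifted degrees of a homogeneous basis, the variable \<open>x\<^sub>i\<close> has degree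
  \<open>- ds ! i\<close>. A multiset \<open>M\<close> of indices stands for the monomial with its variables in increasing
  order, and a power series is the function giving the coefficients of these monomials. As the
  square of an odd variable is 0, only monomials without repeated odd variables matter; the
  variables and the unit have coefficient 0 at all others, and products preserve this.
\<close>

type_synonym 'k gseries = "nat multiset \<Rightarrow> 'k"

definition mon_degree :: "int list \<Rightarrow> nat multiset \<Rightarrow> int" where
  "mon_degree ds M = (\<Sum>i\<in>#M. - ds ! i)"

text \<open>The scalar \<open>c\<close> with \<open>x\<^sup>M x\<^sup>N = c x\<^sup>M\<^sup>+\<^sup>N\<close>; the exponent counts the transpositions of sorting.\<close>

definition mon_sign :: "int list \<Rightarrow> nat multiset \<Rightarrow> nat multiset \<Rightarrow> 'k::ring_1" where
  "mon_sign ds M N =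
     (if \<exists>i. i \<in># M \<and> i \<in># N \<and> odd (ds ! i) then 0
      else sgn_pow (\<Sum>i\<in>#M. \<Sum>j\<in>#filter_mset (\<lambda>j. j < i) N. ds ! i * ds ! j))"

definition gmul :: "int list \<Rightarrow> 'k::ring_1 gseries \<Rightarrow> 'k gseries \<Rightarrow> 'k gseries" where
  "gmul ds F H = (\<lambda>L. \<Sum>(M, N) | M + N = L. mon_sign ds M N * F M * H N)"

definition gone :: "'k::ring_1 gseries" where
  "gone = (\<lambda>M. if M = {#} then 1 else 0)"

definition gvar :: "nat \<Rightarrow> 'k::ring_1 gseries" where
  "gvar i = (\<lambda>M. if M = {#i#} then 1 else 0)"

definition gprod :: "int list \<Rightarrow> 'k::ring_1 gseries list \<Rightarrow> 'k gseries" where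
  "gprod ds Fs = foldr (gmul ds) Fs gone"

text \<open>The Koszul sign of moving a power series past an element of degree \<open>d\<close>.\<close>

definition gtwist :: "int list \<Rightarrow> int \<Rightarrow> 'k::ring_1 gseries \<Rightarrow> 'k gseries" where
  "gtwist ds d F = (\<lambda>M. sgn_pow (d * mon_degree ds M) * F M)"

section \<open>Extension of operations to power series, and potentials\<close>

definition homogeneous_basis ::
  "('k::field \<Rightarrow> 'a::ab_group_add \<Rightarrow> 'a) \<Rightarrow> (int \<Rightarrow> 'a set) \<Rightarrow> 'a list \<Rightarrow> int list \<Rightarrow> bool" where
  "homogeneous_basis scale G es ds \<longleftrightarrow>
     distinct es \<and> finite_dimensional_vector_space scale (set es) \<and> homogeneous G es ds"

text \<open>
  An element \<open>\<Sum>\<^sub>i e\<^sub>i F\<^sub>i\<close> with power series coefficients is given by the function \<open>F\<close> of \<open>i\<close>; in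
  particular \<open>gvar\<close> itself is the generic element \<open>\<Sum>\<^sub>i e\<^sub>i x\<^sub>i\<close>. \<open>ext_form\<close> extends a
  scalar-valued multilinear operation \<open>c\<close>: in
  \<open>c(e\<^sub>j\<^sub>1 F\<^sub>j\<^sub>1, \<dots>, e\<^sub>j\<^sub>n H\<^sub>j\<^sub>n)\<close> each series moves to the right past the basis vectors following it.
\<close>

definition koszul_prod ::
  "int list \<Rightarrow> (nat \<Rightarrow> 'k::ring_1 gseries) list \<Rightarrow> nat list \<Rightarrow> 'k gseries" where
  "koszul_prod ds Fs js =
     gprod ds (map (\<lambda>a. gtwist ds (\<Sum>b\<in>{a<..<length js}. ds ! (js ! b)) ((Fs ! a) (js ! a)))
                [0..<length js])"

definition ext_form ::
  "'a list \<Rightarrow> int list \<Rightarrow> ('a list \<Rightarrow> 'k::ring_1) \<Rightarrow> (nat \<Rightarrow> 'k gseries) list \<Rightarrow> 'k gseries" where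
  "ext_form es ds c Fs =
     (\<lambda>M. \<Sum>js | length js = length Fs \<and> set js \<subseteq> {..<length es}.
            c (map ((!) es) js) * koszul_prod ds Fs js M)"

definition coordinate ::
  "('k::field \<Rightarrow> 'a::ab_group_add \<Rightarrow> 'a) \<Rightarrow> 'a list \<Rightarrow> 'a \<Rightarrow> nat \<Rightarrow> 'k" where
  "coordinate scale es v j = module.representation scale (set es) v (es ! j)"

text \<open>
  Extension of an operation with values in a space with basis \<open>es'\<close>; the variables are those
  of the source basis \<open>es\<close>.
\<close>

definition ext_op ::
  "'a list \<Rightarrow> int list \<Rightarrow> ('k::field \<Rightarrow> 'b::ab_group_add \<Rightarrow> 'b) \<Rightarrow> 'b list \<Rightarrow>
   ('a list \<Rightarrow> 'b) \<Rightarrow> (nat \<Rightarrow> 'k gseries) list \<Rightarrow> nat \<Rightarrow> 'k gseries" where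
  "ext_op es ds scale' es' f Fs = (\<lambda>j. ext_form es ds (\<lambda>vs. coordinate scale' es' (f vs) j) Fs)"

text \<open>
  The infinite sums below are formal: at each monomial only finitely many summands are
  nonzero, since the summand with index \<open>N\<close> (or \<open>k\<close>, or \<open>M\<close>) only involves monomials of length at
  least \<open>N\<close> (or \<open>k\<close>, or \<open>size M\<close>).
\<close>

definition potential ::
  "('k::field_char_0 \<Rightarrow> 'a::ab_group_add \<Rightarrow> 'a) \<Rightarrow> ('a list \<Rightarrow> 'a) \<Rightarrow> ('a, 'k) dual_bimodule_map \<Rightarrow>
   'a list \<Rightarrow> int list \<Rightarrow> 'k gseries" where
  "potential scale m \<phi> es ds =
     (\<lambda>M. Sum_any (\<lambda>N. \<Sum>(p, q, k) | p + q + k = N \<and> 1 \<le> k.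
        1 / of_nat (N + 1) *
        ext_form es ds (flat \<phi> p)
          (replicate p gvar @ ext_op es ds scale es m (replicate k gvar) # replicate q gvar @ [gvar])
          M))"

definition cyclic_potential ::
  "('k::field_char_0 \<Rightarrow> 'b::ab_group_add \<Rightarrow> 'b) \<Rightarrow> ('b list \<Rightarrow> 'b) \<Rightarrow> ('b \<Rightarrow> 'b \<Rightarrow> 'k) \<Rightarrow>
   'b list \<Rightarrow> int list \<Rightarrow> 'k gseries" where
  "cyclic_potential scale m ip fs ds =
     (\<lambda>M. Sum_any (\<lambda>k. if 1 \<le> k then
        1 / of_nat (k + 1) *
        ext_form fs ds (\<lambda>vs. ip (vs ! 0) (vs ! 1))
          [ext_op fs ds scale fs m (replicate k gvar), gvar] M
      else 0))"

text \<open>The coefficient of \<open>e\<^sub>i\<close> in \<open>\<Sum>\<^sub>k h\<^sub>k(y, \<dots>, y)\<close>.\<close>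

definition hom_series ::
  "'b list \<Rightarrow> int list \<Rightarrow> ('k::field_char_0 \<Rightarrow> 'a::ab_group_add \<Rightarrow> 'a) \<Rightarrow> 'a list \<Rightarrow>
   ('b list \<Rightarrow> 'a) \<Rightarrow> nat \<Rightarrow> 'k gseries" where
  "hom_series fs dfs scale es h i =
     (\<lambda>M. Sum_any (\<lambda>k. if 1 \<le> k then ext_op fs dfs scale es h (replicate k gvar) i M else 0))"

text \<open>Substitution of \<open>X\<^sub>i\<close> for \<open>x\<^sub>i\<close>; \<open>ds\<close> are the degrees for the variables of the result.\<close>

definition gsubst :: "int list \<Rightarrow> (nat \<Rightarrow> 'k::ring_1 gseries) \<Rightarrow> 'k gseries \<Rightarrow> 'k gseries" where
  "gsubst ds X F = (\<lambda>L. Sum_any (\<lambda>M. F M * gprod ds (map X (sorted_list_of_multiset M)) L))"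

definition pullback_series ::
  "'b list \<Rightarrow> int list \<Rightarrow> ('k::field_char_0 \<Rightarrow> 'a::ab_group_add \<Rightarrow> 'a) \<Rightarrow> 'a list \<Rightarrow>
   ('b list \<Rightarrow> 'a) \<Rightarrow> 'k gseries \<Rightarrow> 'k gseries" where
  "pullback_series fs dfs scale es h F = gsubst dfs (hom_series fs dfs scale es h) F"

end

theory Submission
  imports Defs "HOL-Combinatorics.Multiset_Permutations"
begin

text \<open>
  All series are images of noncommutative power series in the variables, and the substitution
  \<open>x \<mapsto> h(y)\<close> is signless because \<open>h\<close> has degree 0. Put
  \<open>D(a\<^sub>1, \<dots>, a\<^sub>n) = \<Sum> \<plusminus> \<langle>a\<^sub>1, \<dots>, m(\<dots>), \<dots> | a\<^sub>n\<rangle>\<close>, the sum over all nonempty strings in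
  \<open>a\<^sub>1, \<dots>, a\<^sub>n\<^sub>-\<^sub>1\<close> with the output of \<open>m\<close> as the bimodule entry; the potential is the image of
  \<open>(1/n) D\<close>. The bimodule relation, closedness and skew symmetry together say that \<open>D\<close> is graded
  cyclically invariant, i.e. that the 1-form \<open>D(x, \<dots>, x, dx)\<close> is closed. By the relation for \<open>h\<close>
  and \<open>\<psi> = h\<^sup>*\<phi>\<close>, the form \<open>\<langle>m(b\<^sub>1, \<dots>), b\<^sub>n\<rangle>\<close> of \<open>B\<close> is the sum of \<open>D(h(\<dots>), \<dots>, h(\<dots> b\<^sub>n \<dots>))\<close>
  over all cuts of the cyclic word \<open>b\<^sub>1 \<dots> b\<^sub>n\<close>. After projection to commuting variables, a cut into
  \<open>r\<close> pieces is counted once for each letter of the last piece, hence by cyclic invariance \<open>n/r\<close>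
  times on average, which turns the weight \<open>1/n\<close> of \<open>\<Phi>\<^sup>B\<close> into the weight \<open>1/r\<close> of \<open>h\<^sup>*\<Phi>\<^sup>A\<close>.
\<close>

section \<open>Signs of words in graded-commuting variables\<close>

text \<open>The averaging cannot be done on monomials: the number of letters of the last factor is
  visible only in a word. This is why everything is lifted to words before \<open>h\<close> is
  substituted. The relation for \<open>h\<close> enters through a redundancy. Since the bimodule map
  of \<open>B\<close> vanishes as soon as a side string is nonempty, the form of \<open>B\<close>
  may be replaced by the sum over all strings in b_1 ... b_(n-1), with the output of m in the
  bimodule entry and the remaining letters at its sides; all terms but one vanish. After expansion
  of the pull-back, h(..., m(...), ...) occurs for every position of the string, which is exactly
  one side of the relation. The cyclic words come from the string in the pull-back that joins the
  end of the right side, the last entry and the beginning of the left side. The other obstacle is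
  signs: they depend on degrees of basis vectors that are mere summation indices. A nonzero
  coordinate forces the degree of its basis vector, so that all signs can be computed from the
  words.\<close>

lemma sgn_pow_0 [simp]: "sgn_pow 0 = 1"
  by (simp add: sgn_pow_def)

lemma sgn_pow_add: "sgn_pow (a + b) = (sgn_pow a * sgn_pow b :: 'k::ring_1)"
  by (simp add: sgn_pow_def)

lemma sgn_pow_self: "sgn_pow a * sgn_pow a = (1 :: 'k::ring_1)"
  by (simp add: sgn_pow_def)

lemma sgn_pow_cong: "even a = even b \<Longrightarrow> sgn_pow a = sgn_pow b"
  by (simp add: sgn_pow_def)

lemma mon_sign_add_left:
  "mon_sign ds (M1 + M2) N = mon_sign ds M1 N * (mon_sign ds M2 N :: 'k::comm_ring_1)"
  by (auto simp: mon_sign_def sgn_pow_add)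

lemma mon_sign_add_right:
  "mon_sign ds M (N1 + N2) = mon_sign ds M N1 * (mon_sign ds M N2 :: 'k::comm_ring_1)"
  by (auto simp: mon_sign_def sgn_pow_add sum_mset.distrib)

lemma mon_sign_empty [simp]: "mon_sign ds {#} N = 1" "mon_sign ds M {#} = 1"
  by (auto simp: mon_sign_def)

definition word_deg :: "int list \<Rightarrow> nat list \<Rightarrow> int" where
  "word_deg ds js = (\<Sum>j\<leftarrow>js. ds ! j)"

lemma word_deg_simps [simp]:
  "word_deg ds [] = 0" "word_deg ds (j # js) = ds ! j + word_deg ds js"
  "word_deg ds (us @ vs) = word_deg ds us + word_deg ds vs"
  by (auto simp: word_deg_def)

lemma mon_degree_mset: "mon_degree ds (mset js) = - word_deg ds js"
  by (induction js) (auto simp: mon_degree_def)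

text \<open>Exactly one order of two distinct variables is unsorted and carries the sign. For equal
  odd variables both products vanish, for equal even ones all signs are 1.\<close>

lemma mon_sign_singleton_commute:
  "mon_sign ds {#i#} {#j#} = (sgn_pow (ds ! i * ds ! j) * mon_sign ds {#j#} {#i#} :: 'k::comm_ring_1)"
  by (auto simp: mon_sign_def sgn_pow_def)

lemma mon_sign_left_singleton_commute:
  "mon_sign ds {#i#} (mset vs) =
     (sgn_pow (ds ! i * word_deg ds vs) * mon_sign ds (mset vs) {#i#} :: 'k::comm_ring_1)"
proof (induction vs)
  case (Cons v vs)
  have "mon_sign ds {#i#} (mset (v # vs)) =
      mon_sign ds {#i#} {#v#} * (mon_sign ds {#i#} (mset vs) :: 'k)"
    using mon_sign_add_right[of ds "{#i#}" "{#v#}" "mset vs"] by simp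
  moreover have "mon_sign ds (mset (v # vs)) {#i#} =
      mon_sign ds {#v#} {#i#} * (mon_sign ds (mset vs) {#i#} :: 'k)"
    using mon_sign_add_left[of ds "{#v#}" "mset vs" "{#i#}"] by simp
  ultimately show ?case
    using Cons mon_sign_singleton_commute[of ds i v, where ?'k = 'k]
    by (simp only: word_deg_simps distrib_left sgn_pow_add) (simp add: mult_ac)
qed simp

lemma mon_sign_commute:
  "mon_sign ds (mset us) (mset vs) =
     (sgn_pow (word_deg ds us * word_deg ds vs) * mon_sign ds (mset vs) (mset us) :: 'k::comm_ring_1)"
proof (induction us)
  case (Cons u us)
  have "mon_sign ds (mset (u # us)) (mset vs) =
      mon_sign ds {#u#} (mset vs) * (mon_sign ds (mset us) (mset vs) :: 'k)"
    using mon_sign_add_left[of ds "{#u#}" "mset us" "mset vs"] by simp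
  moreover have "mon_sign ds (mset vs) (mset (u # us)) =
      mon_sign ds (mset vs) {#u#} * (mon_sign ds (mset vs) (mset us) :: 'k)"
    using mon_sign_add_right[of ds "mset vs" "{#u#}" "mset us"] by simp
  ultimately show ?case
    using Cons mon_sign_left_singleton_commute[of ds u vs, where ?'k = 'k]
    by (simp only: word_deg_simps distrib_right sgn_pow_add) (simp add: mult_ac)
qed simp

text \<open>\<open>var_sign ds js\<close> is the scalar \<open>c\<close> with \<open>x\<^sub>j\<^sub>1 \<dots> x\<^sub>j\<^sub>n = c x\<^sup>M\<close> for \<open>M = mset js\<close>.\<close>

primrec var_sign :: "int list \<Rightarrow> nat list \<Rightarrow> 'k::comm_ring_1" where
  "var_sign ds [] = 1"
| "var_sign ds (j # js) = mon_sign ds {#j#} (mset js) * var_sign ds js"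

lemma var_sign_append:
  "var_sign ds (us @ vs) =
     (mon_sign ds (mset us) (mset vs) * var_sign ds us * var_sign ds vs :: 'k::comm_ring_1)"
proof (induction us)
  case (Cons u us)
  then show ?case
    using mon_sign_add_left[of ds "{#u#}" "mset us" "mset vs", where ?'k = 'k]
    by (simp add: mon_sign_add_right mult_ac)
qed simp

lemma var_sign_commute:
  "var_sign ds (us @ vs) =
     (sgn_pow (word_deg ds us * word_deg ds vs) * var_sign ds (vs @ us) :: 'k::comm_ring_1)"
  by (simp add: var_sign_append mon_sign_commute[of ds us vs] algebra_simps)

text \<open>The sign of moving the variables of \<open>e\<^sub>j\<^sub>1 x\<^sub>j\<^sub>1 \<otimes> \<dots> \<otimes> e\<^sub>j\<^sub>n x\<^sub>j\<^sub>n\<close> to the right.\<close>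

primrec twist_sign :: "int list \<Rightarrow> nat list \<Rightarrow> 'k::comm_ring_1" where
  "twist_sign ds [] = 1"
| "twist_sign ds (j # js) = sgn_pow (ds ! j * word_deg ds js) * twist_sign ds js"

lemma twist_sign_append:
  "twist_sign ds (us @ vs) =
     (sgn_pow (word_deg ds us * word_deg ds vs) * twist_sign ds us * twist_sign ds vs :: 'k::comm_ring_1)"
  by (induction us) (auto simp: algebra_simps sgn_pow_add)

text \<open>The total sign of a word in c(x, ..., x): \<open>twist_sign\<close> separates the
  variables from the basis vectors, \<open>var_sign\<close> then sorts the variables.\<close>

definition word_sign :: "int list \<Rightarrow> nat list \<Rightarrow> 'k::comm_ring_1" where
  "word_sign ds js = twist_sign ds js * var_sign ds js"

text \<open>Only \<open>var_sign\<close> notices the rotation, because the cross term in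
  \<open>twist_sign_append\<close> is symmetric in the two parts. A cyclically invariant form
  changes by the same sign, so its product with \<open>word_sign\<close> is rotation
  invariant.\<close>

lemma word_sign_commute:
  "word_sign ds (us @ vs) =
     (sgn_pow (word_deg ds us * word_deg ds vs) * word_sign ds (vs @ us) :: 'k::comm_ring_1)"
  unfolding word_sign_def var_sign_commute[of ds us vs] twist_sign_append
  by (simp add: algebra_simps)

text \<open>
  The image of a noncommutative power series, with coefficient \<open>c js\<close> at the word \<open>js\<close>, under the
  quotient map to graded-commutative series.
\<close>

definition word_series :: "int list \<Rightarrow> (nat list \<Rightarrow> 'k::comm_ring_1) \<Rightarrow> 'k gseries" where
  "word_series ds c = (\<lambda>M. \<Sum>js\<in>permutations_of_multiset M. c js * var_sign ds js)"

section \<open>Products of series of words\<close>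

text \<open>The multiset is fixed, not the word: these are the ways in which a monomial arises from
  a product of \<open>n\<close> series of words. The series multiplied below have no constant term,
  hence the nonempty factors, and hence \<open>n\<close> is at most the size of
  \<open>M\<close>.\<close>

definition factorizations :: "nat \<Rightarrow> nat multiset \<Rightarrow> nat list list set" where
  "factorizations n M = {ps. length ps = n \<and> [] \<notin> set ps \<and> mset (concat ps) = M}"

lemma finite_blocks [simp, intro]: "finite (blocks xs)"
proof -
  have "length yss \<le> length (concat yss)" if "[] \<notin> set yss" for yss :: "'a list list"
    using that by (induction yss) (auto simp: Suc_le_eq, metis add_less_mono1 add_le_less_mono add_0 length_greater_0_conv add.commute)
  moreover have "length x \<le> length (concat yss)" if "x \<in> set yss" for x and yss :: "'a list list"
    using that by (induction yss) auto
  ultimately have "blocks xs \<subseteq> {yss. set yss \<subseteq> {ys. set ys \<subseteq> set xs \<and> length ys \<le> length xs}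
                     \<and> length yss \<le> length xs}"
    unfolding blocks_def by fastforce
  moreover have "finite {ys. set ys \<subseteq> set xs \<and> length ys \<le> length xs}"
    by (rule finite_lists_length_le) simp
  ultimately show ?thesis
    using finite_lists_length_le finite_subset by blast
qed

lemma finite_factorizations [simp, intro]: "finite (factorizations n M)"
proof -
  have "factorizations n M \<subseteq> (\<Union>js\<in>permutations_of_multiset M. blocks js)"
    by (auto simp: factorizations_def blocks_def permutations_of_multiset_def)
  then show ?thesis
    by (rule finite_subset) auto
qed

lemma finite_multiset_splits: "finite {(M, N). M + N = (L :: 'a multiset)}"
proof -
  have "M \<in> mset ` {xs. set xs \<subseteq> set_mset L \<and> length xs \<le> size L}" if M: "M \<subseteq># L" for M
  proof -
    obtain xs where "mset xs = M"
      using ex_mset by blast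
    with M show ?thesis
      by (force simp: image_iff dest: mset_subset_eqD size_mset_mono)
  qed
  then have "finite {M. M \<subseteq># L}"
    using finite_subset[of "{M. M \<subseteq># L}" "mset ` {xs. set xs \<subseteq> set_mset L \<and> length xs \<le> size L}"]
      finite_lists_length_le[of "set_mset L" "size L"] by blast
  moreover have "{(M, N). M + N = L} \<subseteq> {M. M \<subseteq># L} \<times> {N. N \<subseteq># L}"
    by auto
  ultimately show ?thesis
    by (meson finite_SigmaI finite_subset)
qed

lemma factorizations_nil: "factorizations 0 L = (if L = {#} then {[]} else {})"
  by (auto simp: factorizations_def)

text \<open>Multiplication concatenates words. A split of the monomial with an arrangement of each
  half is a factorization, and \<open>var_sign_append\<close> accounts for
  \<open>mon_sign\<close>.\<close>

lemma prod_word_series: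
  assumes "\<forall>c\<in>set cs. c [] = 0"
  shows "gprod ds (map (word_series ds) cs) L =
    (\<Sum>ps\<in>factorizations (length cs) L.
       prod_list (map2 (\<lambda>c p. c p) cs ps) * (var_sign ds (concat ps) :: 'k::comm_ring_1))"
  using assms
proof (induction cs arbitrary: L)
  case Nil
  then show ?case
    by (cases "L = {#}") (auto simp: gprod_def gone_def factorizations_nil)
next
  case (Cons c cs)
  let ?t = "\<lambda>ps. prod_list (map2 (\<lambda>c p. c p) (c # cs) ps) * (var_sign ds (concat ps) :: 'k)"
  let ?P = "{(M, N). M + N = L}"
  have "gprod ds (map (word_series ds) (c # cs)) L =
     (\<Sum>(M, N)\<in>?P. mon_sign ds M N * (\<Sum>us\<in>permutations_of_multiset M. c us * var_sign ds us) *
        gprod ds (map (word_series ds) cs) N)"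
    by (simp add: gprod_def gmul_def word_series_def)
  also have "\<dots> = (\<Sum>(M, N)\<in>?P. mon_sign ds M N * (\<Sum>us\<in>permutations_of_multiset M - {[]}. c us * var_sign ds us) *
        (\<Sum>ps\<in>factorizations (length cs) N.
       prod_list (map2 (\<lambda>c p. c p) cs ps) * (var_sign ds (concat ps) :: 'k)))"
  proof (rule sum.cong[OF refl], clarify, goal_cases)
    case (1 M N)
    have "(\<Sum>us\<in>permutations_of_multiset M - {[]}. c us * var_sign ds us) =
          (\<Sum>us\<in>permutations_of_multiset M. c us * (var_sign ds us :: 'k))"
      by (rule sum.mono_neutral_left) (use Cons.prems in auto)
    moreover have "gprod ds (map (word_series ds) cs) N = (\<Sum>ps\<in>factorizations (length cs) N.
       prod_list (map2 (\<lambda>c p. c p) cs ps) * (var_sign ds (concat ps) :: 'k))"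
      using Cons by simp
    ultimately show ?case by simp
  qed
  also have "\<dots> = (\<Sum>(M, N)\<in>?P.
        (\<Sum>(us, ps)\<in>(permutations_of_multiset M - {[]}) \<times> factorizations (length cs) N. ?t (us # ps)))"
    unfolding sum.cartesian_product[symmetric] mult.assoc
    unfolding sum_product
    unfolding sum_distrib_left
    by (intro sum.cong refl, clarify, intro sum.cong refl)
       (auto simp: var_sign_append permutations_of_multiset_def factorizations_def mult_ac simp flip: mset_concat)
  also have "\<dots> = (\<Sum>x\<in>?P. \<Sum>y\<in>(case x of (M, N) \<Rightarrow> (permutations_of_multiset M - {[]}) \<times> factorizations (length cs) N).
       ?t (fst y # snd y))"
    by (simp add: case_prod_unfold)
  also have "\<dots> = (\<Sum>x\<in>Sigma ?P (\<lambda>(M, N). (permutations_of_multiset M - {[]}) \<times> factorizations (length cs) N).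
       ?t (fst (snd x) # snd (snd x)))"
    by (subst sum.Sigma) (auto simp: finite_multiset_splits[unfolded case_prod_unfold] case_prod_unfold)
  also have "\<dots> = (\<Sum>ps\<in>factorizations (length (c # cs)) L. ?t ps)"
    by (rule sum.reindex_bij_witness[where i = "\<lambda>ps. ((mset (hd ps), mset (concat (tl ps))), hd ps, tl ps)"
          and j = "\<lambda>x. fst (snd x) # snd (snd x)"])
       (auto simp: factorizations_def permutations_of_multiset_def length_Suc_conv)
  finally show ?case .
qed

lemma gtwist_word_series:
  "gtwist ds e (word_series ds c) = word_series ds (\<lambda>p. sgn_pow (e * word_deg ds p) * (c p :: 'k::comm_ring_1))"
proof
  fix M
  have "sgn_pow (e * mon_degree ds M) = (sgn_pow (e * word_deg ds p) :: 'k)"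
    if "p \<in> permutations_of_multiset M" for p
    using that mon_degree_mset[of ds p] by (intro sgn_pow_cong) (auto simp: permutations_of_multiset_def)
  then show "gtwist ds e (word_series ds c) M =
      word_series ds (\<lambda>p. sgn_pow (e * word_deg ds p) * (c p :: 'k)) M"
    by (simp add: gtwist_def word_series_def sum_distrib_left mult.assoc)
qed

text \<open>
  The product computed by \<open>koszul_prod\<close>, except that the basis elements (of degrees \<open>de\<close>) and the
  variables (of degrees given by \<open>ds\<close>) may belong to different spaces.
\<close>

fun kprod :: "int list \<Rightarrow> int list \<Rightarrow> (nat \<Rightarrow> 'k::comm_ring_1 gseries) list \<Rightarrow> nat list \<Rightarrow> 'k gseries" where
  "kprod de ds (F # Fs) (i # is) = gmul ds (gtwist ds (word_deg de is) (F i)) (kprod de ds Fs is)"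
| "kprod de ds _ _ = gone"

lemma sum_nth_word_deg: "(\<Sum>b\<in>{a<..<length js}. ds ! (js ! b)) = word_deg ds (drop (Suc a) js)"
proof -
  have "word_deg ds (drop (Suc a) js) = (\<Sum>b = 0..<length js - Suc a. ds ! (js ! (Suc a + b)))"
    by (simp add: word_deg_def sum_list_sum_nth)
  also have "\<dots> = (\<Sum>b\<in>{a<..<length js}. ds ! (js ! b))"
    by (rule sum.reindex_bij_witness[where i = "\<lambda>b. b - Suc a" and j = "\<lambda>b. Suc a + b"]) auto
  finally show ?thesis ..
qed

lemma kprod_conv_gprod:
  "length Fs = length is \<Longrightarrow>
   kprod de ds Fs is = gprod ds (map (\<lambda>a. gtwist ds (word_deg de (drop (Suc a) is)) ((Fs ! a) (is ! a))) [0..<length is])"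
proof (induction Fs "is" rule: list_induct2)
  case (Cons F Fs i "is")
  then show ?case
    unfolding length_Cons map_upt_Suc by (simp add: gprod_def)
qed (simp add: gprod_def)

lemma koszul_prod_conv_kprod: "length Fs = length js \<Longrightarrow> koszul_prod ds Fs js = kprod ds ds Fs js"
  by (simp add: koszul_prod_def kprod_conv_gprod sum_nth_word_deg)

lemma kprod_cong:
  "list_all2 (\<lambda>F F'. \<forall>i\<in>set is. F i = F' i) Fs Fs' \<Longrightarrow> kprod de ds Fs is = kprod de ds Fs' is"
proof (induction de ds Fs "is" arbitrary: Fs' rule: kprod.induct)
  case (1 de ds F Fs i "is")
  from "1.prems" obtain F'' Fs'' where "Fs' = F'' # Fs''" "F i = F'' i"
    "list_all2 (\<lambda>F F'. \<forall>j\<in>set (i # is). F j = F' j) Fs Fs''"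
    by (auto simp: list_all2_Cons1)
  moreover from this(3) have "list_all2 (\<lambda>F F'. \<forall>i\<in>set is. F i = F' i) Fs Fs''"
    by (rule list_all2_mono) auto
  ultimately have "Fs' = F'' # Fs''" "F i = F'' i"
    "list_all2 (\<lambda>F F'. \<forall>i\<in>set is. F i = F' i) Fs Fs''"
    by auto
  with "1.IH"[of Fs''] show ?case by simp
qed (auto simp: list_all2_Cons1)

fun kterm :: "int list \<Rightarrow> int list \<Rightarrow> (nat \<Rightarrow> nat list \<Rightarrow> 'k::comm_ring_1) list \<Rightarrow> nat list \<Rightarrow> nat list list \<Rightarrow> 'k" where
  "kterm de ds (c # cs) (i # is) (p # ps) =
     sgn_pow (word_deg de is * word_deg ds p) * c i p * kterm de ds cs is ps"
| "kterm de ds _ _ _ = 1"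

text \<open>By \<open>gtwist_word_series\<close> a twist only changes the signs of the coefficients.
  So \<open>kprod\<close> is an ordinary product of series with modified coefficients, whose product
  along \<open>ps\<close> is \<open>kterm\<close>.\<close>

lemma kprod_word_series:
  assumes "length cs = length is" and "\<forall>c\<in>set cs. \<forall>i. c i [] = (0 :: 'k::comm_ring_1)"
  shows "kprod de ds (map (\<lambda>c i. word_series ds (c i)) cs) is L =
    (\<Sum>ps\<in>factorizations (length cs) L. kterm de ds cs is ps * var_sign ds (concat ps))"
proof -
  have "\<exists>cs'. length cs' = length cs \<and> (\<forall>c\<in>set cs'. c [] = (0 :: 'k)) \<and>
      kprod de ds (map (\<lambda>c i. word_series ds (c i)) cs) is = gprod ds (map (word_series ds) cs') \<and>
      (\<forall>ps. length ps = length cs \<longrightarrow> kterm de ds cs is ps = prod_list (map2 (\<lambda>c p. c p) cs' ps))"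
    using assms
  proof (induction cs "is" rule: list_induct2)
    case Nil
    then show ?case by (simp add: gprod_def)
  next
    case (Cons c cs i "is")
    then obtain cs' where cs': "length cs' = length cs" "\<forall>c\<in>set cs'. c [] = (0 :: 'k)"
      "kprod de ds (map (\<lambda>c i. word_series ds (c i)) cs) is = gprod ds (map (word_series ds) cs')"
      "\<forall>ps. length ps = length cs \<longrightarrow> kterm de ds cs is ps = prod_list (map2 (\<lambda>c p. c p) cs' ps)"
      by auto
    with Cons.prems show ?case
      by (intro exI[of _ "(\<lambda>p. sgn_pow (word_deg de is * word_deg ds p) * c i p) # cs'"])
         (auto simp: gtwist_word_series gprod_def length_Suc_conv)
  qed
  then obtain cs' where cs': "length cs' = length cs" "\<forall>c\<in>set cs'. c [] = (0 :: 'k)"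
    "kprod de ds (map (\<lambda>c i. word_series ds (c i)) cs) is = gprod ds (map (word_series ds) cs')"
    "\<forall>ps. length ps = length cs \<longrightarrow> kterm de ds cs is ps = prod_list (map2 (\<lambda>c p. c p) cs' ps)"
    by blast
  have "kterm de ds cs is ps = prod_list (map2 (\<lambda>c p. c p) cs' ps)"
    if "ps \<in> factorizations (length cs) L" for ps
    using that cs'(4) by (simp add: factorizations_def)
  then show ?thesis
    unfolding cs'(3) prod_word_series[OF cs'(2)] cs'(1) by simp
qed

section \<open>Graded commutation of homogeneous series, and their substitution for
  variables\<close>

lemma gmul_scale_right: "gmul ds F (\<lambda>M. c * H M) = (\<lambda>M. c * gmul ds F H (M :: nat multiset) :: 'k::comm_ring_1)"
  unfolding gmul_def sum_distrib_left by (intro ext sum.cong) (auto simp: mult_ac)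

lemma gmul_scale_left: "gmul ds (\<lambda>M. c * F M) H = (\<lambda>M. c * gmul ds F H (M :: nat multiset) :: 'k::comm_ring_1)"
  unfolding gmul_def sum_distrib_left by (intro ext sum.cong) (auto simp: mult_ac)

lemma gprod_Cons: "gprod ds (F # Fs) = gmul ds F (gprod ds Fs)"
  by (simp add: gprod_def)

text \<open>Only parities matter: each series is supported on words of one parity, so exchanging the
  first two factors costs the same sign in every factorization.\<close>

lemma gprod_word_series_swap:
  assumes "\<forall>c\<in>set (c1 # c2 # cs). c [] = (0 :: 'k::comm_ring_1)"
    and "\<And>p. c1 p \<noteq> 0 \<Longrightarrow> even (word_deg ds p - d1)" and "\<And>p. c2 p \<noteq> 0 \<Longrightarrow> even (word_deg ds p - d2)"
  shows "gprod ds (map (word_series ds) (c1 # c2 # cs)) =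
         (\<lambda>L. sgn_pow (d1 * d2) * gprod ds (map (word_series ds) (c2 # c1 # cs)) L)"
proof
  fix L
  let ?swap = "\<lambda>ps :: nat list list. ps ! 1 # ps ! 0 # drop 2 ps"
  let ?t = "\<lambda>cs ps. prod_list (map2 (\<lambda>c p. c p) cs ps) * (var_sign ds (concat ps) :: 'k)"
  have "gprod ds (map (word_series ds) (c1 # c2 # cs)) L =
      (\<Sum>ps\<in>factorizations (length cs + 2) L. ?t (c1 # c2 # cs) ps)"
    using assms(1) by (subst prod_word_series) auto
  also have "\<dots> = (\<Sum>ps\<in>factorizations (length cs + 2) L. sgn_pow (d1 * d2) * ?t (c2 # c1 # cs) ps)"
  proof (rule sum.reindex_bij_witness[where i = ?swap and j = ?swap], goal_cases)
    case (5 ps)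
    then obtain p q rs where ps: "ps = p # q # rs"
      by (auto simp: factorizations_def length_Suc_conv)
    have "c1 p * c2 q * var_sign ds (p @ q @ concat rs) =
        c1 p * c2 q * (sgn_pow (d1 * d2) * var_sign ds (q @ p @ concat rs))"
    proof (cases "c1 p = 0 \<or> c2 q = 0")
      case False
      then have "even (word_deg ds p - d1)" "even (word_deg ds q - d2)"
        using assms(2,3) by auto
      then have "sgn_pow (d1 * d2) = (sgn_pow (word_deg ds p * word_deg ds q) :: 'k)"
        by (intro sgn_pow_cong) auto
      then show ?thesis
        using mon_sign_commute[of ds p q, where ?'k = 'k]
        by (simp add: var_sign_append mon_sign_add_left mon_sign_add_right mult_ac)
    qed auto
    from arg_cong[OF this, of "(*) (prod_list (map2 (\<lambda>c p. c p) cs rs))"] show ?case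
      by (simp add: ps mult_ac)
  qed (auto simp: factorizations_def length_Suc_conv numeral_2_eq_2 add_ac)
  also have "\<dots> = sgn_pow (d1 * d2) * gprod ds (map (word_series ds) (c2 # c1 # cs)) L"
    using assms(1) by (subst prod_word_series) (auto simp: sum_distrib_left)
  finally show "gprod ds (map (word_series ds) (c1 # c2 # cs)) L =
      sgn_pow (d1 * d2) * gprod ds (map (word_series ds) (c2 # c1 # cs)) L" .
qed

lemma mon_sign_singletons: "mon_sign ds {#i#} {#j#} =
  (if i = j \<and> odd (ds ! i) then 0 else if j < i then sgn_pow (ds ! i * ds ! j) else 1)"
  by (auto simp: mon_sign_def)

text \<open>The series with index \<open>i\<close> has the parity of the variable with index
  \<open>i\<close>, so the series obey the commutation rules of the variables, and sorting either
  costs \<open>mon_sign\<close>. Its zeros at repeated odd variables correspond to the vanishing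
  squares of odd series.\<close>

lemma gprod_insort:
  fixes \<chi> :: "nat \<Rightarrow> nat list \<Rightarrow> 'k::field_char_0"
  assumes nil: "\<And>i. \<chi> i [] = 0" and deg: "\<And>i p. \<chi> i p \<noteq> 0 \<Longrightarrow> even (word_deg ds p - de ! i)"
  shows "sorted l \<Longrightarrow> gprod ds (map (\<lambda>i. word_series ds (\<chi> i)) (i # l)) =
    (\<lambda>L. mon_sign de {#i#} (mset l) * gprod ds (map (\<lambda>i. word_series ds (\<chi> i)) (insort i l)) L)"
proof (induction l)
  case (Cons a l)
  let ?X = "\<lambda>i. word_series ds (\<chi> i)"
  have swap: "gprod ds (map ?X (i # a # l)) = (\<lambda>L. sgn_pow (de ! i * de ! a) * gprod ds (map ?X (a # i # l)) L)"
    using gprod_word_series_swap[of "\<chi> i" "\<chi> a" "map \<chi> l" ds "de ! i" "de ! a"] nil deg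
    by (simp add: comp_def)
  have mon_Cons: "mon_sign de {#i#} (mset (a # l)) = mon_sign de {#i#} {#a#} * (mon_sign de {#i#} (mset l) :: 'k)"
    using mon_sign_add_right[of de "{#i#}" "{#a#}" "mset l"] by simp
  show ?case
  proof (cases "i \<le> a")
    case True
    have 1: "mon_sign de {#i#} (mset (a # l)) = (1 :: 'k)" if "\<not> (i \<in> set (a # l) \<and> odd (de ! i))"
    proof -
      have "filter_mset (\<lambda>j. j < i) (mset (a # l)) = {#}"
        using True Cons.prems by (fastforce simp: filter_mset_eq_conv)
      with that show ?thesis
        by (simp add: mon_sign_def)
    qed
    show ?thesis
    proof (cases "i \<in> set (a # l) \<and> odd (de ! i)")
      case odd: True
      then have "a = i"
        using True Cons.prems by auto
      \<comment> \<open>An odd series anticommutes with itself, so the product is its own negative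
        and vanishes in characteristic 0.\<close>
      with odd swap have "gprod ds (map ?X (i # a # l)) = (\<lambda>L. - gprod ds (map ?X (i # a # l)) L)"
        by (simp add: sgn_pow_def)
      then have "gprod ds (map ?X (i # a # l)) L = - gprod ds (map ?X (i # a # l)) L" for L
        by (rule fun_cong)
      then have "2 * gprod ds (map ?X (i # a # l)) L = 0" for L
        by (metis add.right_inverse mult_2)
      then have "gprod ds (map ?X (i # a # l)) L = 0" for L
        by simp
      with odd \<open>a = i\<close> mon_Cons show ?thesis
        by (auto simp: mon_sign_singletons)
    qed (use True 1 in auto)
  next
    case False
    have "gprod ds (map ?X (a # i # l)) =
        (\<lambda>L. mon_sign de {#i#} (mset l) * gprod ds (map ?X (a # insort i l)) L)"
      using Cons by (simp add: gprod_Cons gmul_scale_right)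
    with False swap show ?thesis
      unfolding mon_Cons by (simp add: mon_sign_singletons mult_ac)
  qed
qed simp

text \<open>\<open>gsubst\<close> substitutes into sorted monomials. This evaluates the substitution
  on an arbitrary word instead, so that it can be lifted to noncommutative series.\<close>

lemma gprod_sort:
  fixes \<chi> :: "nat \<Rightarrow> nat list \<Rightarrow> 'k::field_char_0"
  assumes "\<And>i. \<chi> i [] = 0" and "\<And>i p. \<chi> i p \<noteq> 0 \<Longrightarrow> even (word_deg ds p - de ! i)"
  shows "gprod ds (map (\<lambda>i. word_series ds (\<chi> i)) is) =
    (\<lambda>L. var_sign de is * gprod ds (map (\<lambda>i. word_series ds (\<chi> i)) (sort is)) L)"
proof (induction "is")
  case (Cons i "is")
  have "gprod ds (map (\<lambda>i. word_series ds (\<chi> i)) (i # is)) =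
     (\<lambda>L. var_sign de is * gprod ds (map (\<lambda>i. word_series ds (\<chi> i)) (i # sort is)) L)"
    using Cons by (simp add: gprod_Cons gmul_scale_right)
  also have "\<dots> = (\<lambda>L. var_sign de is * (mon_sign de {#i#} (mset (sort is)) *
        gprod ds (map (\<lambda>i. word_series ds (\<chi> i)) (insort i (sort is))) L))"
    using gprod_insort[where \<chi> = \<chi> and l = "sort is", OF assms] by simp
  finally show ?case
    by (simp add: mult_ac)
qed simp

text \<open>A series with the parity of \<open>de ! i\<close> moves past the later basis vectors at
  the same cost as the variable it replaces.\<close>

lemma twist_gprod:
  fixes \<chi> :: "nat \<Rightarrow> nat list \<Rightarrow> 'k::field_char_0"
  assumes "\<And>i p. \<chi> i p \<noteq> 0 \<Longrightarrow> even (word_deg ds p - de ! i)"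
  shows "kprod de ds (replicate (length is) (\<lambda>i. word_series ds (\<chi> i))) is =
    (\<lambda>L. twist_sign de is * gprod ds (map (\<lambda>i. word_series ds (\<chi> i)) is) L)"
proof (induction "is")
  case Nil
  then show ?case by (simp add: gprod_def)
next
  case (Cons i "is")
  have sgn: "sgn_pow (e * word_deg ds p) * \<chi> i p = sgn_pow (de ! i * e) * (\<chi> i p :: 'k)" for e p
  proof (cases "\<chi> i p = 0")
    case False
    with assms have "even (word_deg ds p - de ! i)"
      by blast
    then show ?thesis
      by (intro arg_cong2[where f = "(*)"] sgn_pow_cong) auto
  qed simp
  have gtwist: "gtwist ds e (word_series ds (\<chi> i)) = (\<lambda>M. sgn_pow (de ! i * e) * word_series ds (\<chi> i) M)" for e
    unfolding gtwist_word_series unfolding word_series_def sum_distrib_left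
    by (simp only: sgn mult.assoc[symmetric])
  show ?case
    unfolding length_Cons replicate_Suc kprod.simps gtwist Cons.IH gmul_scale_left gmul_scale_right
    by (simp add: gprod_Cons mult_ac)
qed

section \<open>Multilinear maps and homogeneous bases\<close>

lemma sum_lists_Suc:
  assumes "finite A"
  shows "(\<Sum>is | length is = Suc n \<and> set is \<subseteq> A. f is) =
         (\<Sum>i\<in>A. \<Sum>is | length is = n \<and> set is \<subseteq> A. f (i # is))"
proof -
  have "finite {is. length is = n \<and> set is \<subseteq> A}"
    using finite_lists_length_eq[OF assms, of n] by (simp add: conj_commute)
  then have "(\<Sum>i\<in>A. \<Sum>is | length is = n \<and> set is \<subseteq> A. f (i # is)) =
      (\<Sum>(i, is)\<in>A \<times> {is. length is = n \<and> set is \<subseteq> A}. f (i # is))"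
    using assms by (simp add: sum.cartesian_product)
  also have "\<dots> = (\<Sum>is | length is = Suc n \<and> set is \<subseteq> A. f is)"
    by (rule sum.reindex_bij_witness[where i = "\<lambda>is. (hd is, tl is)" and j = "\<lambda>(i, is). i # is"])
       (auto simp: length_Suc_conv)
  finally show ?thesis ..
qed

lemma multilinear_sum:
  assumes "multilinear s t k c" "length us + 1 + length ws = k"
  shows "c (us @ (\<Sum>i\<in>I. f i) # ws) = (\<Sum>i\<in>I. c (us @ f i # ws))"
proof -
  from assms interpret Vector_Spaces.linear s t "\<lambda>v. c (us @ v # ws)"
    by (auto simp: multilinear_def)
  show ?thesis by (rule sum)
qed

lemma multilinear_scale:
  assumes "multilinear s t k c" "length us + 1 + length ws = k"
  shows "c (us @ s r v # ws) = t r (c (us @ v # ws))"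
proof -
  from assms interpret Vector_Spaces.linear s t "\<lambda>v. c (us @ v # ws)"
    by (auto simp: multilinear_def)
  show ?thesis by (rule scale)
qed

lemma multilinear_add:
  assumes "multilinear s t k c" "length us + 1 + length ws = k"
  shows "c (us @ (v + w) # ws) = c (us @ v # ws) + c (us @ w # ws)"
proof -
  from assms interpret Vector_Spaces.linear s t "\<lambda>v. c (us @ v # ws)"
    by (auto simp: multilinear_def)
  show ?thesis by (rule add)
qed

lemma multilinear_zero:
  assumes "multilinear s t k c" "length us + 1 + length ws = k"
  shows "c (us @ 0 # ws) = 0"
  using multilinear_sum[OF assms, of "\<lambda>_. undefined" "{}"] by simp

locale graded_basis = graded_vector_space scale G
  for scale :: "'k::field_char_0 \<Rightarrow> 'a::ab_group_add \<Rightarrow> 'a" and G +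
  fixes es :: "'a list" and ds :: "int list"
  assumes homogeneous_basis: "homogeneous_basis scale G es ds"
begin

lemma distinct_basis: "distinct es"
  and length_degrees [simp]: "length ds = length es"
  and basis_component: "i < length es \<Longrightarrow> es ! i \<in> G (ds ! i + 1)"
  using homogeneous_basis by (auto simp: homogeneous_basis_def homogeneous_def list_all2_conv_all_nth)

lemma independent_basis: "independent (set es)" and span_basis: "span (set es) = UNIV"
proof -
  interpret fd: finite_dimensional_vector_space scale "set es"
    using homogeneous_basis by (simp add: homogeneous_basis_def)
  show "independent (set es)" by (rule fd.independent_Basis)
  show "span (set es) = UNIV" by (rule fd.span_Basis)
qed

abbreviation coord :: "'a \<Rightarrow> nat \<Rightarrow> 'k" where
  "coord \<equiv> coordinate scale es"

lemma basis_expansion: "v = (\<Sum>i<length es. scale (coord v i) (es ! i))"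
proof -
  have "v = (\<Sum>e\<in>set es. scale (representation (set es) v e) e)"
    using sum_representation_eq[OF independent_basis, of v "set es"] span_basis by simp
  also have "\<dots> = (\<Sum>i<length es. scale (coord v i) (es ! i))"
    using bij_betw_nth[OF distinct_basis refl refl]
    by (subst sum.reindex_bij_betw[symmetric, where h = "(!) es"]) (auto simp: coordinate_def)
  finally show ?thesis .
qed

lemma coord_basis: "i < length es \<Longrightarrow> j < length es \<Longrightarrow> coord (es ! j) i = (if i = j then 1 else 0)"
  using distinct_basis independent_basis
  by (auto simp: coordinate_def representation_basis nth_eq_iff_index_eq)

lemma coord_zero [simp]: "coord 0 i = 0"
  by (simp add: coordinate_def representation_zero)

text \<open>The basis expansion of \<open>v\<close> grouped by degree and \<open>v\<close> alone in
  degree \<open>d + 1\<close> are two decompositions into homogeneous components. By uniqueness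
  every other group vanishes, and by independence so do its coordinates.\<close>

lemma coord_nonzero_degree:
  assumes v: "v \<in> G (d + 1)" and i: "i < length es" and nz: "coord v i \<noteq> 0"
  shows "ds ! i = d"
proof (rule ccontr)
  assume ne: "ds ! i \<noteq> d"
  define part where "part = (\<lambda>e. \<Sum>j | j < length es \<and> ds ! j + 1 = e. scale (coord v j) (es ! j))"
  have part: "part e \<in> G e" for e
    unfolding part_def
    using basis_component by (intro subspace_sum subspace_component subspace_scale) auto
  have fin: "finite {e. part e \<noteq> 0}"
  proof (rule finite_subset)
    show "{e. part e \<noteq> 0} \<subseteq> (\<lambda>j. ds ! j + 1) ` {..<length es}"
      by (auto simp: part_def elim: sum.not_neutral_contains_not_neutral)
  qed simp
  have "v = (\<Sum>j<length es. scale (coord v j) (es ! j))"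
    by (rule basis_expansion)
  also have "\<dots> = (\<Sum>e\<in>(\<lambda>j. ds ! j + 1) ` {..<length es}. part e)"
    unfolding part_def by (subst sum.group[symmetric, where g = "\<lambda>j. ds ! j + 1"]) auto
  also have "\<dots> = (\<Sum>e | part e \<noteq> 0. part e)"
    by (rule sum.mono_neutral_right)
       (auto simp: part_def elim: sum.not_neutral_contains_not_neutral)
  finally have "v = (\<Sum>e | part e \<noteq> 0. part e)" .
  moreover define single where "single = (\<lambda>e. if e = d + 1 then v else 0)"
  have "(\<forall>e. single e \<in> G e) \<and> finite {e. single e \<noteq> 0} \<and> v = (\<Sum>e | single e \<noteq> 0. single e)"
  proof (intro conjI)
    show "\<forall>e. single e \<in> G e"
      using v subspace_0[OF subspace_component] by (auto simp: single_def)
    have "{e. single e \<noteq> 0} = (if v = 0 then {} else {d + 1})"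
      by (auto simp: single_def)
    then show "finite {e. single e \<noteq> 0}" "v = (\<Sum>e | single e \<noteq> 0. single e)"
      by (auto simp: single_def)
  qed
  ultimately have "part = single"
    using direct_sum[of v] part fin by blast
  then have "part (ds ! i + 1) = 0"
    using ne by (simp add: single_def)
  moreover have "part (ds ! i + 1) =
      (\<Sum>e\<in>(!) es ` {j. j < length es \<and> ds ! j + 1 = ds ! i + 1}. scale (representation (set es) v e) e)"
    unfolding part_def using distinct_basis
    by (subst sum.reindex) (auto simp: inj_on_def nth_eq_iff_index_eq coordinate_def)
  moreover have "independent ((!) es ` {j. j < length es \<and> ds ! j + 1 = ds ! i + 1})"
    by (rule independent_mono[OF independent_basis]) auto
  ultimately have "representation (set es) v (es ! i) = 0"
    using i by (intro independentD[where s = "(!) es ` {j. j < length es \<and> ds ! j + 1 = ds ! i + 1}"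
        and t = "(!) es ` {j. j < length es \<and> ds ! j + 1 = ds ! i + 1}"
        and u = "representation (set es) v"]) auto
  with nz show False
    by (simp add: coordinate_def)
qed

lemma multilinear_expansion:
  assumes "multilinear scale (*) k c" "length us + length vs = k"
  shows "c (us @ vs) = (\<Sum>is | length is = length vs \<and> set is \<subseteq> {..<length es}.
           prod_list (map2 coord vs is) * c (us @ map ((!) es) is))"
  using assms(2)
proof (induction vs arbitrary: us)
  case Nil
  have "{is. length is = length ([] :: 'a list) \<and> set is \<subseteq> {..<length es}} = {[]}"
    by auto
  then show ?case by (simp only:) simp
next
  case (Cons v vs)
  have "c (us @ v # vs) = c (us @ (\<Sum>i<length es. scale (coord v i) (es ! i)) # vs)"
    using basis_expansion[of v] by simp
  also have "\<dots> = (\<Sum>i<length es. coord v i * c ((us @ [es ! i]) @ vs))"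
    using Cons.prems
    by (simp add: multilinear_sum[OF assms(1)] multilinear_scale[OF assms(1)])
  also have "\<dots> = (\<Sum>i<length es. coord v i * (\<Sum>is | length is = length vs \<and> set is \<subseteq> {..<length es}.
           prod_list (map2 coord vs is) * c ((us @ [es ! i]) @ map ((!) es) is)))"
    using Cons.prems by (intro sum.cong refl arg_cong2[where f = "(*)"] Cons.IH) auto
  also have "\<dots> = (\<Sum>is | length is = length (v # vs) \<and> set is \<subseteq> {..<length es}.
           prod_list (map2 coord (v # vs) is) * c (us @ map ((!) es) is))"
    unfolding length_Cons by (subst sum_lists_Suc) (auto simp: sum_distrib_left mult.assoc)
  finally show ?case .
qed

end

section \<open>Applying operations to a word cut into strings\<close>

text \<open>
  The Koszul exponent of applying operations of degrees \<open>gs\<close> to consecutive strings of total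
  degrees \<open>dds\<close>: each operation moves past the strings to its left.
\<close>

fun kos :: "int list \<Rightarrow> int list \<Rightarrow> int" where
  "kos (g # gs) (d # dds) = d * sum_list gs + kos gs dds"
| "kos _ _ = 0"

lemma word_deg_map: "word_deg ds js = sum_list (map ((!) ds) js)"
  by (simp add: word_deg_def)

context graded_basis
begin

text \<open>The coefficient of the \<open>i\<close>-th basis vector in f(x, ..., x) at the word
  \<open>p\<close>. It contains only \<open>twist_sign\<close>, since \<open>word_series\<close>
  adds \<open>var_sign\<close>. \<open>I\<close> is the set of valid indices: monomials may also
  contain indices beyond the basis.\<close>

definition op_coeff :: "int list \<Rightarrow> nat set \<Rightarrow> (nat list \<Rightarrow> 'a) \<Rightarrow> nat \<Rightarrow> nat list \<Rightarrow> 'k" where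
  "op_coeff df I f i p = (if set p \<subseteq> I then twist_sign df p * coord (f p) i else 0)"

lemma degrees_of_nonzero_coords:
  assumes "list_all2 (\<lambda>f g. \<forall>p. set p \<subseteq> I \<longrightarrow> f p \<in> G (word_deg df p + g + 1)) fs gs"
    and "length is = length fs" "length ps = length fs"
    and "set is \<subseteq> {..<length es}" "set (concat ps) \<subseteq> I"
    and "prod_list (map2 coord (map2 (\<lambda>f p. f p) fs ps) is) \<noteq> 0"
  shows "map ((!) ds) is = map2 (\<lambda>g p. word_deg df p + g) gs ps"
  using assms
proof (induction arbitrary: "is" ps rule: list_all2_induct)
  case (Cons f fs g gs)
  from Cons.prems obtain i is' p ps' where eq: "is = i # is'" "ps = p # ps'"
    by (auto simp: length_Suc_conv)
  from Cons.hyps(1) Cons.prems have "f p \<in> G ((word_deg df p + g) + 1)"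
    by (simp add: eq)
  then have "ds ! i = word_deg df p + g"
    using Cons.prems by (intro coord_nonzero_degree) (auto simp: eq)
  moreover have "map ((!) ds) is' = map2 (\<lambda>g p. word_deg df p + g) gs ps'"
    using Cons.prems by (intro Cons.IH) (auto simp: eq)
  ultimately show ?case
    by (simp add: eq)
qed simp

text \<open>If the coordinates do not vanish, each basis vector has the degree of its word plus that
  of its operation. Moving a word past later basis vectors thus costs a word-past-words sign, which
  completes the twist sign of the concatenation, and a word-past-operations sign, which is
  \<open>kos\<close>.\<close>

lemma kterm_op_coeff:
  assumes "list_all2 (\<lambda>f g. \<forall>p. set p \<subseteq> I \<longrightarrow> f p \<in> G (word_deg df p + g + 1)) fs gs"
    and "length is = length fs" "length ps = length fs"
    and "set is \<subseteq> {..<length es}" "set (concat ps) \<subseteq> I"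
  shows "kterm ds df (map (op_coeff df I) fs) is ps =
      twist_sign df (concat ps) * sgn_pow (kos gs (map (word_deg df) ps)) *
      prod_list (map2 coord (map2 (\<lambda>f p. f p) fs ps) is)"
  using assms
proof (induction arbitrary: "is" ps rule: list_all2_induct)
  case (Cons f fs g gs)
  from Cons.prems obtain i is' p ps' where eq: "is = i # is'" "ps = p # ps'"
    by (auto simp: length_Suc_conv)
  let ?R = "prod_list (map2 coord (map2 (\<lambda>f p. f p) fs ps') is')"
  have IH: "kterm ds df (map (op_coeff df I) fs) is' ps' =
      twist_sign df (concat ps') * sgn_pow (kos gs (map (word_deg df) ps')) * ?R"
    using Cons.prems by (intro Cons.IH) (auto simp: eq)
  show ?case
  proof (cases "?R = 0")
    case True
    with IH show ?thesis by (simp add: eq)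
  next
    case False
    have "map ((!) ds) is' = map2 (\<lambda>g p. word_deg df p + g) gs ps'"
      using Cons.prems Cons.hyps False
      by (intro degrees_of_nonzero_coords[of I df fs]) (auto simp: eq)
    moreover have "length gs = length ps'"
      using Cons.hyps Cons.prems by (auto simp: eq dest: list_all2_lengthD)
    then have "sum_list (map2 (\<lambda>g p. word_deg df p + g) gs ps') = word_deg df (concat ps') + sum_list gs"
      by (induction gs ps' rule: list_induct2) auto
    ultimately have "word_deg ds is' = word_deg df (concat ps') + sum_list gs"
      by (simp add: word_deg_map)
    moreover have "op_coeff df I f i p = twist_sign df p * coord (f p) i"
      using Cons.prems by (simp add: op_coeff_def eq)
    ultimately show ?thesis
      unfolding eq list.map kterm.simps IH
      by (simp add: twist_sign_append sgn_pow_add distrib_left distrib_right mult_ac)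
  qed
qed simp

lemma kterm_out_of_range:
  "length is = length fs \<Longrightarrow> length ps = length fs \<Longrightarrow> \<not> set (concat ps) \<subseteq> I \<Longrightarrow>
   kterm de df (map (op_coeff df I) fs) is ps = 0"
proof (induction fs arbitrary: "is" ps)
  case (Cons f fs)
  then obtain i is' p ps' where "is = i # is'" "ps = p # ps'" "length is' = length fs" "length ps' = length fs"
    by (auto simp: length_Suc_conv)
  with Cons show ?case
    by (cases "set p \<subseteq> I") (auto simp: op_coeff_def)
qed simp

lemma kprod_out_of_range:
  assumes "\<forall>f\<in>set fs. f [] = 0" and "length is = length fs" and "\<not> set_mset M \<subseteq> I"
  shows "kprod de df (map (\<lambda>f i. word_series df (op_coeff df I f i)) fs) is M = 0"
proof -
  have "\<forall>c\<in>set (map (op_coeff df I) fs). \<forall>i. c i [] = 0"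
    using assms(1) by (auto simp: op_coeff_def)
  then have "kprod de df (map (\<lambda>f i. word_series df (op_coeff df I f i)) fs) is M =
    (\<Sum>ps\<in>factorizations (length fs) M. kterm de df (map (op_coeff df I) fs) is ps * var_sign df (concat ps))"
    using kprod_word_series[of "map (op_coeff df I) fs" "is" de df M] assms(2) by (simp add: comp_def)
  also have "\<dots> = 0"
  proof (rule sum.neutral, rule ballI)
    fix ps assume "ps \<in> factorizations (length fs) M"
    then have "length ps = length fs" "set (concat ps) = set_mset M"
      by (auto simp: factorizations_def simp flip: set_mset_mset)
    with assms(2,3) show "kterm de df (map (op_coeff df I) fs) is ps * var_sign df (concat ps) = 0"
      by (simp add: kterm_out_of_range)
  qed
  finally show ?thesis .
qed

text \<open>Inserting the series of the operations into a form means, word by word, evaluating the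
  form at their values. \<open>C\<close> takes the degrees separately because the potential form
  contains signs and is linear in the vectors only for fixed degrees: the degrees of the basis
  vectors must first be replaced by those read off from the words.\<close>

lemma sum_kprod_op_coeff:
  assumes fs: "list_all2 (\<lambda>f g. \<forall>p. set p \<subseteq> I \<longrightarrow> f p \<in> G (word_deg df p + g + 1)) fs gs"
    and nil: "\<forall>f\<in>set fs. f [] = 0"
    and C: "\<And>dds. multilinear scale (*) (length fs) (\<lambda>xs. C xs dds)"
    and M: "set_mset M \<subseteq> I"
  shows "(\<Sum>is | length is = length fs \<and> set is \<subseteq> {..<length es}.
            C (map ((!) es) is) (map ((!) ds) is) *
            kprod ds df (map (\<lambda>f i. word_series df (op_coeff df I f i)) fs) is M) =
    (\<Sum>ps\<in>factorizations (length fs) M.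
            word_sign df (concat ps) * sgn_pow (kos gs (map (word_deg df) ps)) *
            C (map2 (\<lambda>f p. f p) fs ps) (map2 (\<lambda>g p. word_deg df p + g) gs ps))"
    (is "?L = ?R")
proof -
  let ?I = "{is. length is = length fs \<and> set is \<subseteq> {..<length es}}"
  let ?e = "\<lambda>ps. twist_sign df (concat ps) * sgn_pow (kos gs (map (word_deg df) ps)) * (var_sign df (concat ps) :: 'k)"
  let ?p = "\<lambda>ps is. prod_list (map2 coord (map2 (\<lambda>f p. f p) fs ps) is)"
  have nil_coeff: "\<forall>c\<in>set (map (op_coeff df I) fs). \<forall>i. c i [] = 0"
    using nil by (auto simp: op_coeff_def)
  have "?L = (\<Sum>is\<in>?I. C (map ((!) es) is) (map ((!) ds) is) *
      (\<Sum>ps\<in>factorizations (length fs) M.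
        kterm ds df (map (op_coeff df I) fs) is ps * var_sign df (concat ps)))"
  proof (intro sum.cong refl arg_cong2[where f = "(*)"])
    fix "is" assume "is \<in> ?I"
    then show "kprod ds df (map (\<lambda>f i. word_series df (op_coeff df I f i)) fs) is M =
      (\<Sum>ps\<in>factorizations (length fs) M. kterm ds df (map (op_coeff df I) fs) is ps * var_sign df (concat ps))"
      using kprod_word_series[of "map (op_coeff df I) fs" "is" ds df M] nil_coeff
      by (simp add: comp_def)
  qed
  also have "\<dots> = (\<Sum>ps\<in>factorizations (length fs) M. \<Sum>is\<in>?I.
      C (map ((!) es) is) (map ((!) ds) is) *
        kterm ds df (map (op_coeff df I) fs) is ps * var_sign df (concat ps))"
    unfolding sum_distrib_left by (subst sum.swap) (simp add: mult.assoc)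
  \<comment> \<open>A nonzero product of coordinates determines the degrees of the basis vectors;
    otherwise both sides vanish.\<close>
  also have "\<dots> = (\<Sum>ps\<in>factorizations (length fs) M. \<Sum>is\<in>?I.
      ?e ps * (?p ps is * C (map ((!) es) is) (map2 (\<lambda>g p. word_deg df p + g) gs ps)))"
  proof (intro sum.cong refl)
    fix ps "is" assume ps: "ps \<in> factorizations (length fs) M" and "is": "is \<in> ?I"
    have len: "length ps = length fs" and "set (concat ps) = set_mset M"
      using ps by (auto simp: factorizations_def simp flip: set_mset_mset)
    then have I: "set (concat ps) \<subseteq> I"
      using M by simp
    show "C (map ((!) es) is) (map ((!) ds) is) *
        kterm ds df (map (op_coeff df I) fs) is ps * var_sign df (concat ps) =
      ?e ps * (?p ps is * C (map ((!) es) is) (map2 (\<lambda>g p. word_deg df p + g) gs ps))"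
    proof (cases "?p ps is = 0")
      case True
      then show ?thesis
        using kterm_op_coeff[OF fs _ len _ I, of "is"] "is" by simp
    next
      case False
      with degrees_of_nonzero_coords[OF fs _ len _ I, of "is"] kterm_op_coeff[OF fs _ len _ I, of "is"] "is"
      show ?thesis by (simp add: mult_ac)
    qed
  qed
  also have "\<dots> = ?R"
  proof (intro sum.cong refl)
    fix ps assume "ps \<in> factorizations (length fs) M"
    then have len: "length ps = length fs"
      by (simp add: factorizations_def)
    have "C (map2 (\<lambda>f p. f p) fs ps) dds = (\<Sum>is\<in>?I. ?p ps is * C (map ((!) es) is) dds)" for dds
      using multilinear_expansion[OF C, of "[]" "map2 (\<lambda>f p. f p) fs ps"] len by simp
    then show "(\<Sum>is\<in>?I. ?e ps * (?p ps is * C (map ((!) es) is) (map2 (\<lambda>g p. word_deg df p + g) gs ps))) =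
       word_sign df (concat ps) * sgn_pow (kos gs (map (word_deg df) ps)) *
            C (map2 (\<lambda>f p. f p) fs ps) (map2 (\<lambda>g p. word_deg df p + g) gs ps)"
      by (simp add: sum_distrib_left[symmetric] word_sign_def mult_ac)
  qed
  finally show ?thesis .
qed

end

section \<open>Inserting one operation into a word\<close>

lemma map_singleton_concat:
  "map length ps = replicate n (Suc 0) \<Longrightarrow> ps = map (\<lambda>j. [j]) (concat ps) \<and> length (concat ps) = n"
proof (induction ps arbitrary: n)
  case (Cons p ps)
  then obtain n' where "n = Suc n'"
    by (cases n) auto
  with Cons show ?case
    by (auto simp: length_Suc_conv)
qed auto

lemma multilinear_zero_mem:
  assumes "multilinear s t k c" "length xs = k" "0 \<in> set xs"
  shows "c xs = 0"
  using split_list[OF assms(3)] assms(2) multilinear_zero[OF assms(1)] by auto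

lemma lengths_if_no_zero:
  assumes "list_all2 (\<lambda>f l. \<forall>p. length p \<noteq> l \<longrightarrow> f p = 0) fs ls" "length ps = length fs"
    and "0 \<notin> set (map2 (\<lambda>f p. f p) fs ps)"
  shows "map length ps = ls"
  using assms
proof (induction arbitrary: ps rule: list_all2_induct)
  case (Cons f fs l ls)
  then show ?case
    by (cases ps) auto
qed simp

lemma kos_zero: "kos (replicate r 0) x = 0"
proof (induction r arbitrary: x)
  case (Suc r)
  then show ?case by (cases x) (auto simp: sum_list_replicate)
qed simp

lemma kos_one:
  "kos (replicate (length u) 0 @ 1 # replicate r 0) (map (word_deg ds) (map (\<lambda>j. [j]) u) @ d # x) = word_deg ds u"
  by (induction u) (auto simp: kos_zero sum_list_replicate)

definition split_word :: "nat \<Rightarrow> nat \<Rightarrow> nat list \<Rightarrow> nat list list" where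
  "split_word p k w = map (\<lambda>j. [j]) (take p w) @ take k (drop p w) # map (\<lambda>j. [j]) (drop (p + k) w)"

lemma concat_split_word: "p + k \<le> length w \<Longrightarrow> concat (split_word p k w) = w"
  by (simp add: split_word_def concat_map_singleton[of "\<lambda>x. x", simplified])
     (metis append_take_drop_id drop_drop add.commute)

lemma map_length_split_word:
  "length w = p + k + r \<Longrightarrow> map length (split_word p k w) = replicate p 1 @ k # replicate r 1"
  by (simp add: split_word_def comp_def map_replicate_const)

lemma split_word_concat:
  assumes "map length ps = replicate p 1 @ k # replicate r 1"
  shows "split_word p k (concat ps) = ps" "length (concat ps) = p + k + r"
proof -
  from assms obtain us v ts where ps: "ps = us @ v # ts" and us: "map length us = replicate p (Suc 0)"
    and v: "length v = k" and ts: "map length ts = replicate r (Suc 0)"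
    by (auto simp: map_eq_append_conv map_eq_Cons_conv)
  note 1 = map_singleton_concat[OF us] map_singleton_concat[OF ts]
  then have "split_word p k (concat ps) = map (\<lambda>j. [j]) (concat us) @ v # map (\<lambda>j. [j]) (concat ts)"
    by (simp add: split_word_def ps v)
  with 1 show "split_word p k (concat ps) = ps" by (simp add: ps)
  from 1 show "length (concat ps) = p + k + r" by (simp add: ps v)
qed

context graded_basis
begin

text \<open>The identity as an operation of arity 1 and degree 0; it puts the generic element and
  the outputs of \<open>m\<close> on the same footing.\<close>

definition basis_op :: "nat list \<Rightarrow> 'a" where
  "basis_op p = (if length p = 1 then es ! hd p else 0)"

definition restrict_op :: "nat \<Rightarrow> ('a list \<Rightarrow> 'c::zero) \<Rightarrow> nat list \<Rightarrow> 'c" where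
  "restrict_op k f p = (if length p = k then f (map ((!) es) p) else 0)"

lemma word_series_delta: "gvar i = word_series ds (\<lambda>p. if p = [i] then 1 else (0 :: 'k))"
proof
  fix M
  have "word_series ds (\<lambda>p. if p = [i] then 1 else 0) M =
      (\<Sum>js\<in>permutations_of_multiset M. if js = [i] then 1 else (0 :: 'k))"
    unfolding word_series_def by (intro sum.cong) auto
  also have "\<dots> = (if [i] \<in> permutations_of_multiset M then 1 else 0)"
    by simp
  finally show "gvar i M = word_series ds (\<lambda>p. if p = [i] then 1 else (0 :: 'k)) M"
    by (auto simp: gvar_def permutations_of_multiset_def)
qed

lemma gvar_eq: "i < length es \<Longrightarrow> gvar i = word_series ds (op_coeff ds {..<length es} basis_op i)"
  unfolding word_series_delta
  by (rule arg_cong[where f = "word_series ds"])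
     (auto simp: op_coeff_def basis_op_def coord_basis length_Suc_conv fun_eq_iff split: if_splits)

lemma kterm_delta:
  "length ps = length js \<Longrightarrow>
   kterm ds ds (replicate (length js) (\<lambda>i p. if p = [i] then 1 else (0 :: 'k))) js ps =
     (if ps = map (\<lambda>j. [j]) js then twist_sign ds js else 0)"
proof (induction js arbitrary: ps)
  case (Cons j js)
  then obtain p ps' where "ps = p # ps'" "length ps' = length js"
    by (auto simp: length_Suc_conv)
  with Cons.IH show ?case
    by (auto simp: mult_ac)
qed simp

text \<open>Only the factorization of \<open>js\<close> into its letters contributes.\<close>

lemma koszul_prod_gvar:
  assumes "length js = n"
  shows "koszul_prod ds (replicate n gvar) js M = (if mset js = M then word_sign ds js else (0 :: 'k))"
proof -
  let ?\<delta> = "\<lambda>i p. if p = [i] then 1 else (0 :: 'k)"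
  have "koszul_prod ds (replicate n gvar) js M = kprod ds ds (map (\<lambda>c i. word_series ds (c i)) (replicate n ?\<delta>)) js M"
    using assms by (simp add: koszul_prod_conv_kprod word_series_delta[symmetric])
  also have "\<dots> = (\<Sum>ps\<in>factorizations n M. kterm ds ds (replicate n ?\<delta>) js ps * var_sign ds (concat ps))"
    using assms by (subst kprod_word_series) auto
  also have "\<dots> = (\<Sum>ps\<in>factorizations n M. if ps = map (\<lambda>j. [j]) js then word_sign ds js else 0)"
    using kterm_delta[of _ js] assms
    by (intro sum.cong refl) (auto simp: factorizations_def word_sign_def concat_map_singleton[of "\<lambda>x. x", simplified])
  also have "\<dots> = (if mset js = M then word_sign ds js else 0)"
  proof -
    have "map (\<lambda>j. [j]) js \<in> factorizations n M \<longleftrightarrow> mset js = M"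
      using assms by (auto simp: factorizations_def concat_map_singleton[of "\<lambda>x. x", simplified])
    then show ?thesis by simp
  qed
  finally show ?thesis .
qed

lemma ext_form_gvar:
  "ext_form es ds c (replicate n gvar) M =
     (\<Sum>w | w \<in> permutations_of_multiset M \<and> set w \<subseteq> {..<length es} \<and> length w = n.
        c (map ((!) es) w) * (word_sign ds w :: 'k))"
proof -
  have "finite {w. length w = n \<and> set w \<subseteq> {..<length es}}"
    using finite_lists_length_eq[of "{..<length es}" n] by (simp add: conj_commute)
  moreover have "ext_form es ds c (replicate n gvar) M =
      (\<Sum>w | length w = n \<and> set w \<subseteq> {..<length es}.
         if mset w = M then c (map ((!) es) w) * (word_sign ds w :: 'k) else 0)"
    by (auto simp: ext_form_def koszul_prod_gvar intro!: sum.cong)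
  ultimately show ?thesis
    by (simp add: sum.inter_filter[symmetric] permutations_of_multiset_def conj_ac)
qed

end

lemma (in graded_basis) ext_op_gvar:
  fixes scale' :: "'k \<Rightarrow> 'c::ab_group_add \<Rightarrow> 'c"
  assumes "graded_basis scale' G' es' ds'"
  shows "ext_op es ds scale' es' f (replicate k gvar) i =
    word_series ds (graded_basis.op_coeff scale' es' ds {..<length es} (restrict_op k f) i)"
proof
  interpret target: graded_basis scale' G' es' ds' by fact
  fix M
  show "ext_op es ds scale' es' f (replicate k gvar) i M =
    word_series ds (graded_basis.op_coeff scale' es' ds {..<length es} (restrict_op k f) i) M"
    unfolding ext_op_def ext_form_gvar word_series_def
    by (rule sum.mono_neutral_cong_left)
       (auto simp: target.op_coeff_def restrict_op_def word_sign_def)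
qed

text \<open>Evaluates one summand of a potential. The sign is that of moving the odd operation past
  the \<open>p\<close> entries to its left.\<close>

lemma (in graded_basis) ext_form_insert_op:
  fixes c :: "'a list \<Rightarrow> 'k"
  assumes c: "multilinear scale (*) (p + q + 2) c" and k: "1 \<le> k"
    and f: "\<And>w. length w = k \<Longrightarrow> set w \<subseteq> {..<length es} \<Longrightarrow> f (map ((!) es) w) \<in> G (word_deg ds w + 1 + 1)"
  shows "ext_form es ds c (replicate p gvar @ ext_op es ds scale es f (replicate k gvar) # replicate q gvar @ [gvar]) M =
    (\<Sum>w | w \<in> permutations_of_multiset M \<and> set w \<subseteq> {..<length es} \<and> length w = p + k + q + 1.
       word_sign ds w * sgn_pow (word_deg ds (take p w)) *
       c (map ((!) es) (take p w) @ f (map ((!) es) (take k (drop p w))) # map ((!) es) (drop (p + k) w)))"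
proof -
  \<comment> \<open>The \<open>q\<close> entries on the right and the argument of the dual are all
    generic.\<close>
  let ?n = "length es" and ?r = "Suc q"
  let ?Fs = "replicate p gvar @ ext_op es ds scale es f (replicate k gvar) # replicate q gvar @ [gvar]"
  define ops where "ops = replicate p basis_op @ restrict_op k f # replicate ?r basis_op"
  define gs where "gs = replicate p 0 @ (1 :: int) # replicate ?r 0"
  let ?N = "p + q + 2"
  let ?t = "\<lambda>ps. word_sign ds (concat ps) * sgn_pow (kos gs (map (word_deg ds) ps)) * c (map2 (\<lambda>f p. f p) ops ps)"
  let ?W = "{w. w \<in> permutations_of_multiset M \<and> set w \<subseteq> {..<?n} \<and> length w = p + k + q + 1}"
  have len_ops: "length ops = ?N" by (simp add: ops_def)
  have Fs: "replicate q gvar @ [gvar] = replicate ?r gvar"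
    by (simp add: replicate_append_same)
  have ext: "ext_form es ds c ?Fs M =
      (\<Sum>is | length is = length ops \<and> set is \<subseteq> {..<?n}.
         c (map ((!) es) is) * kprod ds ds (map (\<lambda>f i. word_series ds (op_coeff ds {..<?n} f i)) ops) is M)"
    unfolding ext_form_def Fs
  proof (rule sum.cong, goal_cases)
    case 1
    show ?case by (simp add: ops_def)
  next
    case (2 "is")
    have "list_all2 (\<lambda>F F'. \<forall>i\<in>set is. F i = F' i)
       (replicate p gvar @ ext_op es ds scale es f (replicate k gvar) # replicate ?r gvar)
       (map (\<lambda>f i. word_series ds (op_coeff ds {..<?n} f i)) ops)"
      unfolding ops_def map_append list.map map_replicate ext_op_gvar[OF graded_basis_axioms]
      using 2 by (intro list_all2_appendI list.rel_intros) (auto simp: list_all2_conv_all_nth gvar_eq simp del: replicate_Suc)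
    from kprod_cong[OF this] 2 show ?case
      by (simp add: koszul_prod_conv_kprod len_ops del: replicate_Suc)
  qed
  show ?thesis
  proof (cases "set_mset M \<subseteq> {..<?n}")
    case False
    moreover have "\<forall>f\<in>set ops. f [] = 0"
      using k by (auto simp: ops_def basis_op_def restrict_op_def)
    ultimately have "kprod ds ds (map (\<lambda>f i. word_series ds (op_coeff ds {..<?n} f i)) ops) is M = 0"
      if "length is = length ops" for "is"
      using that by (intro kprod_out_of_range)
    moreover have W: "?W = {}"
      using False by (auto simp: permutations_of_multiset_def)
    ultimately show ?thesis
      unfolding ext W by simp
  next
    case True
    have "ext_form es ds c ?Fs M = (\<Sum>ps\<in>factorizations (length ops) M. ?t ps)"
      unfolding ext
    proof (rule sum_kprod_op_coeff[where C = "\<lambda>xs _. c xs"])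
      show "list_all2 (\<lambda>f g. \<forall>p. set p \<subseteq> {..<?n} \<longrightarrow> f p \<in> G (word_deg ds p + g + 1)) ops gs"
        unfolding ops_def gs_def using f subspace_0[OF subspace_component] basis_component
        by (intro list_all2_appendI list.rel_intros)
           (auto simp: list_all2_conv_all_nth restrict_op_def basis_op_def length_Suc_conv simp del: replicate_Suc)
      show "\<forall>f\<in>set ops. f [] = 0"
        using k by (auto simp: ops_def basis_op_def restrict_op_def)
    qed (use c True len_ops in auto)
    \<comment> \<open>An operation is 0 on words of the wrong length, so only factorizations of this
      shape survive; they are determined by their concatenation.\<close>
    also have "\<dots> = (\<Sum>ps | ps \<in> factorizations (length ops) M \<and> map length ps = replicate p 1 @ k # replicate ?r 1. ?t ps)"
    proof (rule sum.mono_neutral_right, goal_cases)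
      case 3
      have "c (map2 (\<lambda>f p. f p) ops ps) = 0"
        if "ps \<in> factorizations (length ops) M" "map length ps \<noteq> replicate p 1 @ k # replicate ?r 1" for ps
      proof (rule multilinear_zero_mem[OF c])
        have ops: "list_all2 (\<lambda>f l. \<forall>p. length p \<noteq> l \<longrightarrow> f p = 0) ops (replicate p 1 @ k # replicate ?r 1)"
          unfolding ops_def
          by (intro list_all2_appendI list.rel_intros)
             (auto simp: list_all2_conv_all_nth restrict_op_def basis_op_def simp del: replicate_Suc)
        show "0 \<in> set (map2 (\<lambda>f p. f p) ops ps)"
          using lengths_if_no_zero[OF ops, of ps] that by (auto simp: factorizations_def)
        show "length (map2 (\<lambda>f p. f p) ops ps) = ?N"
          using that len_ops by (auto simp: factorizations_def)
      qed
      then show ?case by auto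
    qed auto
    also have "\<dots> = (\<Sum>w\<in>?W. ?t (split_word p k w))"
    proof (rule sum.reindex_bij_witness[where i = "split_word p k" and j = concat], goal_cases)
      case (1 ps)
      then show ?case using split_word_concat(1)[of ps p k ?r] by simp
    next
      case (2 ps)
      then show ?case
        using split_word_concat(2)[of ps p k ?r] True
        by (auto simp: factorizations_def permutations_of_multiset_def simp flip: set_mset_mset)
    next
      case (3 w)
      then show ?case by (simp add: concat_split_word)
    next
      case (4 w)
      then have "map length (split_word p k w) = replicate p 1 @ k # replicate ?r 1"
        by (intro map_length_split_word) auto
      moreover from arg_cong[OF this, of length] have "length (split_word p k w) = length ops"
        by (simp add: len_ops)
      moreover have "[] \<notin> set (split_word p k w)"
        using 4 k by (auto simp: split_word_def)
      ultimately show ?case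
        using 4 by (auto simp: factorizations_def concat_split_word permutations_of_multiset_def simp del: replicate_Suc)
    next
      case (5 ps)
      then show ?case using split_word_concat(1)[of ps p k ?r] by simp
    qed
    also have "\<dots> = (\<Sum>w\<in>?W. word_sign ds w * sgn_pow (word_deg ds (take p w)) *
       c (map ((!) es) (take p w) @ f (map ((!) es) (take k (drop p w))) # map ((!) es) (drop (p + k) w)))"
    proof (rule sum.cong[OF refl], goal_cases)
      case (1 w)
      have basis: "map2 (\<lambda>f p. f p) (replicate (length u) basis_op) (map (\<lambda>j. [j]) u) = map ((!) es) u" for u
        by (induction u) (auto simp: basis_op_def)
      have "map2 (\<lambda>f p. f p) ops (split_word p k w) =
          map ((!) es) (take p w) @ f (map ((!) es) (take k (drop p w))) # map ((!) es) (drop (p + k) w)"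
        using basis[of "take p w"] basis[of "drop (p + k) w"] 1
        by (simp add: ops_def split_word_def restrict_op_def del: replicate_Suc)
      moreover have "kos gs (map (word_deg ds) (split_word p k w)) = word_deg ds (take p w)"
        using kos_one[of "take p w" ?r ds] 1
        by (simp add: gs_def split_word_def del: replicate_Suc)
      ultimately show ?case
        using 1 by (simp add: concat_split_word)
    qed
    finally show ?thesis .
  qed
qed

section \<open>Cuts of words\<close>

text \<open>Cuts are kept as decompositions instead of index ranges, so that regrouping nested cuts
  is a bijection given by concatenation. In \<open>ncuts3\<close> the middle string is the argument
  of an operation, hence nonempty.\<close>

definition cuts2 :: "'a list \<Rightarrow> ('a list \<times> 'a list) set" where
  "cuts2 xs = {(u, v). u @ v = xs}"

definition cuts3 :: "'a list \<Rightarrow> ('a list \<times> 'a list \<times> 'a list) set" where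
  "cuts3 xs = {(u, v, t). u @ v @ t = xs}"

definition ncuts3 :: "'a list \<Rightarrow> ('a list \<times> 'a list \<times> 'a list) set" where
  "ncuts3 xs = {(u, v, t). u @ v @ t = xs \<and> v \<noteq> []}"

lemma finite_cuts [simp, intro]: "finite (cuts2 xs)" "finite (cuts3 xs)" "finite (ncuts3 xs)"
proof -
  let ?L = "{ys. set ys \<subseteq> set xs \<and> length ys \<le> length xs}"
  have fin: "finite ?L"
    by (rule finite_lists_length_le) simp
  have "cuts2 xs \<subseteq> ?L \<times> ?L" "cuts3 xs \<subseteq> ?L \<times> ?L \<times> ?L" "ncuts3 xs \<subseteq> ?L \<times> ?L \<times> ?L"
    by (auto simp: cuts2_def cuts3_def ncuts3_def)
  then show "finite (cuts2 xs)" "finite (cuts3 xs)" "finite (ncuts3 xs)"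
    using fin by (auto intro: finite_subset)
qed

lemma sum_cuts2: "(\<Sum>j\<le>length xs. f (take j xs) (drop j xs)) = (\<Sum>(u, v)\<in>cuts2 xs. f u v)"
  by (rule sum.reindex_bij_witness[where i = "\<lambda>(u, v). length u" and j = "\<lambda>j. (take j xs, drop j xs)"])
     (auto simp: cuts2_def)

lemma sum_cuts3:
  "(\<Sum>i\<le>length xs. \<Sum>j=i..length xs. f (take i xs) (drop i (take j xs)) (drop j xs)) = (\<Sum>(u, v, t)\<in>cuts3 xs. f u v t)"
proof -
  have *: "take i xs @ drop i (take j xs) @ drop j xs = xs" if "i \<le> j" for i j
    using that by (metis append.assoc append_take_drop_id min.absorb1 take_take)
  have "(\<Sum>i\<le>length xs. \<Sum>j=i..length xs. f (take i xs) (drop i (take j xs)) (drop j xs)) =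
      (\<Sum>(i, j)\<in>(SIGMA i:{..length xs}. {i..length xs}). f (take i xs) (drop i (take j xs)) (drop j xs))"
    by (simp add: sum.Sigma)
  also have "\<dots> = (\<Sum>(u, v, t)\<in>cuts3 xs. f u v t)"
    by (rule sum.reindex_bij_witness[where i = "\<lambda>(u, v, t). (length u, length u + length v)"
          and j = "\<lambda>(i, j). (take i xs, drop i (take j xs), drop j xs)"])
       (auto simp: cuts3_def * min_def)
  finally show ?thesis .
qed

lemma sum_ncuts3:
  "(\<Sum>i<length xs. \<Sum>j=1..length xs - i. f (take i xs) (take j (drop i xs)) (drop (i + j) xs)) =
   (\<Sum>(u, v, t)\<in>ncuts3 xs. f u v t)"
proof -
  have *: "take i xs @ take j (drop i xs) @ drop (i + j) xs = xs" for i j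
    by (metis append_take_drop_id drop_drop add.commute)
  have "(\<Sum>i<length xs. \<Sum>j=1..length xs - i. f (take i xs) (take j (drop i xs)) (drop (i + j) xs)) =
      (\<Sum>(i, j)\<in>(SIGMA i:{..<length xs}. {1..length xs - i}). f (take i xs) (take j (drop i xs)) (drop (i + j) xs))"
    by (simp add: sum.Sigma)
  also have "\<dots> = (\<Sum>(u, v, t)\<in>ncuts3 xs. f u v t)"
    by (rule sum.reindex_bij_witness[where i = "\<lambda>(u, v, t). (length u, length v)"
          and j = "\<lambda>(i, j). (take i xs, take j (drop i xs), drop (i + j) xs)"])
       (auto simp: ncuts3_def * min_def Suc_le_eq)
  finally show ?thesis .
qed

lemma sum_ncuts3_map:
  "(\<Sum>(u, v, t)\<in>ncuts3 (map g xs). f u v t) = (\<Sum>(u, v, t)\<in>ncuts3 xs. f (map g u) (map g v) (map g t))"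
  unfolding sum_ncuts3[symmetric] by (simp add: take_map drop_map)

text \<open>Either the middle string starts at the first letter or it avoids it. With the mirrored
  \<open>sum_ncuts3_snoc\<close> this compares the strings of a word and of its rotation.\<close>

lemma sum_ncuts3_Cons:
  fixes f :: "'a list \<Rightarrow> 'a list \<Rightarrow> 'a list \<Rightarrow> 'k::ab_group_add"
  shows "(\<Sum>(u, v, t)\<in>ncuts3 (a # xs). f u v t) =
    (\<Sum>(v, t)\<in>cuts2 xs. f [] (a # v) t) + (\<Sum>(u, v, t)\<in>ncuts3 xs. f (a # u) v t)"
proof -
  let ?A = "(\<lambda>(v, t). ([], a # v, t)) ` cuts2 xs" and ?B = "(\<lambda>(u, v, t). (a # u, v, t)) ` ncuts3 xs"
  have "ncuts3 (a # xs) = ?A \<union> ?B"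
    by (auto simp: ncuts3_def cuts2_def image_iff Cons_eq_append_conv append_eq_Cons_conv)
  moreover have "?A \<inter> ?B = {}"
    by auto
  ultimately have "(\<Sum>(u, v, t)\<in>ncuts3 (a # xs). f u v t) = (\<Sum>(u, v, t)\<in>?A. f u v t) + (\<Sum>(u, v, t)\<in>?B. f u v t)"
    by (simp add: sum.union_disjoint)
  also have "\<dots> = (\<Sum>(v, t)\<in>cuts2 xs. f [] (a # v) t) + (\<Sum>(u, v, t)\<in>ncuts3 xs. f (a # u) v t)"
    by (subst (1 2) sum.reindex) (auto simp: inj_on_def case_prod_unfold)
  finally show ?thesis .
qed

lemma sum_ncuts3_snoc:
  fixes f :: "'a list \<Rightarrow> 'a list \<Rightarrow> 'a list \<Rightarrow> 'k::ab_group_add"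
  shows "(\<Sum>(u, v, t)\<in>ncuts3 (xs @ [a]). f u v t) =
    (\<Sum>(u, v)\<in>cuts2 xs. f u (v @ [a]) []) + (\<Sum>(u, v, t)\<in>ncuts3 xs. f u v (t @ [a]))"
proof -
  let ?A = "(\<lambda>(u, v). (u, v @ [a], [])) ` cuts2 xs" and ?B = "(\<lambda>(u, v, t). (u, v, t @ [a])) ` ncuts3 xs"
  have "ncuts3 (xs @ [a]) \<subseteq> ?A \<union> ?B"
  proof clarify
    fix u v t assume uvt: "(u, v, t) \<in> ncuts3 (xs @ [a])" "(u, v, t) \<notin> ?B"
    then have "t = []"
      by (cases t rule: rev_cases) (auto simp: ncuts3_def image_iff simp flip: append_assoc)
    with uvt show "(u, v, t) \<in> ?A"
      by (cases v rule: rev_cases) (auto simp: ncuts3_def cuts2_def image_iff simp flip: append_assoc)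
  qed
  then have "ncuts3 (xs @ [a]) = ?A \<union> ?B"
    by (auto simp: ncuts3_def cuts2_def)
  moreover have "?A \<inter> ?B = {}"
    by auto
  ultimately have "(\<Sum>(u, v, t)\<in>ncuts3 (xs @ [a]). f u v t) = (\<Sum>(u, v, t)\<in>?A. f u v t) + (\<Sum>(u, v, t)\<in>?B. f u v t)"
    by (simp add: sum.union_disjoint)
  also have "\<dots> = (\<Sum>(u, v)\<in>cuts2 xs. f u (v @ [a]) []) + (\<Sum>(u, v, t)\<in>ncuts3 xs. f u v (t @ [a]))"
    by (subst (1 2) sum.reindex) (auto simp: inj_on_def case_prod_unfold)
  finally show ?thesis .
qed

lemma sum_blocks_map:
  "(\<Sum>ps\<in>blocks (map g xs). f ps) = (\<Sum>ps\<in>blocks xs. f (map (map g) ps))"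
proof -
  \<comment> \<open>\<open>g\<close> may fail to be injective, but a cut of a given word is
    determined by the lengths of its blocks.\<close>
  have inj: "inj_on (map (map g)) (blocks xs)"
  proof
    fix ps qs assume *: "ps \<in> blocks xs" "qs \<in> blocks xs" "map (map g) ps = map (map g) qs"
    then have "map length ps = map length qs"
      by (metis (no_types, lifting) length_map list.map_comp map_eq_conv comp_apply)
    moreover have "concat ps = concat qs"
      using * by (simp add: blocks_def)
    ultimately show "ps = qs"
      by (induction ps arbitrary: qs) (auto simp: map_eq_Cons_conv Cons_eq_map_conv)
  qed
  have "blocks (map g xs) \<subseteq> map (map g) ` blocks xs"
  proof
    fix qs assume "qs \<in> blocks (map g xs)"
    then have "concat qs = map g xs" "[] \<notin> set qs"
      by (auto simp: blocks_def)
    then have "\<exists>ps. concat ps = xs \<and> map (map g) ps = qs"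
    proof (induction qs arbitrary: xs)
      case Nil
      then show ?case by (intro exI[of _ "[]"]) auto
    next
      case (Cons q qs)
      then obtain us vs where "xs = us @ vs" "q = map g us" "concat qs = map g vs"
        by (auto simp: append_eq_map_conv)
      with Cons.IH[of vs] Cons.prems show ?case
        by (metis concat.simps(2) list.simps(9) list.set_intros(2))
    qed
    with \<open>[] \<notin> set qs\<close> show "qs \<in> map (map g) ` blocks xs"
      by (force simp: blocks_def)
  qed
  moreover have "map (map g) ` blocks xs \<subseteq> blocks (map g xs)"
    by (auto simp: blocks_def map_concat)
  ultimately have "blocks (map g xs) = map (map g) ` blocks xs" ..
  then show ?thesis
    by (simp add: sum.reindex[OF inj])
qed

section \<open>Cyclic invariance of the potential form\<close>

text \<open>Homogeneous elements are carried along with their shifted degrees.\<close>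

abbreviation vecs :: "('a \<times> int) list \<Rightarrow> 'a list" where
  "vecs \<equiv> map fst"

abbreviation total_deg :: "('a \<times> int) list \<Rightarrow> int" where
  "total_deg zs \<equiv> sum_list (map snd zs)"

definition graded :: "(int \<Rightarrow> 'a set) \<Rightarrow> ('a \<times> int) list \<Rightarrow> bool" where
  "graded G zs \<longleftrightarrow> (\<forall>(x, d)\<in>set zs. x \<in> G (d + 1))"

lemma graded_simps [simp]:
  "graded G []" "graded G (z # zs) \<longleftrightarrow> fst z \<in> G (snd z + 1) \<and> graded G zs"
  "graded G (us @ vs) \<longleftrightarrow> graded G us \<and> graded G vs"
  by (auto simp: graded_def case_prod_unfold)

lemma homogeneous_vecs: "graded G zs \<Longrightarrow> homogeneous G (vecs zs) (map snd zs)"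
  by (auto simp: graded_def homogeneous_def list_all2_conv_all_nth case_prod_unfold)

lemma homogeneous_singleton [simp]: "homogeneous G [x] [d] \<longleftrightarrow> x \<in> G (d + 1)"
  by (simp add: homogeneous_def)

definition potential_form :: "('a list \<Rightarrow> 'a) \<Rightarrow> ('a, 'k::ring_1) dual_bimodule_map \<Rightarrow> ('a \<times> int) list \<Rightarrow> 'k" where
  "potential_form m \<phi> zs = (\<Sum>(u, v, t)\<in>ncuts3 (butlast zs).
     sgn_pow (total_deg u) * \<phi> (vecs u) (m (vecs v)) (vecs t) (fst (last zs)))"

lemma flat_append: "flat \<phi> (length us) (us @ v # ws @ [w]) = \<phi> us v ws w"
  by (simp add: flat_def butlast_append)

context A_infinity_algebra
begin

lemma degree_m_vecs: "graded G zs \<Longrightarrow> zs \<noteq> [] \<Longrightarrow> m (vecs zs) \<in> G (total_deg zs + 1 + 1)"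
  using degree_m[of "vecs zs" "map snd zs"] by (simp add: homogeneous_vecs)

end

context A_infinity_dual_bimodule_map
begin

lemma phi_sum: "\<phi> us (\<Sum>i\<in>I. f i) ws w = (\<Sum>i\<in>I. \<phi> us (f i) ws w)"
  using multilinear_sum[OF multilinear_\<phi>[of "length us" "length ws"], of us "ws @ [w]" f I]
  by (simp add: flat_append)

lemma phi_scale: "\<phi> us (scale r v) ws w = r * \<phi> us v ws w"
  using multilinear_scale[OF multilinear_\<phi>[of "length us" "length ws"], of us "ws @ [w]" r v]
  by (simp add: flat_append)

text \<open>The case of an empty left side: the sum over strings inside that side is empty, and the
  strings through the dual argument end there.\<close>

lemma bimodule_relation_right:
  assumes "graded G ((x, d) # bs @ [(y, e)])"
  shows "(\<Sum>(u, v)\<in>cuts2 bs. \<phi> [] (m (x # vecs u)) (vecs v) y)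
    + (\<Sum>(u, v, t)\<in>ncuts3 bs. sgn_pow (d + total_deg u) * \<phi> [] x (vecs u @ m (vecs v) # vecs t) y)
    + (\<Sum>(u, v)\<in>cuts2 bs. sgn_pow (d + total_deg u) * \<phi> [] x (vecs u) (m (vecs v @ [y]))) = 0"
  using bimodule_relation[of "[]" "[]" x d "vecs bs" "map snd bs" y e] assms
  unfolding sum_cuts2[symmetric] sum_ncuts3[symmetric]
  by (simp add: homogeneous_vecs take_map drop_map) (simp add: homogeneous_def)

end

context strong_homotopy_inner_product
begin

text \<open>Closedness for the positions of \<open>x\<close>, \<open>z\<close>, \<open>y\<close>;
  skew symmetry puts \<open>z\<close>, respectively \<open>x\<close>, into the bimodule entry of the
  two rotated terms. So moving the dual argument from \<open>y\<close> to \<open>x\<close> while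
  \<open>z\<close> stays the bimodule entry costs a term with bimodule entry
  \<open>x\<close>.\<close>

lemma closedness_three:
  assumes "graded G ((x, d) # u @ (z, c) # t @ [(y, e)])"
  shows "\<phi> (x # vecs u) z (vecs t) y =
    sgn_pow (d * (total_deg u + c + total_deg t + e)) * \<phi> (vecs u) z (vecs t @ [y]) x
    + \<phi> [] x (vecs u @ z # vecs t) y"
proof -
  let ?U = "vecs u" and ?T = "vecs t"
  let ?xs = "x # ?U @ z # ?T @ [y]" and ?ds = "d # map snd u @ c # map snd t @ [e]"
  let ?j = "Suc (length u)" and ?k = "length u + length t + 2"
  let ?K = "(d + total_deg u + c) * (total_deg t + e)"
  have hom: "homogeneous G ?xs ?ds"
    using homogeneous_vecs[OF assms] by simp
  have rot: "rotate (Suc ?j) ?xs = (?T @ [y]) @ x # ?U @ [z]"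
    using rotate_append[of "x # ?U @ [z]" "?T @ [y]"] by simp
  have "cyclic_bracket \<phi> ?xs ?ds 0 ?j = sgn_pow ?K * \<phi> (?T @ [y]) x ?U z"
  proof -
    have "(0 + length ?xs - Suc ?j) mod length ?xs = length (?T @ [y])"
      by simp
    then show ?thesis
      unfolding cyclic_bracket_def rot using flat_append[of \<phi> "?T @ [y]" x ?U z] by (simp add: add.assoc)
  qed
  moreover have "cyclic_bracket \<phi> ?xs ?ds ?j ?k = \<phi> (x # ?U) z ?T y"
  proof -
    have "rotate (Suc ?k) ?xs = ?xs"
      using rotate_append[of ?xs "[]"] by simp
    moreover have "(?j + length ?xs - Suc ?k) mod length ?xs = length (x # ?U)"
      by simp
    ultimately show ?thesis
      unfolding cyclic_bracket_def using flat_append[of \<phi> "x # ?U" z ?T y] by simp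
  qed
  moreover have "cyclic_bracket \<phi> ?xs ?ds ?k 0 = sgn_pow (d * (total_deg u + c + total_deg t + e)) * \<phi> (?U @ z # ?T) y [] x"
  proof -
    have "rotate (Suc 0) ?xs = (?U @ z # ?T) @ y # [] @ [x]"
      by simp
    moreover have "(?k + length ?xs - Suc 0) mod length ?xs = length (?U @ z # ?T)"
    proof -
      have "?k + length ?xs - Suc 0 = length (?U @ z # ?T) + length ?xs"
        by simp
      then show ?thesis by (simp only: mod_add_self2) simp
    qed
    ultimately show ?thesis
      unfolding cyclic_bracket_def using flat_append[of \<phi> "?U @ z # ?T" y "[]" x]
      by (simp add: add.assoc)
  qed
  ultimately have sum: "sgn_pow ?K * \<phi> (?T @ [y]) x ?U z + \<phi> (x # ?U) z ?T y
      + sgn_pow (d * (total_deg u + c + total_deg t + e)) * \<phi> (?U @ z # ?T) y [] x = 0"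
    using closedness[OF hom, of 0 ?j ?k] by simp
  have skew1: "\<phi> (?T @ [y]) x ?U z =
      - sgn_pow ((total_deg t + e + d) * (total_deg u + c)) * \<phi> ?U z (?T @ [y]) x"
    using skew_symmetry[of "?T @ [y]" "map snd t @ [e]" x d ?U "map snd u" z c]
      homogeneous_vecs[of G "t @ [(y, e)]"] homogeneous_vecs[of G u] assms by simp
  have skew2: "\<phi> (?U @ z # ?T) y [] x =
      - sgn_pow (d * (total_deg u + c + total_deg t + e)) * \<phi> [] x (?U @ z # ?T) y"
    using skew_symmetry[of "?U @ z # ?T" "map snd u @ c # map snd t" y e "[]" "[]" x d]
      homogeneous_vecs[of G "u @ (z, c) # t"] homogeneous_vecs[of G "[]"] assms by (simp add: add.assoc mult.commute[of d])
  have sgn: "sgn_pow ?K * sgn_pow ((total_deg t + e + d) * (total_deg u + c)) =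
      (sgn_pow (d * (total_deg u + c + total_deg t + e)) :: 'k)"
    unfolding sgn_pow_add[symmetric] by (intro sgn_pow_cong) (simp; argo)
  have "\<phi> (x # ?U) z ?T y = - (sgn_pow ?K * \<phi> (?T @ [y]) x ?U z)
      - sgn_pow (d * (total_deg u + c + total_deg t + e)) * \<phi> (?U @ z # ?T) y [] x"
    using sum by (simp add: eq_diff_eq eq_neg_iff_add_eq_0 add_ac)
  then show ?thesis
    unfolding skew1 skew2 using sgn
    by (simp add: sgn_pow_self mult.assoc[symmetric])
qed

text \<open>Strings avoiding \<open>a\<close> and the last letter of \<open>zs\<close> occur on both
  sides; \<open>closedness_three\<close>, with the output of \<open>m\<close> as \<open>z\<close>,
  matches them up to terms with bimodule entry \<open>a\<close>. Strings ending at the last letter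
  of \<open>zs\<close> are turned by skew symmetry into terms with bimodule entry \<open>a\<close>
  and the output of \<open>m\<close> as dual argument. Together with the strings starting at
  \<open>a\<close>, what remains is the left-hand side of
  \<open>bimodule_relation_right\<close>.\<close>

lemma potential_form_rotate:
  assumes "graded G (a # zs)"
  shows "potential_form m \<phi> (a # zs) = sgn_pow (snd a * total_deg zs) * potential_form m \<phi> (zs @ [a])"
proof (cases zs rule: rev_cases)
  case (snoc bs w)
  obtain x d y e where a: "a = (x, d)" and w: "w = (y, e)"
    by (cases a, cases w)
  let ?s = "sgn_pow (d * (total_deg bs + e)) :: 'k"
  have gr: "graded G bs" "x \<in> G (d + 1)" "y \<in> G (e + 1)"
    using assms by (auto simp: snoc a w)
  have split: "sgn_pow (d + total_deg u) * \<phi> (x # vecs u) (m (vecs v)) (vecs t) y =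
      ?s * (sgn_pow (total_deg u) * \<phi> (vecs u) (m (vecs v)) (vecs t @ [y]) x)
      + sgn_pow (d + total_deg u) * \<phi> [] x (vecs u @ m (vecs v) # vecs t) y"
    if "(u, v, t) \<in> ncuts3 bs" for u v t
  proof -
    from that have bs: "bs = u @ v @ t" and "v \<noteq> []"
      by (auto simp: ncuts3_def)
    with gr have "graded G ((x, d) # u @ (m (vecs v), total_deg v + 1) # t @ [(y, e)])"
      using degree_m_vecs[of v] by (simp add: bs add_ac)
    note closedness_three[OF this]
    moreover have "sgn_pow (d + total_deg u) * sgn_pow (d * (total_deg u + (total_deg v + 1) + total_deg t + e)) =
        ?s * sgn_pow (total_deg u)"
      unfolding sgn_pow_add[symmetric] bs by (intro sgn_pow_cong) (simp; argo)
    ultimately show ?thesis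
      by (simp add: distrib_left mult.assoc[symmetric])
  qed
  have skew: "?s * (sgn_pow (total_deg u) * \<phi> (vecs u) (m (vecs v @ [y])) [] x) =
      - (sgn_pow (d + total_deg u) * \<phi> [] x (vecs u) (m (vecs v @ [y])))"
    if "(u, v) \<in> cuts2 bs" for u v
  proof -
    from that have bs: "bs = u @ v"
      by (auto simp: cuts2_def)
    have "m (vecs (v @ [w])) \<in> G (total_deg (v @ [w]) + 1 + 1)"
      using gr by (intro degree_m_vecs) (auto simp: bs w)
    then have "\<phi> (vecs u) (m (vecs v @ [y])) [] x =
        - sgn_pow ((total_deg u + (total_deg v + e + 1)) * d) * \<phi> [] x (vecs u) (m (vecs v @ [y]))"
      using skew_symmetry[of "vecs u" "map snd u" "m (vecs v @ [y])" "total_deg v + e + 1" "[]" "[]" x d]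
        gr homogeneous_vecs[of G u] homogeneous_vecs[of G "[]"]
      by (simp add: bs w)
    moreover have "?s * sgn_pow (total_deg u) * sgn_pow ((total_deg u + (total_deg v + e + 1)) * d) =
       (sgn_pow (d + total_deg u) :: 'k)"
      unfolding sgn_pow_add[symmetric] bs by (intro sgn_pow_cong) (simp; argo)
    ultimately show ?thesis
      by (simp add: mult.assoc[symmetric])
  qed
  have "potential_form m \<phi> (a # zs) = (\<Sum>(u, v)\<in>cuts2 bs. \<phi> [] (m (x # vecs u)) (vecs v) y)
     + (\<Sum>(u, v, t)\<in>ncuts3 bs. sgn_pow (d + total_deg u) * \<phi> (x # vecs u) (m (vecs v)) (vecs t) y)"
    by (simp add: potential_form_def snoc a w sum_ncuts3_Cons)
  also have "(\<Sum>(u, v, t)\<in>ncuts3 bs. sgn_pow (d + total_deg u) * \<phi> (x # vecs u) (m (vecs v)) (vecs t) y) =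
      (\<Sum>(u, v, t)\<in>ncuts3 bs. ?s * (sgn_pow (total_deg u) * \<phi> (vecs u) (m (vecs v)) (vecs t @ [y]) x)
        + sgn_pow (d + total_deg u) * \<phi> [] x (vecs u @ m (vecs v) # vecs t) y)"
    by (intro sum.cong refl) (auto simp: split)
  also have "\<dots> = ?s * (\<Sum>(u, v, t)\<in>ncuts3 bs. sgn_pow (total_deg u) * \<phi> (vecs u) (m (vecs v)) (vecs t @ [y]) x)
      + (\<Sum>(u, v, t)\<in>ncuts3 bs. sgn_pow (d + total_deg u) * \<phi> [] x (vecs u @ m (vecs v) # vecs t) y)"
    by (simp add: case_prod_unfold sum.distrib sum_distrib_left)
  finally have 1: "potential_form m \<phi> (a # zs) = \<dots> + (\<Sum>(u, v)\<in>cuts2 bs. \<phi> [] (m (x # vecs u)) (vecs v) y)"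
    by (simp add: add.commute)
  have "?s * (\<Sum>(u, v)\<in>cuts2 bs. sgn_pow (total_deg u) * \<phi> (vecs u) (m (vecs v @ [y])) [] x) =
     - (\<Sum>(u, v)\<in>cuts2 bs. sgn_pow (d + total_deg u) * \<phi> [] x (vecs u) (m (vecs v @ [y])))"
    unfolding sum_distrib_left sum_negf[symmetric] by (intro sum.cong refl) (auto simp: skew)
  then have 2: "?s * potential_form m \<phi> (zs @ [a]) =
      ?s * (\<Sum>(u, v, t)\<in>ncuts3 bs. sgn_pow (total_deg u) * \<phi> (vecs u) (m (vecs v)) (vecs t @ [y]) x)
      - (\<Sum>(u, v)\<in>cuts2 bs. sgn_pow (d + total_deg u) * \<phi> [] x (vecs u) (m (vecs v @ [y])))"
    by (simp add: potential_form_def snoc a w sum_ncuts3_snoc butlast_append distrib_left)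
  have "potential_form m \<phi> (a # zs) - ?s * potential_form m \<phi> (zs @ [a]) = 0"
    using bimodule_relation_right[of x d bs y e] gr unfolding 1 2 by (simp add: algebra_simps)
  then show ?thesis
    by (simp add: snoc a w)
qed (simp add: potential_form_def)

end

section \<open>The pull-back of the potential form\<close>

definition hom_vec :: "('b list \<Rightarrow> 'a) \<Rightarrow> ('b \<times> int) list \<Rightarrow> 'a \<times> int" where
  "hom_vec h l = (h (vecs l), total_deg l)"

lemma fst_hom_vec [simp]: "fst (hom_vec h l) = h (vecs l)"
  and snd_hom_vec [simp]: "snd (hom_vec h l) = total_deg l"
  by (simp_all add: hom_vec_def)

lemma total_deg_hom_vec: "total_deg (map (hom_vec h) ps) = total_deg (concat ps)"
  by (induction ps) auto

lemma finite_block_cuts: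
  "finite {(a, P, z, T, b). a @ concat P @ z @ concat T @ b = zs \<and> z \<noteq> [] \<and> [] \<notin> set P \<and> [] \<notin> set T}"
proof -
  let ?L = "{ys. set ys \<subseteq> set zs \<and> length ys \<le> length zs}"
  have fin: "finite ?L"
    by (rule finite_lists_length_le) simp
  let ?B = "\<Union>ys\<in>?L. blocks ys"
  have "{(a, P, z, T, b). a @ concat P @ z @ concat T @ b = zs \<and> z \<noteq> [] \<and> [] \<notin> set P \<and> [] \<notin> set T}
      \<subseteq> ?L \<times> ?B \<times> ?L \<times> ?B \<times> ?L"
    by (auto simp: blocks_def)
  then show ?thesis
    by (rule finite_subset) (use fin in auto)
qed

context A_infinity_hom
begin

lemma degree_f_vecs: "graded G zs \<Longrightarrow> zs \<noteq> [] \<Longrightarrow> f (vecs zs) \<in> G' (total_deg zs + 1)"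
  using degree_f[of "vecs zs" "map snd zs"] by (simp add: homogeneous_vecs)

lemma hom_relation_vecs:
  assumes "graded G zs" "zs \<noteq> []"
  shows "(\<Sum>R\<in>blocks zs. m' (vecs (map (hom_vec f) R))) =
    (\<Sum>(u, v, t)\<in>ncuts3 zs. scale' (sgn_pow (total_deg u)) (f (vecs u @ m (vecs v) # vecs t)))"
  using hom_relation[of "vecs zs" "map snd zs"] assms
  unfolding sum_ncuts3[symmetric] sum_blocks_map
  by (simp add: homogeneous_vecs take_map drop_map comp_def)

end

lemma pullback_bimodule_map_vecs:
  "pullback_bimodule_map h \<phi> (map snd us) dv (map snd ws) dw (vecs us) v (vecs ws) w =
    (\<Sum>(a, \<alpha>, a')\<in>cuts3 us. \<Sum>(b', \<beta>, b)\<in>cuts3 ws.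
       sgn_pow (total_deg a * (total_deg \<alpha> + total_deg a' + dv + total_deg ws + dw)) *
       (\<Sum>P\<in>blocks \<alpha>. \<Sum>T\<in>blocks \<beta>.
         \<phi> (vecs (map (hom_vec h) P)) (h (vecs a' @ v # vecs b'))
           (vecs (map (hom_vec h) T)) (h (vecs b @ w # vecs a))))"
proof -
  have *: "total_deg (drop i us) = total_deg (drop i (take j us)) + total_deg (drop j us)" if "i \<le> j" for i j
  proof -
    have "drop i us = drop i (take j us @ drop j us)" by simp
    also have "\<dots> = drop i (take j us) @ drop (i - length (take j us)) (drop j us)"
      by (rule drop_append)
    also have "drop (i - length (take j us)) (drop j us) = drop j us"
      using that by (cases "j \<le> length us") auto
    finally show ?thesis by (simp only: map_append sum_list_append)
  qed
  show ?thesis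
    unfolding pullback_bimodule_map_def sum_cuts3[symmetric] length_map
    by (intro sum.cong refl)
       (simp add: take_map drop_map sum_blocks_map comp_def *[symmetric])
qed

text \<open>
  Both sides expand into sums over factorizations of the cyclic word \<open>zs @ [w]\<close> in which one of the
  factors receives \<open>m\<close>; the homomorphism relation is applied to that factor.
\<close>

lemma (in A_infinity_hom) cyclic_form_eq_potential_form:
  assumes target: "A_infinity_dual_bimodule_map scale' G' m' \<phi>"
    and pullback: "is_pullback G f \<phi> (cyclic_bimodule_map ip)"
    and gr: "graded G (zs @ [w])" and "zs \<noteq> []"
  shows "ip (m (vecs zs)) (fst w) =
    (\<Sum>(a, y, b)\<in>cuts3 zs. sgn_pow (total_deg a * (total_deg y + total_deg b + snd w)) *
       (\<Sum>ps\<in>blocks y. potential_form m' \<phi> (map (hom_vec f) ps @ [hom_vec f (b @ w # a)])))"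
proof -
  interpret A_infinity_dual_bimodule_map scale' G' m' \<phi> by fact
  \<comment> \<open>\<open>z\<close> is the part that receives the operation, \<open>P\<close> and
    \<open>T\<close> are the blocks before and after it; \<open>b\<close>, \<open>w\<close> and
    \<open>a\<close> form the block that wraps around.\<close>
  define Mid where "Mid = {(a, P, z, T, b). a @ concat P @ z @ concat T @ b = zs \<and> z \<noteq> [] \<and> [] \<notin> set P \<and> [] \<notin> set T}"
  have fin: "finite Mid"
    unfolding Mid_def by (rule finite_block_cuts)
  let ?h = "\<lambda>P. vecs (map (hom_vec f) P)"
  \<comment> \<open>The string \<open>a\<close> moves past all other entries, and the operation past
    the blocks in \<open>P\<close>.\<close>
  let ?s = "\<lambda>a P z T b. sgn_pow (total_deg a * (total_deg (concat P) + total_deg z + total_deg (concat T) + total_deg b + snd w)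
      + total_deg (concat P)) :: 'k"
  let ?M = "\<Sum>(a, P, z, T, b)\<in>Mid. ?s a P z T b *
       \<phi> (?h P) (\<Sum>R\<in>blocks z. m' (?h R)) (?h T) (f (vecs (b @ w # a)))"
  have "(\<Sum>(a, y, b)\<in>cuts3 zs. sgn_pow (total_deg a * (total_deg y + total_deg b + snd w)) *
       (\<Sum>ps\<in>blocks y. potential_form m' \<phi> (map (hom_vec f) ps @ [hom_vec f (b @ w # a)]))) =
    (\<Sum>(a, y, b)\<in>cuts3 zs. \<Sum>ps\<in>blocks y. \<Sum>(P, R, T)\<in>ncuts3 ps.
       sgn_pow (total_deg a * (total_deg y + total_deg b + snd w)) *
       (sgn_pow (total_deg (concat P)) * \<phi> (?h P) (m' (?h R)) (?h T) (f (vecs (b @ w # a)))))"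
    unfolding potential_form_def butlast_snoc sum_ncuts3_map total_deg_hom_vec
    by (simp add: sum_distrib_left case_prod_unfold)
  also have "\<dots> = (\<Sum>x\<in>Sigma (cuts3 zs) (\<lambda>(a, y, b). Sigma (blocks y) ncuts3).
      case x of ((a, y, b), ps, P, R, T) \<Rightarrow>
       sgn_pow (total_deg a * (total_deg y + total_deg b + snd w)) *
       (sgn_pow (total_deg (concat P)) * \<phi> (?h P) (m' (?h R)) (?h T) (f (vecs (b @ w # a)))))"
    by (simp add: sum.Sigma case_prod_unfold)
  \<comment> \<open>A run \<open>R\<close> of consecutive blocks is the same as a string
    \<open>z\<close> together with a cut of \<open>z\<close>.\<close>
  also have "\<dots> = (\<Sum>x\<in>Sigma Mid (\<lambda>(a, P, z, T, b). blocks z).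
      case x of ((a, P, z, T, b), R) \<Rightarrow> ?s a P z T b * \<phi> (?h P) (m' (?h R)) (?h T) (f (vecs (b @ w # a))))"
    by (rule sum.reindex_bij_witness[
          where j = "\<lambda>((a, y, b), ps, P, R, T). ((a, P, concat R, T, b), R)"
            and i = "\<lambda>((a, P, z, T, b), R). ((a, concat P @ z @ concat T, b), P @ R @ T, P, R, T)"])
       (auto simp: cuts3_def ncuts3_def blocks_def Mid_def sgn_pow_add add_ac,
         metis list.set_intros(1) neq_Nil_conv)
  also have "\<dots> = ?M"
    using fin by (simp add: sum.Sigma case_prod_unfold phi_sum sum_distrib_left)
  finally have rhs: "(\<Sum>(a, y, b)\<in>cuts3 zs. sgn_pow (total_deg a * (total_deg y + total_deg b + snd w)) *
       (\<Sum>ps\<in>blocks y. potential_form m' \<phi> (map (hom_vec f) ps @ [hom_vec f (b @ w # a)]))) = ?M" .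
  let ?g = "\<lambda>a P a' v b' T b. ?s a P (a' @ v @ b') T b * (sgn_pow (total_deg a') *
       \<phi> (?h P) (f (vecs a' @ m (vecs v) # vecs b')) (?h T) (f (vecs (b @ w # a))))"
  \<comment> \<open>The relation for \<open>f\<close> trades \<open>m'\<close> on the blocks of
    \<open>z\<close> for \<open>m\<close> on a string inside \<open>z\<close>.\<close>
  have "?M = (\<Sum>(a, P, z, T, b)\<in>Mid. \<Sum>(a', v, b')\<in>ncuts3 z. ?g a P a' v b' T b)"
  proof (intro sum.cong refl, clarify)
    fix a P z T b assume "(a, P, z, T, b) \<in> Mid"
    then have "graded G z" "z \<noteq> []"
      using gr by (auto simp: Mid_def)
    then show "?s a P z T b * \<phi> (?h P) (\<Sum>R\<in>blocks z. m' (?h R)) (?h T) (f (vecs (b @ w # a))) =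
        (\<Sum>(a', v, b')\<in>ncuts3 z. ?g a P a' v b' T b)"
      unfolding hom_relation_vecs[OF \<open>graded G z\<close> \<open>z \<noteq> []\<close>] case_prod_unfold phi_sum phi_scale sum_distrib_left
      by (intro sum.cong refl) (auto simp: ncuts3_def add_ac)
  qed
  also have "\<dots> = (\<Sum>x\<in>Sigma Mid (\<lambda>(a, P, z, T, b). ncuts3 z).
      case x of ((a, P, z, T, b), a', v, b') \<Rightarrow> ?g a P a' v b' T b)"
    using fin by (simp add: sum.Sigma case_prod_unfold)
  \<comment> \<open>The string \<open>v\<close> fed to \<open>m\<close> is now chosen before the
    cuts; those of \<open>u\<close> and \<open>t\<close> are the cuts in the pull-back, and
    \<open>a'\<close>, \<open>v\<close>, \<open>b'\<close> make up \<open>z\<close>.\<close>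
  also have "\<dots> = (\<Sum>x\<in>Sigma (ncuts3 zs) (\<lambda>(u, v, t). Sigma (cuts3 u) (\<lambda>(a, \<alpha>, a').
        Sigma (cuts3 t) (\<lambda>(b', \<beta>, b). Sigma (blocks \<alpha>) (\<lambda>P. blocks \<beta>)))).
      case x of ((u, v, t), (a, \<alpha>, a'), (b', \<beta>, b), P, T) \<Rightarrow> ?g a P a' v b' T b)"
    by (rule sum.reindex_bij_witness[
          where j = "\<lambda>((a, P, z, T, b), a', v, b'). ((a @ concat P @ a', v, b' @ concat T @ b),
                       (a, concat P, a'), (b', concat T, b), P, T)"
            and i = "\<lambda>((u, v, t), (a, \<alpha>, a'), (b', \<beta>, b), P, T). ((a, P, a' @ v @ b', T, b), a', v, b')"])
       (auto simp: cuts3_def ncuts3_def blocks_def Mid_def)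
  also have "\<dots> = (\<Sum>(u, v, t)\<in>ncuts3 zs. \<Sum>(a, \<alpha>, a')\<in>cuts3 u. \<Sum>(b', \<beta>, b)\<in>cuts3 t.
      \<Sum>P\<in>blocks \<alpha>. \<Sum>T\<in>blocks \<beta>. ?g a P a' v b' T b)"
    by (simp add: sum.Sigma case_prod_unfold)
  also have "\<dots> = (\<Sum>(u, v, t)\<in>ncuts3 zs. sgn_pow (total_deg u) *
      pullback_bimodule_map f \<phi> (map snd u) (total_deg v + 1) (map snd t) (snd w) (vecs u) (m (vecs v)) (vecs t) (fst w))"
  proof (intro sum.cong refl, clarify)
    fix u v t :: "('a \<times> int) list"
    \<comment> \<open>The output of \<open>m\<close> has degree \<open>total_deg v + 1\<close>, so
      \<open>a\<close> picks up an additional \<open>total_deg a\<close> when moving past it; this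
      cancels against the part of \<open>total_deg u\<close> coming from \<open>a\<close>.\<close>
    have sgn: "?s a P (a' @ v @ b') T b * sgn_pow (total_deg a') =
        sgn_pow (total_deg u) * sgn_pow (total_deg a * (total_deg \<alpha> + total_deg a' + (total_deg v + 1)
           + total_deg t + snd w))"
      if "a @ \<alpha> @ a' = u" "b' @ \<beta> @ b = t" "concat P = \<alpha>" "concat T = \<beta>" for a \<alpha> a' b' \<beta> b P T
      unfolding sgn_pow_add[symmetric] that(1,2)[symmetric] that(3,4) map_append sum_list_append
      by (rule sgn_pow_cong) (simp; argo)
    show "(\<Sum>(a, \<alpha>, a')\<in>cuts3 u. \<Sum>(b', \<beta>, b)\<in>cuts3 t. \<Sum>P\<in>blocks \<alpha>. \<Sum>T\<in>blocks \<beta>. ?g a P a' v b' T b) =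
      sgn_pow (total_deg u) *
      pullback_bimodule_map f \<phi> (map snd u) (total_deg v + 1) (map snd t) (snd w) (vecs u) (m (vecs v)) (vecs t) (fst w)"
      unfolding pullback_bimodule_map_vecs sum_distrib_left case_prod_unfold
    proof (intro sum.cong refl)
      fix x y P T
      assume "x \<in> cuts3 u" "y \<in> cuts3 t" "P \<in> blocks (fst (snd x))" "T \<in> blocks (fst (snd y))"
      then show "?g (fst x) P (snd (snd x)) v (fst y) T (snd (snd y)) =
        sgn_pow (total_deg u) * (sgn_pow (total_deg (fst x) * (total_deg (fst (snd x)) + total_deg (snd (snd x))
            + (total_deg v + 1) + total_deg t + snd w)) *
          \<phi> (?h P) (f (vecs (snd (snd x)) @ m (vecs v) # vecs (fst y))) (?h T) (f (vecs (snd (snd y)) @ fst w # vecs (fst x))))"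
        unfolding mult.assoc[symmetric]
        by (subst sgn[of "fst x" "fst (snd x)" "snd (snd x)" "fst y" "fst (snd y)" "snd (snd y)"])
           (auto simp: cuts3_def blocks_def)
    qed
  qed
  also have "\<dots> = (\<Sum>(u, v, t)\<in>ncuts3 zs. sgn_pow (total_deg u) *
      cyclic_bimodule_map ip (vecs u) (m (vecs v)) (vecs t) (fst w))"
  proof (intro sum.cong refl, clarify)
    fix u v t assume "(u, v, t) \<in> ncuts3 zs"
    then have zs: "zs = u @ v @ t" "v \<noteq> []"
      by (auto simp: ncuts3_def)
    with gr have "graded G u" "graded G v" "graded G t" "homogeneous G [fst w] [snd w]"
      by auto
    moreover from this zs have "homogeneous G [m (vecs v)] [total_deg v + 1]"
      using source.degree_m_vecs[of v] by simp
    ultimately show "sgn_pow (total_deg u) *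
      pullback_bimodule_map f \<phi> (map snd u) (total_deg v + 1) (map snd t) (snd w) (vecs u) (m (vecs v)) (vecs t) (fst w) =
      sgn_pow (total_deg u) * cyclic_bimodule_map ip (vecs u) (m (vecs v)) (vecs t) (fst w)"
      by (subst pullback[unfolded is_pullback_def, rule_format]) (auto intro: homogeneous_vecs)
  qed
  \<comment> \<open>The bimodule map of a cyclic algebra vanishes on nonempty side strings, so only
    the string exhausting \<open>zs\<close> survives.\<close>
  also have "\<dots> = (\<Sum>(u, v, t)\<in>{([], zs, [])}. sgn_pow (total_deg u) *
      cyclic_bimodule_map ip (vecs u) (m (vecs v)) (vecs t) (fst w))"
    using \<open>zs \<noteq> []\<close>
    by (intro sum.mono_neutral_right finite_cuts)
       (auto simp: ncuts3_def cyclic_bimodule_map_def split: if_splits)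
  also have "\<dots> = ip (m (vecs zs)) (fst w)"
    by (simp add: cyclic_bimodule_map_def)
  finally show ?thesis
    unfolding rhs ..
qed

section \<open>Averaging over rotations of factorizations\<close>

definition all_factorizations :: "nat multiset \<Rightarrow> nat list list set" where
  "all_factorizations L = {ps. [] \<notin> set ps \<and> mset (concat ps) = L}"

lemma length_le_length_concat: "[] \<notin> set yss \<Longrightarrow> length yss \<le> length (concat yss)"
proof (induction yss)
  case (Cons ys yss)
  then show ?case by (cases ys) auto
qed simp

lemma sum_all_factorizations:
  "(\<Sum>ps\<in>all_factorizations L. f ps) = (\<Sum>r\<le>size L. \<Sum>ps\<in>factorizations r L. f ps)"
proof -
  have "all_factorizations L = (\<Union>r\<le>size L. factorizations r L)"
    using length_le_length_concat by (fastforce simp: all_factorizations_def factorizations_def simp flip: size_mset)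
  moreover have "(\<Sum>ps\<in>(\<Union>r\<le>size L. factorizations r L). f ps) = (\<Sum>r\<le>size L. \<Sum>ps\<in>factorizations r L. f ps)"
    by (rule sum.UNION_disjoint) (simp, simp, auto simp: factorizations_def)
  ultimately show ?thesis by simp
qed

lemma finite_all_factorizations [simp, intro]: "finite (all_factorizations L)"
proof -
  have "all_factorizations L \<subseteq> (\<Union>w\<in>permutations_of_multiset L. blocks w)"
    by (auto simp: all_factorizations_def blocks_def permutations_of_multiset_def)
  then show ?thesis
    by (rule finite_subset) auto
qed

text \<open>Rotation carries each position to the next, so the weighted sum \<open>S t\<close> of
  the lengths of the \<open>t\<close>-th factors does not depend on \<open>t\<close>, while the sum
  of all \<open>S t\<close> counts every letter.\<close>

lemma sum_length_last_factor:
  fixes W :: "nat list list \<Rightarrow> 'k::field_char_0"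
  assumes rot: "\<And>ps. ps \<in> factorizations (Suc r) L \<Longrightarrow> W (rotate1 ps) = W ps"
  shows "of_nat (Suc r) * (\<Sum>ps\<in>factorizations (Suc r) L. of_nat (length (last ps)) * W ps) =
         of_nat (size L) * (\<Sum>ps\<in>factorizations (Suc r) L. W ps)"
proof -
  define S where "S t = (\<Sum>ps\<in>factorizations (Suc r) L. of_nat (length (ps ! t)) * W ps)" for t
  have "bij_betw rotate1 (factorizations (Suc r) L) (factorizations (Suc r) L)"
  proof (rule bij_betwI[where g = "\<lambda>ps. last ps # butlast ps"])
    show "rotate1 \<in> factorizations (Suc r) L \<rightarrow> factorizations (Suc r) L"
    proof
      fix ps assume "ps \<in> factorizations (Suc r) L"
      then show "rotate1 ps \<in> factorizations (Suc r) L"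
        by (cases ps) (auto simp: factorizations_def add_ac)
    qed
    show "(\<lambda>ps. last ps # butlast ps) \<in> factorizations (Suc r) L \<rightarrow> factorizations (Suc r) L"
    proof
      fix ps assume ps: "ps \<in> factorizations (Suc r) L"
      then obtain qs q where "ps = qs @ [q]"
        by (cases ps rule: rev_cases) (auto simp: factorizations_def)
      with ps show "last ps # butlast ps \<in> factorizations (Suc r) L"
        by (auto simp: factorizations_def add_ac)
    qed
  next
    fix ps assume "ps \<in> factorizations (Suc r) L"
    then have "ps \<noteq> []"
      by (auto simp: factorizations_def)
    then show "last (rotate1 ps) # butlast (rotate1 ps) = ps"
      by (cases ps) simp_all
    from \<open>ps \<noteq> []\<close> show "rotate1 (last ps # butlast ps) = ps"
      by simp
  qed
  then have "S t = (\<Sum>ps\<in>factorizations (Suc r) L. of_nat (length (rotate1 ps ! t)) * W (rotate1 ps))" for t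
    unfolding S_def by (rule sum.reindex_bij_betw[symmetric])
  also have "\<dots> t = S (Suc t)" if "t < r" for t
    unfolding S_def using that
    by (intro sum.cong refl) (auto simp: rot nth_rotate1 factorizations_def)
  finally have step: "S t = S (Suc t)" if "t < r" for t
    using that by simp
  have S: "S t = S r" if "t \<le> r" for t
    using that by (induction rule: inc_induct) (rule refl, metis step)
  have "(\<Sum>t<Suc r. S t) = (\<Sum>ps\<in>factorizations (Suc r) L. (\<Sum>t<Suc r. of_nat (length (ps ! t))) * W ps)"
    unfolding S_def by (subst sum.swap) (simp add: sum_distrib_right del: sum.lessThan_Suc)
  also have "\<dots> = (\<Sum>ps\<in>factorizations (Suc r) L. of_nat (size L) * W ps)"
  proof (rule sum.cong[OF refl])
    fix ps assume "ps \<in> factorizations (Suc r) L"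
    then have "length ps = Suc r" "size L = length (concat ps)"
      by (auto simp: factorizations_def)
    then have "size L = (\<Sum>t<Suc r. length (ps ! t))"
      by (simp add: length_concat sum_list_sum_nth atLeast0LessThan del: sum.lessThan_Suc)
    then show "(\<Sum>t<Suc r. of_nat (length (ps ! t))) * W ps = of_nat (size L) * W ps"
      by (simp only: of_nat_sum)
  qed
  moreover have "(\<Sum>t<Suc r. S t) = (\<Sum>t<Suc r. S r)"
    by (intro sum.cong refl S) simp
  moreover have "S r = (\<Sum>ps\<in>factorizations (Suc r) L. of_nat (length (last ps)) * W ps)"
    unfolding S_def
  proof (rule sum.cong[OF refl])
    fix ps assume "ps \<in> factorizations (Suc r) L"
    then have "length ps = Suc r"
      by (simp add: factorizations_def)
    moreover from this have "ps \<noteq> []"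
      by auto
    ultimately show "of_nat (length (ps ! r)) * W ps = of_nat (length (last ps)) * W ps"
      by (simp add: last_conv_nth)
  qed
  ultimately show ?thesis
    by (simp only: sum_constant card_lessThan sum_distrib_left[symmetric])
qed

text \<open>
  On the left, the cyclic words are cut into factors with the last letter marked; unwrapping the
  factor containing the mark shows that each factorization occurs once for every letter of its
  last factor, which on average over the rotations is \<open>size L / length ps\<close> times.
\<close>

lemma sum_cyclic_factorizations:
  fixes F :: "nat list list \<Rightarrow> 'k::field_char_0"
  assumes rot: "\<And>p ps. [] \<notin> set (p # ps) \<Longrightarrow> mset (concat (p # ps)) = L \<Longrightarrow>
      F (p # ps) = sgn_pow (word_deg ds p * word_deg ds (concat ps)) * F (ps @ [p])"
  shows "(\<Sum>w\<in>permutations_of_multiset L - {[]}. word_sign ds w *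
      (\<Sum>(a, y, b)\<in>cuts3 (butlast w). sgn_pow (word_deg ds a * (word_deg ds y + word_deg ds b + ds ! last w)) *
         (\<Sum>ps\<in>blocks y. F (ps @ [b @ last w # a])))) =
    of_nat (size L) * (\<Sum>r\<le>size L. \<Sum>ps\<in>factorizations r L. word_sign ds (concat ps) * (1 / of_nat r * F ps))"
proof -
  define W where "W ps = word_sign ds (concat ps) * F ps" for ps
  have W_rotate: "W (rotate1 ps) = W ps" if "ps \<in> factorizations (Suc r) L" for r ps
  proof -
    from that obtain p qs where ps: "ps = p # qs"
      by (auto simp: factorizations_def length_Suc_conv)
    have "F ps = sgn_pow (word_deg ds p * word_deg ds (concat qs)) * F (qs @ [p])"
      using that unfolding ps by (intro rot) (auto simp: factorizations_def)
    moreover have "word_sign ds (concat ps) =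
        (sgn_pow (word_deg ds p * word_deg ds (concat qs)) * word_sign ds (concat qs @ p) :: 'k)"
      unfolding ps by (simp only: concat.simps) (rule word_sign_commute)
    ultimately show ?thesis
      by (simp add: W_def ps sgn_pow_self mult_ac)
  qed
  have "(\<Sum>w\<in>permutations_of_multiset L - {[]}. word_sign ds w *
      (\<Sum>(a, y, b)\<in>cuts3 (butlast w). sgn_pow (word_deg ds a * (word_deg ds y + word_deg ds b + ds ! last w)) *
         (\<Sum>ps\<in>blocks y. F (ps @ [b @ last w # a])))) =
    (\<Sum>w\<in>permutations_of_multiset L - {[]}. \<Sum>(a, y, b)\<in>cuts3 (butlast w). \<Sum>ps\<in>blocks y. W (ps @ [b @ last w # a]))"
  proof (rule sum.cong[OF refl])
    fix w assume "w \<in> permutations_of_multiset L - {[]}"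
    then obtain z l where w: "w = z @ [l]"
      by (cases w rule: rev_cases) auto
    \<comment> \<open>Moving \<open>a\<close> to the end changes \<open>word_sign\<close> by exactly
      the sign of the cyclic cut.\<close>
    have "word_sign ds w * (sgn_pow (word_deg ds a * (word_deg ds y + word_deg ds b + ds ! l)) * F (ps @ [b @ l # a])) =
       W (ps @ [b @ l # a])" if "z = a @ y @ b" "y = concat ps" for a y b ps
    proof -
      have "word_sign ds w = (sgn_pow (word_deg ds a * (word_deg ds y + word_deg ds b + ds ! l)) *
          word_sign ds ((y @ b @ [l]) @ a) :: 'k)"
        using word_sign_commute[of ds a "y @ b @ [l]"] by (simp add: w that add.assoc)
      then show ?thesis
        by (simp add: W_def that sgn_pow_self mult_ac)
    qed
    then show "word_sign ds w *
      (\<Sum>(a, y, b)\<in>cuts3 (butlast w). sgn_pow (word_deg ds a * (word_deg ds y + word_deg ds b + ds ! last w)) *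
         (\<Sum>ps\<in>blocks y. F (ps @ [b @ last w # a]))) =
      (\<Sum>(a, y, b)\<in>cuts3 (butlast w). \<Sum>ps\<in>blocks y. W (ps @ [b @ last w # a]))"
      unfolding sum_distrib_left case_prod_unfold
      by (intro sum.cong refl) (auto simp: w cuts3_def blocks_def)
  qed
  also have "\<dots> = (\<Sum>x\<in>Sigma (permutations_of_multiset L - {[]}) (\<lambda>w. Sigma (cuts3 (butlast w)) (\<lambda>(a, y, b). blocks y)).
      case x of (w, (a, y, b), ps) \<Rightarrow> W (ps @ [b @ last w # a]))"
    by (simp add: sum.Sigma case_prod_unfold)
  \<comment> \<open>The mark is recorded as its position \<open>length b\<close> in the last factor.
    The condition \<open>ps \<noteq> []\<close> discards the empty factorization, which has no last
    factor.\<close>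
  also have "\<dots> = (\<Sum>x\<in>Sigma (all_factorizations L) (\<lambda>ps. {..<length (last ps)} \<inter> {i. ps \<noteq> []}). W (fst x))"
  proof (rule sum.reindex_bij_witness[
        where j = "\<lambda>(w, (a, y, b), ps). (ps @ [b @ last w # a], length b)"
          and i = "\<lambda>(qs, i). let l = last qs; a = drop (Suc i) l; b = take i l; y = concat (butlast qs)
                     in (a @ y @ b @ [l ! i], (a, y, b), butlast qs)"], goal_cases)
    case (1 x)
    then obtain w a y b ps where x: "x = (w, (a, y, b), ps)" "butlast w = a @ y @ b" "y = concat ps" "w \<noteq> []"
      by (cases x) (auto simp: cuts3_def blocks_def)
    then obtain l where "w = (a @ y @ b) @ [l]"
      by (metis append_butlast_last_id)
    with x show ?case by (simp add: Let_def)
  next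
    case (2 x)
    then obtain w a y b ps where x: "x = (w, (a, y, b), ps)" "butlast w = a @ y @ b" "y = concat ps" "w \<noteq> []"
      "[] \<notin> set ps" "mset w = L"
      by (cases x) (auto simp: cuts3_def blocks_def permutations_of_multiset_def)
    then obtain l where "w = (a @ y @ b) @ [l]"
      by (metis append_butlast_last_id)
    with x show ?case by (auto simp: all_factorizations_def)
  next
    case (3 x)
    then obtain ps i where x: "x = (ps, i)" "ps \<noteq> []" "i < length (last ps)"
      by (cases x) (auto split: if_splits)
    then obtain qs q where "ps = qs @ [q]"
      by (metis append_butlast_last_id)
    with x show ?case by (simp add: Let_def id_take_nth_drop[symmetric])
  next
    case (4 x)
    then obtain ps i where x: "x = (ps, i)" "ps \<noteq> []" "i < length (last ps)" "ps \<in> all_factorizations L"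
      by (cases x) (auto split: if_splits)
    then obtain qs q where ps: "ps = qs @ [q]"
      by (metis append_butlast_last_id)
    have "mset q = mset (drop (Suc i) q) + mset (take i q) + {#q ! i#}"
      using arg_cong[OF id_take_nth_drop[of i q], of mset] x by (simp add: ps)
    with x show ?case
      by (auto simp: ps Let_def cuts3_def blocks_def permutations_of_multiset_def all_factorizations_def butlast_append)
  qed (auto split: prod.splits)
  also have "\<dots> = (\<Sum>ps\<in>all_factorizations L. \<Sum>i\<in>{..<length (last ps)} \<inter> {i. ps \<noteq> []}. W ps)"
    by (subst sum.Sigma) (auto simp: case_prod_unfold)
  also have "\<dots> = (\<Sum>r\<le>size L. \<Sum>ps\<in>factorizations r L. (if r = 0 then 0 else of_nat (length (last ps)) * W ps))"
    unfolding sum_all_factorizations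
    by (intro sum.cong refl) (auto simp: factorizations_def)
  \<comment> \<open>For \<open>r = 0\<close> the right side is 0 because
    \<open>1 / of_nat 0 = 0\<close>.\<close>
  also have "\<dots> = (\<Sum>r\<le>size L. of_nat (size L) * (\<Sum>ps\<in>factorizations r L. 1 / of_nat r * W ps))"
  proof (rule sum.cong[OF refl])
    fix r
    show "(\<Sum>ps\<in>factorizations r L. (if r = 0 then 0 else of_nat (length (last ps)) * W ps)) =
        of_nat (size L) * (\<Sum>ps\<in>factorizations r L. 1 / of_nat r * W ps)"
    proof (cases r)
      case (Suc r')
      have eq: "of_nat r * (\<Sum>ps\<in>factorizations r L. of_nat (length (last ps)) * W ps) =
         of_nat (size L) * (\<Sum>ps\<in>factorizations r L. W ps)"
        unfolding Suc by (rule sum_length_last_factor) (rule W_rotate)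
      moreover have "(\<Sum>ps\<in>factorizations r L. 1 / of_nat r * W ps) = (\<Sum>ps\<in>factorizations r L. W ps) / of_nat r"
        by (simp add: sum_divide_distrib)
      moreover have "of_nat r \<noteq> (0 :: 'k)"
        by (simp only: Suc of_nat_neq_0 not_False_eq_True)
      then have "(\<Sum>ps\<in>factorizations r L. of_nat (length (last ps)) * W ps) =
          of_nat (size L) * (\<Sum>ps\<in>factorizations r L. W ps) / of_nat r"
        by (rule eq_divide_imp) (use eq in \<open>simp only: mult.commute\<close>)
      ultimately show ?thesis
        using Suc by (simp del: of_nat_Suc)
    qed simp
  qed
  finally show ?thesis
    by (simp add: W_def sum_distrib_left mult_ac)
qed

section \<open>The potentials as series of words\<close>

lemma multilinearI:
  assumes "vector_space s" "vector_space t"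
    and "\<And>us v w ws. length us + 1 + length ws = k \<Longrightarrow> c (us @ (v + w) # ws) = c (us @ v # ws) + c (us @ w # ws)"
    and "\<And>us r v ws. length us + 1 + length ws = k \<Longrightarrow> c (us @ s r v # ws) = t r (c (us @ v # ws))"
  shows "multilinear s t k c"
  using assms by (auto simp: multilinear_def Vector_Spaces.linear_iff)

lemma vector_space_field: "vector_space ((*) :: 'k::field \<Rightarrow> 'k \<Rightarrow> 'k)"
  by unfold_locales (auto simp: algebra_simps)

lemma multilinear_scaled_sum:
  fixes s :: "'k::field \<Rightarrow> 'a::ab_group_add \<Rightarrow> 'a"
  assumes "vector_space s" and "\<And>i. i \<in> I \<Longrightarrow> multilinear s (*) k (g i)"
  shows "multilinear s (*) k (\<lambda>xs. \<Sum>i\<in>I. r i * g i xs)"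
proof (rule multilinearI[OF assms(1) vector_space_field])
  fix us ws :: "'a list" and v w assume "length us + 1 + length ws = k"
  then show "(\<Sum>i\<in>I. r i * g i (us @ (v + w) # ws)) =
      (\<Sum>i\<in>I. r i * g i (us @ v # ws)) + (\<Sum>i\<in>I. r i * g i (us @ w # ws))"
    by (simp add: multilinear_add[OF assms(2)] distrib_left sum.distrib)
next
  fix us ws :: "'a list" and q v assume "length us + 1 + length ws = k"
  then show "(\<Sum>i\<in>I. r i * g i (us @ s q v # ws)) = q * (\<Sum>i\<in>I. r i * g i (us @ v # ws))"
    by (simp add: multilinear_scale[OF assms(2)] sum_distrib_left mult_ac)
qed

text \<open>A slot lies before, inside or after the string fed to \<open>m\<close>, so the composite
  depends on it through one slot of \<open>c\<close>, or of \<open>m\<close> within one slot of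
  \<open>c\<close>.\<close>

lemma multilinear_insert_op:
  fixes s :: "'k::field \<Rightarrow> 'a::ab_group_add \<Rightarrow> 'a"
  assumes vs: "vector_space s" and c: "multilinear s (*) (p + r + 1) c" and m: "multilinear s s k m"
  shows "multilinear s (*) (p + k + r) (\<lambda>xs. c (take p xs @ m (take k (drop p xs)) # drop (p + k) xs))"
    (is "multilinear _ _ _ ?f")
proof -
  have "\<exists>A B. (\<forall>v. ?f (us @ v # ws) = c (A @ v # B)) \<and> length A + 1 + length B = p + r + 1 \<or>
      (\<exists>A' B'. (\<forall>v. ?f (us @ v # ws) = c (A @ m (A' @ v # B') # B)) \<and> length A' + 1 + length B' = k
          \<and> length A + 1 + length B = p + r + 1)"
    if len: "length us + 1 + length ws = p + k + r" for us ws
  proof -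
    consider "length us < p" | "p \<le> length us" "length us < p + k" | "p + k \<le> length us"
      by linarith
    then show ?thesis
    proof cases
      case 1
      then obtain n where p: "p = Suc (length us + n)"
        using less_imp_Suc_add by blast
      show ?thesis
        by (rule exI[of _ us], rule exI[of _ "take n ws @ m (take k (drop n ws)) # drop (n + k) ws"], rule disjI1)
           (use len in \<open>auto simp: p min_def\<close>)
    next
      case 2
      define u1 u2 where "u1 = take p us" and "u2 = drop p us"
      with 2 have us: "us = u1 @ u2" "length u1 = p" "length u2 < k"
        by auto
      then obtain n where k: "k = Suc (length u2 + n)"
        using less_imp_Suc_add by blast
      show ?thesis
        by (rule exI[of _ u1], rule exI[of _ "drop n ws"], rule disjI2, rule exI[of _ u2], rule exI[of _ "take n ws"])
           (use us len in \<open>auto simp: k min_def\<close>)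
    next
      case 3
      define u1 u2 u3 where "u1 = take p us" and "u2 = take k (drop p us)" and "u3 = drop (p + k) us"
      have us: "us = u1 @ u2 @ u3"
        unfolding u1_def u2_def u3_def by (metis append_take_drop_id drop_drop add.commute)
      have lens: "length u1 = p" "length u2 = k"
        using 3 by (auto simp: u1_def u2_def)
      show ?thesis
        by (rule exI[of _ "u1 @ m u2 # u3"], rule exI[of _ ws], rule disjI1) (use us lens len in auto)
    qed
  qed
  note form = this
  show ?thesis
  proof (rule multilinearI[OF vs vector_space_field])
    fix us ws :: "'a list" and v w assume "length us + 1 + length ws = p + k + r"
    from form[OF this] show "?f (us @ (v + w) # ws) = ?f (us @ v # ws) + ?f (us @ w # ws)"
      by (elim exE disjE conjE) (simp_all add: multilinear_add[OF c] multilinear_add[OF m])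
  next
    fix us ws :: "'a list" and q v assume "length us + 1 + length ws = p + k + r"
    from form[OF this] show "?f (us @ s q v # ws) = q * ?f (us @ v # ws)"
      by (elim exE disjE conjE) (simp_all add: multilinear_scale[OF c] multilinear_scale[OF m])
  qed
qed

definition compositions3 :: "nat \<Rightarrow> (nat \<times> nat \<times> nat) set" where
  "compositions3 N = {(p, q, k). p + q + k = N \<and> 1 \<le> k}"

lemma finite_compositions3 [simp, intro]: "finite (compositions3 N)"
  by (rule finite_subset[of _ "{..N} \<times> {..N} \<times> {..N}"]) (auto simp: compositions3_def)

text \<open>Separates the signs, which depend on the degrees, from the expressions in the vectors,
  which are multilinear.\<close>

lemma potential_form_index:
  assumes "length zs = Suc N"
  shows "potential_form m \<phi> zs = (\<Sum>(p, q, k)\<in>compositions3 N. sgn_pow (sum_list (take p (map snd zs))) *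
     flat \<phi> p (take p (vecs zs) @ m (take k (drop p (vecs zs))) # drop (p + k) (vecs zs)))"
proof -
  from assms obtain z l where zs: "zs = z @ [l]" and len: "length z = N"
    by (cases zs rule: rev_cases) auto
  have "(\<Sum>(u, v, t)\<in>ncuts3 z. sgn_pow (total_deg u) * \<phi> (vecs u) (m (vecs v)) (vecs t) (fst l)) =
     (\<Sum>(p, q, k)\<in>compositions3 N. sgn_pow (sum_list (take p (map snd zs))) *
     flat \<phi> p (take p (vecs zs) @ m (take k (drop p (vecs zs))) # drop (p + k) (vecs zs)))"
  proof (rule sum.reindex_bij_witness[where i = "\<lambda>(p, q, k). (take p z, take k (drop p z), drop (p + k) z)"
        and j = "\<lambda>(u, v, t). (length u, length t, length v)"], goal_cases)
    case (1 x)
    then show ?case by (auto simp: ncuts3_def)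
  next
    case (2 x)
    then show ?case using len by (cases x) (auto simp: ncuts3_def compositions3_def Suc_le_eq)
  next
    case (3 x)
    then show ?case using len by (cases x) (auto simp: compositions3_def)
  next
    case (4 x)
    then show ?case using len
      by (cases x) (auto simp: ncuts3_def compositions3_def, metis append_take_drop_id drop_drop add.commute)
  next
    case (5 x)
    then obtain u v t where "x = (u, v, t)" "z = u @ v @ t"
      by (auto simp: ncuts3_def)
    then show ?case
      using flat_append[of \<phi> "vecs u" "m (vecs v)" "vecs t" "fst l"] by (simp add: zs)
  qed
  then show ?thesis
    by (simp add: potential_form_def zs)
qed

definition basis_word :: "'a list \<Rightarrow> int list \<Rightarrow> nat list \<Rightarrow> ('a \<times> int) list" where
  "basis_word es ds = map (\<lambda>j. (es ! j, ds ! j))"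

lemma vecs_basis_word [simp]: "vecs (basis_word es ds w) = map ((!) es) w"
  and snd_basis_word [simp]: "map snd (basis_word es ds w) = map ((!) ds) w"
  and length_basis_word [simp]: "length (basis_word es ds w) = length w"
  by (simp_all add: basis_word_def)

lemma (in graded_basis) graded_basis_word: "set w \<subseteq> {..<length es} \<Longrightarrow> graded G (basis_word es ds w)"
  using basis_component by (auto simp: graded_def basis_word_def)

lemma (in graded_basis) ext_form_insert_m:
  assumes "A_infinity_algebra scale G m" "multilinear scale (*) (p + q + 2) c" "1 \<le> k"
  shows "ext_form es ds c (replicate p gvar @ ext_op es ds scale es m (replicate k gvar) # replicate q gvar @ [gvar]) M =
    (\<Sum>w | w \<in> permutations_of_multiset M \<and> set w \<subseteq> {..<length es} \<and> length w = p + k + q + 1.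
       word_sign ds w * sgn_pow (word_deg ds (take p w)) *
       c (map ((!) es) (take p w) @ m (map ((!) es) (take k (drop p w))) # map ((!) es) (drop (p + k) w)))"
proof (rule ext_form_insert_op[OF assms(2,3)])
  interpret A_infinity_algebra scale G m by fact
  fix w assume "length w = k" "set w \<subseteq> {..<length es}"
  moreover from this assms(3) have "basis_word es ds w \<noteq> []"
    by (auto simp: basis_word_def)
  ultimately show "m (map ((!) es) w) \<in> G (word_deg ds w + 1 + 1)"
    using degree_m_vecs[OF graded_basis_word, of w] by (simp add: word_deg_map)
qed

lemma Sum_any_single:
  assumes "\<And>N. N \<noteq> n \<Longrightarrow> g N = 0"
  shows "Sum_any g = g n"
  using Sum_any.expand_superset[of "{n}" g] assms by auto

text \<open>All words of a monomial have the same length, so only \<open>N + 1 = size M\<close>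
  contributes and the weight becomes the reciprocal of the word length.\<close>

lemma potential_eq_word_series:
  fixes scale :: "'k::field_char_0 \<Rightarrow> 'a::ab_group_add \<Rightarrow> 'a"
  assumes alg: "A_infinity_dual_bimodule_map scale G m \<phi>" and basis: "graded_basis scale G es ds"
  shows "potential scale m \<phi> es ds = word_series ds (\<lambda>w. if set w \<subseteq> {..<length es}
      then twist_sign ds w * (1 / of_nat (length w) * potential_form m \<phi> (basis_word es ds w)) else 0)"
proof
  fix M
  interpret A_infinity_dual_bimodule_map scale G m \<phi> by fact
  interpret graded_basis scale G es ds by fact
  let ?W = "{w. w \<in> permutations_of_multiset M \<and> set w \<subseteq> {..<length es}}"
  have fin: "finite ?W"
    by (rule finite_subset[of _ "permutations_of_multiset M"]) auto
  define g where "g N = (\<Sum>(p, q, k)\<in>compositions3 N. 1 / of_nat (N + 1) *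
        ext_form es ds (flat \<phi> p)
          (replicate p gvar @ ext_op es ds scale es m (replicate k gvar) # replicate q gvar @ [gvar]) M)" for N
  have g: "g N = (if Suc N = size M then
      (\<Sum>w\<in>?W. word_sign ds w * (1 / of_nat (Suc N) * potential_form m \<phi> (basis_word es ds w))) else 0)" for N
  proof -
    have W: "{w. w \<in> permutations_of_multiset M \<and> set w \<subseteq> {..<length es} \<and> length w = N + 1} =
        (if Suc N = size M then ?W else {})"
      by (auto simp: permutations_of_multiset_def)
    have "g N = (\<Sum>(p, q, k)\<in>compositions3 N. 1 / of_nat (N + 1) *
       (\<Sum>w | w \<in> permutations_of_multiset M \<and> set w \<subseteq> {..<length es} \<and> length w = N + 1.
         word_sign ds w * sgn_pow (word_deg ds (take p w)) * flat \<phi> p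
           (map ((!) es) (take p w) @ m (map ((!) es) (take k (drop p w))) # map ((!) es) (drop (p + k) w))))"
      unfolding g_def
    proof (intro sum.cong refl, clarify)
      fix p q k assume "(p, q, k) \<in> compositions3 N"
      then have N: "N = p + k + q" and "1 \<le> k"
        by (auto simp: compositions3_def)
      show "1 / of_nat (N + 1) *
        ext_form es ds (flat \<phi> p)
          (replicate p gvar @ ext_op es ds scale es m (replicate k gvar) # replicate q gvar @ [gvar]) M =
        1 / of_nat (N + 1) *
       (\<Sum>w | w \<in> permutations_of_multiset M \<and> set w \<subseteq> {..<length es} \<and> length w = N + 1.
         word_sign ds w * sgn_pow (word_deg ds (take p w)) * flat \<phi> p
           (map ((!) es) (take p w) @ m (map ((!) es) (take k (drop p w))) # map ((!) es) (drop (p + k) w)))"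
        unfolding ext_form_insert_m[OF A_infinity_algebra_axioms multilinear_\<phi> \<open>1 \<le> k\<close>] N ..
    qed
    also have "\<dots> = (\<Sum>w | w \<in> permutations_of_multiset M \<and> set w \<subseteq> {..<length es} \<and> length w = N + 1.
        word_sign ds w * (1 / of_nat (Suc N) * potential_form m \<phi> (basis_word es ds w)))"
      unfolding sum_distrib_left case_prod_unfold
    proof (subst sum.swap, rule sum.cong[OF refl], goal_cases)
      case (1 w)
      then have "length (basis_word es ds w) = Suc N"
        by simp
      show ?case
        unfolding potential_form_index[OF \<open>length (basis_word es ds w) = Suc N\<close>] sum_distrib_left case_prod_unfold
        by (intro sum.cong refl) (simp add: word_deg_map take_map drop_map)
    qed
    also have "\<dots> = (if Suc N = size M then
      (\<Sum>w\<in>?W. word_sign ds w * (1 / of_nat (Suc N) * potential_form m \<phi> (basis_word es ds w))) else 0)"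
      unfolding W by (simp only: if_distrib[of "\<lambda>A. sum _ A"] sum.empty)
    finally show ?thesis .
  qed
  have "potential scale m \<phi> es ds M = Sum_any g"
    unfolding potential_def g_def compositions3_def ..
  also have "\<dots> = (\<Sum>w\<in>?W. word_sign ds w * (1 / of_nat (length w) * potential_form m \<phi> (basis_word es ds w)))"
  \<comment> \<open>No \<open>N\<close> belongs to the empty monomial, and the empty word has weight
    \<open>1 / of_nat 0 = 0\<close>.\<close>
  proof (cases "size M")
    case 0
    then have M: "M = {#}" by simp
    have "Sum_any g = 0"
      using Sum_any_single[of 0 g] by (simp add: g M)
    then show ?thesis
      by (simp add: M cong: conj_cong)
  next
    case (Suc n)
    then have "Sum_any g = g n"
      by (intro Sum_any_single) (auto simp: g)
    also have "\<dots> = (\<Sum>w\<in>?W. word_sign ds w * (1 / of_nat (length w) * potential_form m \<phi> (basis_word es ds w)))"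
      unfolding g using Suc by (auto intro!: sum.cong simp: permutations_of_multiset_def simp del: of_nat_Suc)
    finally show ?thesis .
  qed
  also have "\<dots> = word_series ds (\<lambda>w. if set w \<subseteq> {..<length es}
      then twist_sign ds w * (1 / of_nat (length w) * potential_form m \<phi> (basis_word es ds w)) else 0) M"
    unfolding word_series_def
    by (rule sum.mono_neutral_cong_left) (auto simp: word_sign_def mult_ac)
  finally show "potential scale m \<phi> es ds M = \<dots>" .
qed

text \<open>The inner product is a form with \<open>p = q = 0\<close>; words have at least two
  letters because \<open>k\<close> starts at 1.\<close>

lemma cyclic_potential_eq_sum:
  fixes scale :: "'k::field_char_0 \<Rightarrow> 'a::ab_group_add \<Rightarrow> 'a"
  assumes alg: "cyclic_A_infinity_algebra scale G m ip" and basis: "graded_basis scale G es ds"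
  shows "cyclic_potential scale m ip es ds M =
    (\<Sum>w | w \<in> permutations_of_multiset M \<and> set w \<subseteq> {..<length es} \<and> 2 \<le> length w.
       word_sign ds w * (1 / of_nat (length w) * ip (m (map ((!) es) (butlast w))) (es ! last w)))"
proof -
  interpret cyclic_A_infinity_algebra scale G m ip by fact
  interpret graded_basis scale G es ds by fact
  let ?c = "\<lambda>vs. ip (vs ! 0) (vs ! 1)"
  have vs: "vector_space scale"
    by unfold_locales
  have c: "multilinear scale (*) (0 + 0 + 2) ?c"
  proof (rule multilinearI[OF vs vector_space_field])
    fix us ws :: "'a list" and v w assume "length us + 1 + length ws = 0 + 0 + (2 :: nat)"
    then have "us = [] \<and> (\<exists>x. ws = [x]) \<or> (\<exists>x. us = [x]) \<and> ws = []"
      by (cases us; cases ws) auto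
    then show "?c (us @ (v + w) # ws) = ?c (us @ v # ws) + ?c (us @ w # ws)"
      using linear_left linear_right by (auto simp: Vector_Spaces.linear_iff)
  next
    fix us ws :: "'a list" and q v assume "length us + 1 + length ws = 0 + 0 + (2 :: nat)"
    then have "us = [] \<and> (\<exists>x. ws = [x]) \<or> (\<exists>x. us = [x]) \<and> ws = []"
      by (cases us; cases ws) auto
    then show "?c (us @ scale q v # ws) = q * ?c (us @ v # ws)"
      using linear_left linear_right by (auto simp: Vector_Spaces.linear_iff)
  qed
  let ?t = "\<lambda>w. word_sign ds w * (1 / of_nat (length w) * ip (m (map ((!) es) (butlast w))) (es ! last w))"
  have ext: "(if 1 \<le> k then 1 / of_nat (k + 1) * ext_form es ds ?c [ext_op es ds scale es m (replicate k gvar), gvar] M else 0) =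
    (if 1 \<le> k \<and> k + 1 = size M then
      (\<Sum>w | w \<in> permutations_of_multiset M \<and> set w \<subseteq> {..<length es} \<and> 2 \<le> length w. ?t w) else 0)" for k
  proof (cases "1 \<le> k")
    case True
    have W: "{w. w \<in> permutations_of_multiset M \<and> set w \<subseteq> {..<length es} \<and> length w = k + 1} =
        (if k + 1 = size M then {w. w \<in> permutations_of_multiset M \<and> set w \<subseteq> {..<length es} \<and> 2 \<le> length w} else {})"
    proof (cases "k + 1 = size M")
      case eq: True
      have "length w = size M" if "w \<in> permutations_of_multiset M" for w
        using that by (auto simp: permutations_of_multiset_def)
      with eq True show ?thesis by auto
    qed (auto simp: permutations_of_multiset_def)
    have "1 / of_nat (k + 1) * ext_form es ds ?c [ext_op es ds scale es m (replicate k gvar), gvar] M =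
      (\<Sum>w | w \<in> permutations_of_multiset M \<and> set w \<subseteq> {..<length es} \<and> length w = k + 1.
         1 / of_nat (k + 1) * (word_sign ds w * ?c (m (map ((!) es) (take k w)) # map ((!) es) (drop k w))))"
      using ext_form_insert_m[OF A_infinity_algebra_axioms c True, of M] by (simp add: sum_distrib_left)
    also have "\<dots> = (\<Sum>w | w \<in> permutations_of_multiset M \<and> set w \<subseteq> {..<length es} \<and> length w = k + 1. ?t w)"
    proof (rule sum.cong[OF refl], clarify)
      fix w :: "nat list" assume "length w = k + 1"
      then obtain z l where "w = z @ [l]" "length z = k"
        by (cases w rule: rev_cases) auto
      then show "1 / of_nat (k + 1) * (word_sign ds w * ?c (m (map ((!) es) (take k w)) # map ((!) es) (drop k w))) = ?t w"
        by simp
    qed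
    also have "\<dots> = (if k + 1 = size M then
      (\<Sum>w | w \<in> permutations_of_multiset M \<and> set w \<subseteq> {..<length es} \<and> 2 \<le> length w. ?t w) else 0)"
      unfolding W by (simp only: if_distrib[of "\<lambda>A. sum _ A"] sum.empty)
    finally show ?thesis
      using True by simp
  qed simp
  show ?thesis
  proof (cases "2 \<le> size M")
    case True
    have "cyclic_potential scale m ip es ds M = (if 1 \<le> size M - 1 \<and> size M - 1 + 1 = size M then
      (\<Sum>w | w \<in> permutations_of_multiset M \<and> set w \<subseteq> {..<length es} \<and> 2 \<le> length w. ?t w) else 0)"
      unfolding cyclic_potential_def ext by (rule Sum_any_single) auto
    with True show ?thesis by simp
  next
    case False
    have "cyclic_potential scale m ip es ds M = Sum_any (\<lambda>_ :: nat. 0)"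
      unfolding cyclic_potential_def ext using False by (intro arg_cong[where f = Sum_any]) (auto simp: fun_eq_iff)
    moreover have "{w. w \<in> permutations_of_multiset M \<and> set w \<subseteq> {..<length es} \<and> 2 \<le> length w} = {}"
      using False by (auto simp: permutations_of_multiset_def)
    ultimately show ?thesis by (simp only: sum.empty) simp
  qed
qed

section \<open>Substitution of the homomorphism into the potential\<close>

lemma basis_word_eq_Nil_iff [simp]: "basis_word es ds w = [] \<longleftrightarrow> w = []"
  by (simp add: basis_word_def)

lemma sum_cuts3_map:
  "(\<Sum>(u, v, t)\<in>cuts3 (map g xs). f u v t) = (\<Sum>(u, v, t)\<in>cuts3 xs. f (map g u) (map g v) (map g t))"
  unfolding sum_cuts3[symmetric] by (simp add: take_map drop_map)

lemma kprod_word_series_eq_0: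
  assumes "\<And>i. \<chi> i [] = (0 :: 'k::comm_ring_1)" and "length is = r" "size L < r"
  shows "kprod de ds (replicate r (\<lambda>i. word_series ds (\<chi> i))) is L = 0"
proof -
  have "factorizations r L = {}"
    using assms(3) length_le_length_concat by (fastforce simp: factorizations_def)
  then show ?thesis
    using kprod_word_series[of "replicate r \<chi>" "is" de ds L] assms by simp
qed

text \<open>\<open>gprod_sort\<close> and \<open>twist_gprod\<close> absorb \<open>var_sign\<close>
  and \<open>twist_sign\<close> into the \<open>kprod\<close> of the unsorted word, so the sum over
  monomials becomes a sum over words. It is finite because a product of more than
  \<open>size L\<close> series without constant term vanishes at \<open>L\<close>.\<close>

lemma gsubst_word_series:
  fixes \<chi> :: "nat \<Rightarrow> nat list \<Rightarrow> 'k::field_char_0"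
  assumes nil: "\<And>i. \<chi> i [] = 0" and deg: "\<And>i p. \<chi> i p \<noteq> 0 \<Longrightarrow> even (word_deg ds p - de ! i)"
    and X: "\<And>i. i < n \<Longrightarrow> X i = word_series ds (\<chi> i)"
  shows "gsubst ds X (word_series de (\<lambda>w. if set w \<subseteq> {..<n} then twist_sign de w * c w else 0)) L =
    (\<Sum>r\<le>size L. \<Sum>is | length is = r \<and> set is \<subseteq> {..<n}.
       c is * kprod de ds (replicate r (\<lambda>i. word_series ds (\<chi> i))) is L)"
proof -
  let ?\<Phi> = "word_series de (\<lambda>w. if set w \<subseteq> {..<n} then twist_sign de w * c w else 0)"
  let ?f = "\<lambda>is. c is * kprod de ds (replicate (length is) (\<lambda>i. word_series ds (\<chi> i))) is L"
  define g where "g M = ?\<Phi> M * gprod ds (map X (sorted_list_of_multiset M)) L" for M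
  define S where "S = {is. set is \<subseteq> {..<n} \<and> length is \<le> size L}"
  have fin: "finite S"
    unfolding S_def by (rule finite_lists_length_le) simp
  have g: "g M = (\<Sum>is | is \<in> permutations_of_multiset M \<and> set is \<subseteq> {..<n}. ?f is)" for M
  proof -
    have \<Phi>: "?\<Phi> M = (\<Sum>is\<in>permutations_of_multiset M.
        (if set is \<subseteq> {..<n} then twist_sign de is * c is else 0) * var_sign de is)"
      by (simp add: word_series_def)
    have "g M = (\<Sum>is\<in>permutations_of_multiset M. if set is \<subseteq> {..<n} then ?f is else 0)"
      unfolding g_def \<Phi> sum_distrib_right
    proof (rule sum.cong[OF refl])
      fix "is" assume "is \<in> permutations_of_multiset M"
      then have M: "M = mset is"
        by (simp add: permutations_of_multiset_def)
      have sort: "gprod ds (map (\<lambda>i. word_series ds (\<chi> i)) is) =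
          (\<lambda>L. var_sign de is * gprod ds (map (\<lambda>i. word_series ds (\<chi> i)) (sort is)) L)"
        using nil deg by (rule gprod_sort)
      have twist: "kprod de ds (replicate (length is) (\<lambda>i. word_series ds (\<chi> i))) is =
          (\<lambda>L. twist_sign de is * gprod ds (map (\<lambda>i. word_series ds (\<chi> i)) is) L)"
        using deg by (rule twist_gprod)
      have mapX: "map X (sort is) = map (\<lambda>i. word_series ds (\<chi> i)) (sort is)" if "set is \<subseteq> {..<n}"
        using that by (auto simp: X)
      show "(if set is \<subseteq> {..<n} then twist_sign de is * c is else 0) * var_sign de is *
          gprod ds (map X (sorted_list_of_multiset M)) L = (if set is \<subseteq> {..<n} then ?f is else 0)"
        unfolding M twist sort
        by (cases "set is \<subseteq> {..<n}") (simp_all only: mapX if_True if_False mult_ac sorted_list_of_multiset_mset mult_zero_left)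
    qed
    also have "\<dots> = (\<Sum>is | is \<in> permutations_of_multiset M \<and> set is \<subseteq> {..<n}. ?f is)"
      by (simp add: sum.inter_filter)
    finally show ?thesis .
  qed
  have "gsubst ds X ?\<Phi> L = Sum_any g"
    by (simp add: gsubst_def g_def)
  also have "\<dots> = (\<Sum>M\<in>mset ` S. g M)"
  proof (rule Sum_any.expand_superset)
    show "{M. g M \<noteq> 0} \<subseteq> mset ` S"
    proof clarify
      fix M assume "g M \<noteq> 0"
      then obtain "is" where "is \<in> {is. is \<in> permutations_of_multiset M \<and> set is \<subseteq> {..<n}}" and nz: "?f is \<noteq> 0"
        unfolding g by (rule sum.not_neutral_contains_not_neutral)
      then have "is": "mset is = M" "set is \<subseteq> {..<n}"
        by (auto simp: permutations_of_multiset_def)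
      have "length is \<le> size L"
      proof (rule ccontr)
        assume "\<not> length is \<le> size L"
        then have "kprod de ds (replicate (length is) (\<lambda>i. word_series ds (\<chi> i))) is L = 0"
          using nil by (intro kprod_word_series_eq_0) auto
        with nz show False by simp
      qed
      with "is" show "M \<in> mset ` S"
        by (auto simp: S_def)
    qed
  qed (use fin in simp)
  also have "\<dots> = (\<Sum>M\<in>mset ` S. \<Sum>is | is \<in> S \<and> mset is = M. ?f is)"
  proof (intro sum.cong refl)
    fix M assume "M \<in> mset ` S"
    then have "{is. is \<in> permutations_of_multiset M \<and> set is \<subseteq> {..<n}} = {is. is \<in> S \<and> mset is = M}"
      by (auto simp: S_def permutations_of_multiset_def dest: mset_eq_length)
    then show "g M = (\<Sum>is | is \<in> S \<and> mset is = M. ?f is)"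
      unfolding g by simp
  qed
  also have "\<dots> = (\<Sum>is\<in>S. ?f is)"
    by (rule sum.image_gen[symmetric, OF fin])
  also have "\<dots> = (\<Sum>r\<le>size L. \<Sum>is | is \<in> S \<and> length is = r. ?f is)"
    by (rule sum.group[symmetric]) (use fin in \<open>auto simp: S_def\<close>)
  also have "\<dots> = (\<Sum>r\<le>size L. \<Sum>is | length is = r \<and> set is \<subseteq> {..<n}.
       c is * kprod de ds (replicate r (\<lambda>i. word_series ds (\<chi> i))) is L)"
    by (intro sum.cong) (auto simp: S_def)
  finally show ?thesis .
qed

lemma graded_basisI:
  "graded_vector_space scale G \<Longrightarrow> homogeneous_basis scale G es ds \<Longrightarrow> graded_basis scale G es ds"
  by (simp add: graded_basis_def graded_basis_axioms_def)

text \<open>The operation \<open>f\<close> has degree 0, so \<open>kos\<close> vanishes and the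
  substitution adds no sign beyond \<open>word_sign\<close>.\<close>

lemma (in graded_basis) sum_potential_form_kprod:
  fixes \<phi> :: "('a, 'k) dual_bimodule_map"
  assumes bimodule: "A_infinity_dual_bimodule_map scale G m \<phi>"
    and f: "\<And>p. p \<noteq> [] \<Longrightarrow> set p \<subseteq> I \<Longrightarrow> f p \<in> G (word_deg df p + 1)" and nil: "f [] = 0"
  shows "(\<Sum>is | length is = r \<and> set is \<subseteq> {..<length es}.
       1 / of_nat (length is) * potential_form m \<phi> (basis_word es ds is) *
       kprod ds df (replicate r (\<lambda>i. word_series df (op_coeff df I f i))) is L) =
    (if set_mset L \<subseteq> I then (\<Sum>ps\<in>factorizations r L. word_sign df (concat ps) *
       (1 / of_nat r * potential_form m \<phi> (map (\<lambda>p. (f p, word_deg df p)) ps))) else 0)"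
proof (cases r)
  \<comment> \<open>The weight \<open>1 / of_nat 0\<close> is 0 on both sides.\<close>
  case 0
  have "(\<Sum>is | length is = r \<and> set is \<subseteq> {..<length es}.
       1 / of_nat (length is) * potential_form m \<phi> (basis_word es ds is) *
       kprod ds df (replicate r (\<lambda>i. word_series df (op_coeff df I f i))) is L) = 0"
    using 0 by (intro sum.neutral) simp
  then show ?thesis
    by (simp add: 0)
next
  case (Suc N)
  interpret A_infinity_dual_bimodule_map scale G m \<phi> by fact
  define C where "C xs dds = (\<Sum>x\<in>compositions3 N. 1 / of_nat r * sgn_pow (sum_list (take (fst x) dds)) *
      (case x of (p, q, k) \<Rightarrow> flat \<phi> p (take p xs @ m (take k (drop p xs)) # drop (p + k) xs)))"
    for xs :: "'a list" and dds
  have C: "C (vecs zs) (map snd zs) = 1 / of_nat r * potential_form m \<phi> zs" if "length zs = r" for zs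
    using that Suc by (simp add: C_def potential_form_index[of zs N] case_prod_unfold sum_distrib_left mult.assoc)
  have multilinear_C: "multilinear scale (*) r (\<lambda>xs. C xs dds)" for dds
    unfolding C_def
  proof (rule multilinear_scaled_sum)
    show "vector_space scale" by unfold_locales
    fix x assume "x \<in> compositions3 N"
    then obtain p q k where x: "x = (p, q, k)" "1 \<le> k" "r = p + k + Suc q"
      by (auto simp: compositions3_def Suc)
    have "multilinear scale (*) (p + Suc q + 1) (flat \<phi> p)"
      using multilinear_\<phi>[of p q] by simp
    from multilinear_insert_op[OF \<open>vector_space scale\<close> this multilinear_m[OF x(2)]]
    show "multilinear scale (*) r (\<lambda>xs. case x of (p, q, k) \<Rightarrow>
        flat \<phi> p (take p xs @ m (take k (drop p xs)) # drop (p + k) xs))"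
      by (simp add: x)
  qed
  let ?fs = "replicate r f"
  have lhs: "(\<Sum>is | length is = r \<and> set is \<subseteq> {..<length es}.
       1 / of_nat (length is) * potential_form m \<phi> (basis_word es ds is) *
       kprod ds df (replicate r (\<lambda>i. word_series df (op_coeff df I f i))) is L) =
    (\<Sum>is | length is = length ?fs \<and> set is \<subseteq> {..<length es}. C (map ((!) es) is) (map ((!) ds) is) *
       kprod ds df (map (\<lambda>f i. word_series df (op_coeff df I f i)) ?fs) is L)"
  proof (rule sum.cong)
    fix "is" assume "is \<in> {is. length is = length ?fs \<and> set is \<subseteq> {..<length es}}"
    then show "1 / of_nat (length is) * potential_form m \<phi> (basis_word es ds is) *
       kprod ds df (replicate r (\<lambda>i. word_series df (op_coeff df I f i))) is L =
      C (map ((!) es) is) (map ((!) ds) is) *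
       kprod ds df (map (\<lambda>f i. word_series df (op_coeff df I f i)) ?fs) is L"
      using C[of "basis_word es ds is"] by simp
  qed simp
  show ?thesis
  proof (cases "set_mset L \<subseteq> I")
    case False
    have "kprod ds df (map (\<lambda>f i. word_series df (op_coeff df I f i)) ?fs) is L = 0" if "length is = length ?fs" for "is"
      using nil that False by (intro kprod_out_of_range) auto
    then have "(\<Sum>is | length is = length ?fs \<and> set is \<subseteq> {..<length es}. C (map ((!) es) is) (map ((!) ds) is) *
       kprod ds df (map (\<lambda>f i. word_series df (op_coeff df I f i)) ?fs) is L) = 0"
      by (intro sum.neutral ballI) (simp only: mem_Collect_eq mult_zero_right)
    with False show ?thesis
      unfolding lhs by simp
  next
    case True
    have "(\<Sum>is | length is = length ?fs \<and> set is \<subseteq> {..<length es}. C (map ((!) es) is) (map ((!) ds) is) *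
       kprod ds df (map (\<lambda>f i. word_series df (op_coeff df I f i)) ?fs) is L) =
     (\<Sum>ps\<in>factorizations (length ?fs) L.
            word_sign df (concat ps) * sgn_pow (kos (replicate r 0) (map (word_deg df) ps)) *
            C (map2 (\<lambda>f p. f p) ?fs ps) (map2 (\<lambda>g p. word_deg df p + g) (replicate r 0) ps))"
    proof (rule sum_kprod_op_coeff[OF _ _ _ True])
      have "f p \<in> G (word_deg df p + 0 + 1)" if "set p \<subseteq> I" for p
        using f[of p] that nil subspace_0[OF subspace_component] by (cases "p = []") auto
      then show "list_all2 (\<lambda>f g. \<forall>p. set p \<subseteq> I \<longrightarrow> f p \<in> G (word_deg df p + g + 1)) ?fs (replicate r 0)"
        by (auto simp: list_all2_conv_all_nth)
    qed (use nil multilinear_C in auto)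
    also have "\<dots> = (\<Sum>ps\<in>factorizations r L. word_sign df (concat ps) *
       (1 / of_nat r * potential_form m \<phi> (map (\<lambda>p. (f p, word_deg df p)) ps)))"
    proof (intro sum.cong)
      fix ps assume "ps \<in> factorizations r L"
      then have len: "length ps = r"
        by (simp add: factorizations_def)
      let ?zs = "map (\<lambda>p. (f p, word_deg df p)) ps"
      have "map2 (\<lambda>f p. f p) ?fs ps = vecs ?zs" "map2 (\<lambda>g p. word_deg df p + g) (replicate r 0) ps = map snd ?zs"
        unfolding len[symmetric] by (induction ps) auto
      then show "word_sign df (concat ps) * sgn_pow (kos (replicate r 0) (map (word_deg df) ps)) *
            C (map2 (\<lambda>f p. f p) ?fs ps) (map2 (\<lambda>g p. word_deg df p + g) (replicate r 0) ps) =
         word_sign df (concat ps) * (1 / of_nat r * potential_form m \<phi> ?zs)"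
        using C[of ?zs] len by (simp only: kos_zero length_map) simp
    qed simp
    finally show ?thesis
      unfolding lhs using True by simp
  qed
qed

text \<open>At \<open>M\<close> only the arity \<open>size M\<close> contributes, so all arities
  merge into one operation on words; its value 0 at the empty word reflects that arities start at
  1.\<close>

lemma (in A_infinity_hom) hom_series_eq_word_series:
  assumes source: "graded_basis scale G fs dfs" and target: "graded_basis scale' G' es des"
  shows "hom_series fs dfs scale' es f i =
    word_series dfs (graded_basis.op_coeff scale' es dfs {..<length fs} (\<lambda>p. if p = [] then 0 else f (map ((!) fs) p)) i)"
proof
  interpret source: graded_basis scale G fs dfs by fact
  interpret target: graded_basis scale' G' es des by fact
  fix M
  let ?c = "target.op_coeff dfs {..<length fs}"
  let ?f = "\<lambda>p. if p = [] then 0 else f (map ((!) fs) p)"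
  have "(if 1 \<le> k then ext_op fs dfs scale' es f (replicate k gvar) i M else 0) =
      (if k = size M then word_series dfs (?c ?f i) M else 0)" for k
  proof (cases "1 \<le> k")
    case True
    have "word_series dfs (?c (source.restrict_op k f) i) M = (if k = size M then word_series dfs (?c ?f i) M else 0)"
    proof (cases "k = size M")
      case eq: True
      have "?c (source.restrict_op k f) i w = ?c ?f i w" if "w \<in> permutations_of_multiset M" for w
        using that eq True by (auto simp: target.op_coeff_def source.restrict_op_def permutations_of_multiset_def)
      with eq show ?thesis
        by (simp add: word_series_def)
    next
      case False
      have "?c (source.restrict_op k f) i w = 0" if "w \<in> permutations_of_multiset M" for w
        using that False by (auto simp: target.op_coeff_def source.restrict_op_def permutations_of_multiset_def)
      with False show ?thesis
        by (simp add: word_series_def)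
    qed
    with True show ?thesis
      by (simp add: source.ext_op_gvar[OF target])
  next
    case False
    have "word_series dfs (?c ?f i) {#} = 0"
      by (simp add: word_series_def target.op_coeff_def)
    with False show ?thesis
      by (auto simp: Suc_le_eq)
  qed
  then have "hom_series fs dfs scale' es f i M = Sum_any (\<lambda>k. if k = size M then word_series dfs (?c ?f i) M else 0)"
    by (simp add: hom_series_def)
  also have "\<dots> = word_series dfs (?c ?f i) M"
    by (subst Sum_any_single[of "size M"]) auto
  finally show "hom_series fs dfs scale' es f i M = word_series dfs (?c ?f i) M" .
qed


theorem theorem3p1:
  fixes scaleA :: "'k::field_char_0 \<Rightarrow> 'a::ab_group_add \<Rightarrow> 'a"
    and GA :: "int \<Rightarrow> 'a set" and mA :: "'a list \<Rightarrow> 'a"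
    and \<phi> :: "('a, 'k) dual_bimodule_map"
    and scaleB :: "'k \<Rightarrow> 'b::ab_group_add \<Rightarrow> 'b"
    and GB :: "int \<Rightarrow> 'b set" and mB :: "'b list \<Rightarrow> 'b"
    and ip :: "'b \<Rightarrow> 'b \<Rightarrow> 'k"
    and h :: "'b list \<Rightarrow> 'a"
    and es :: "'a list" and des :: "int list"
    and fs :: "'b list" and dfs :: "int list"
  assumes "A_infinity_algebra scaleA GA mA"
    and "strong_homotopy_inner_product scaleA GA mA \<phi>"
    and "cyclic_A_infinity_algebra scaleB GB mB ip"
    and "A_infinity_quasi_isomorphism scaleB GB mB scaleA GA mA h"
    and "is_pullback GB h \<phi> (cyclic_bimodule_map ip)"
    and "homogeneous_basis scaleA GA es des"
    and "homogeneous_basis scaleB GB fs dfs"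
  shows "cyclic_potential scaleB mB ip fs dfs =
         pullback_series fs dfs scaleA es h (potential scaleA mA \<phi> es des)"
proof
  fix L
  interpret A: strong_homotopy_inner_product scaleA GA mA \<phi> by fact
  interpret B: cyclic_A_infinity_algebra scaleB GB mB ip by fact
  interpret hom: A_infinity_hom scaleB GB mB scaleA GA mA h
    using assms(4) by (simp add: A_infinity_quasi_isomorphism_def)
  interpret A: graded_basis scaleA GA es des
    using A.graded_vector_space_axioms assms(6) by (rule graded_basisI)
  interpret B: graded_basis scaleB GB fs dfs
    using B.graded_vector_space_axioms assms(7) by (rule graded_basisI)
  let ?I = "{..<length fs}"
  let ?h = "\<lambda>p. if p = [] then 0 else h (map ((!) fs) p)"
  let ?b = "basis_word fs dfs"
  \<comment> \<open>Indices beyond the basis have no degree; with zero series there, the parity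
    condition of \<open>gsubst_word_series\<close> holds for every \<open>i\<close>.\<close>
  define \<chi> where "\<chi> i = (if i < length es then A.op_coeff dfs ?I ?h i else (\<lambda>_. 0))" for i
  define F where "F ps = potential_form mA \<phi> (map (\<lambda>p. hom_vec h (?b p)) ps)" for ps
  have h_deg: "?h p \<in> GA (word_deg dfs p + 1)" if "p \<noteq> []" "set p \<subseteq> ?I" for p
    using hom.degree_f_vecs[OF B.graded_basis_word, of p] that
    by (simp add: word_deg_map)
  have total_deg_b: "total_deg (?b p) = word_deg dfs p" for p
    by (simp add: word_deg_map)
  have pullback: "pullback_series fs dfs scaleA es h (potential scaleA mA \<phi> es des) L =
      (if set_mset L \<subseteq> ?I then \<Sum>r\<le>size L. \<Sum>ps\<in>factorizations r L.
         word_sign dfs (concat ps) * (1 / of_nat r * F ps) else 0)"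
  proof -
    have "pullback_series fs dfs scaleA es h (potential scaleA mA \<phi> es des) L =
      (\<Sum>r\<le>size L. \<Sum>is | length is = r \<and> set is \<subseteq> {..<length es}.
         1 / of_nat (length is) * potential_form mA \<phi> (basis_word es des is) *
         kprod des dfs (replicate r (\<lambda>i. word_series dfs (\<chi> i))) is L)"
      unfolding pullback_series_def
        potential_eq_word_series[OF A.A_infinity_dual_bimodule_map_axioms A.graded_basis_axioms]
    proof (rule gsubst_word_series)
      show "\<chi> i [] = 0" for i
        by (simp add: \<chi>_def A.op_coeff_def)
      show "even (word_deg dfs p - des ! i)" if "\<chi> i p \<noteq> 0" for i p
      proof -
        from that have i: "i < length es" and p: "set p \<subseteq> ?I" "p \<noteq> []" and nz: "A.coord (?h p) i \<noteq> 0"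
          by (auto simp: \<chi>_def A.op_coeff_def split: if_splits)
        from A.coord_nonzero_degree[OF h_deg[OF p(2,1)] i nz] show ?thesis by simp
      qed
      show "hom_series fs dfs scaleA es h i = word_series dfs (\<chi> i)" if "i < length es" for i
        using that hom.hom_series_eq_word_series[OF B.graded_basis_axioms A.graded_basis_axioms]
        by (simp add: \<chi>_def)
    qed
    also have "\<dots> = (\<Sum>r\<le>size L. \<Sum>is | length is = r \<and> set is \<subseteq> {..<length es}.
         1 / of_nat (length is) * potential_form mA \<phi> (basis_word es des is) *
         kprod des dfs (replicate r (\<lambda>i. word_series dfs (A.op_coeff dfs ?I ?h i))) is L)"
    proof (intro sum.cong refl)
      fix r "is" assume "is \<in> {is. length is = r \<and> set is \<subseteq> {..<length es}}"
      then have "\<forall>i\<in>set is. word_series dfs (\<chi> i) = word_series dfs (A.op_coeff dfs ?I ?h i)"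
        by (auto simp: \<chi>_def)
      then have "list_all2 (\<lambda>F F'. \<forall>i\<in>set is. F i = F' i) (replicate r (\<lambda>i. word_series dfs (\<chi> i)))
          (replicate r (\<lambda>i. word_series dfs (A.op_coeff dfs ?I ?h i)))"
        by (simp add: list_all2_conv_all_nth)
      from kprod_cong[OF this] show "1 / of_nat (length is) * potential_form mA \<phi> (basis_word es des is) *
          kprod des dfs (replicate r (\<lambda>i. word_series dfs (\<chi> i))) is L =
        1 / of_nat (length is) * potential_form mA \<phi> (basis_word es des is) *
          kprod des dfs (replicate r (\<lambda>i. word_series dfs (A.op_coeff dfs ?I ?h i))) is L"
        by (rule arg_cong[where f = "\<lambda>F. _ * F L"])
    qed
    also have "\<dots> = (\<Sum>r\<le>size L. if set_mset L \<subseteq> ?I then \<Sum>ps\<in>factorizations r L. word_sign dfs (concat ps) *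
       (1 / of_nat r * potential_form mA \<phi> (map (\<lambda>p. (?h p, word_deg dfs p)) ps)) else 0)"
      using A.sum_potential_form_kprod[OF A.A_infinity_dual_bimodule_map_axioms, of ?I ?h dfs, OF h_deg]
      by simp
    also have "\<dots> = (\<Sum>r\<le>size L. if set_mset L \<subseteq> ?I then \<Sum>ps\<in>factorizations r L. word_sign dfs (concat ps) *
       (1 / of_nat r * F ps) else 0)"
    proof -
      have eq: "map (\<lambda>p. (?h p, word_deg dfs p)) ps = map (\<lambda>p. hom_vec h (?b p)) ps" if "ps \<in> factorizations r L" for r ps
        using that by (auto simp: factorizations_def hom_vec_def word_deg_map)
      show ?thesis
        unfolding F_def by (intro sum.cong if_cong refl) (simp only: eq)
    qed
    finally show ?thesis
      by (simp add: if_distrib)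
  qed
  show "cyclic_potential scaleB mB ip fs dfs L =
      pullback_series fs dfs scaleA es h (potential scaleA mA \<phi> es des) L"
  proof (cases "set_mset L \<subseteq> ?I")
    case False
    then have W: "{w. w \<in> permutations_of_multiset L \<and> set w \<subseteq> ?I \<and> 2 \<le> length w} = {}"
      by (auto simp: permutations_of_multiset_def)
    with False show ?thesis
      unfolding pullback cyclic_potential_eq_sum[OF B.cyclic_A_infinity_algebra_axioms B.graded_basis_axioms] W
      by simp
  next
    case True
    let ?E = "\<lambda>w. \<Sum>(a, y, b)\<in>cuts3 (butlast w).
        sgn_pow (word_deg dfs a * (word_deg dfs y + word_deg dfs b + dfs ! last w)) *
         (\<Sum>ps\<in>blocks y. F (ps @ [b @ last w # a]))"
    have rot: "F (p # ps) = sgn_pow (word_deg dfs p * word_deg dfs (concat ps)) * F (ps @ [p])"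
      if "[] \<notin> set (p # ps)" "mset (concat (p # ps)) = L" for p ps
    proof -
      have "set (concat (p # ps)) \<subseteq> ?I"
        using that(2) True by (metis set_mset_mset)
      have "fst (hom_vec h (?b q)) \<in> GA (snd (hom_vec h (?b q)) + 1)" if "q \<in> set (p # ps)" for q
      proof -
        have "q \<noteq> []"
          using that \<open>[] \<notin> set (p # ps)\<close> by metis
        moreover have "set q \<subseteq> ?I"
          using that \<open>set (concat (p # ps)) \<subseteq> ?I\<close> by auto
        ultimately show ?thesis
          using h_deg[of q] unfolding fst_hom_vec snd_hom_vec total_deg_b by simp
      qed
      then have "graded GA (hom_vec h (?b p) # map (\<lambda>p. hom_vec h (?b p)) ps)"
        by (simp add: graded_def case_prod_unfold del: fst_hom_vec snd_hom_vec)
      moreover have "total_deg (map (\<lambda>p. hom_vec h (?b p)) ps) = word_deg dfs (concat ps)"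
        by (induction ps) (simp_all add: total_deg_b del: snd_basis_word)
      ultimately show ?thesis
        using A.potential_form_rotate[of "hom_vec h (?b p)" "map (\<lambda>p. hom_vec h (?b p)) ps"]
        unfolding F_def list.map map_append snd_hom_vec total_deg_b by (simp only:)
    qed
    have form: "ip (mB (map ((!) fs) (butlast w))) (fs ! last w) = ?E w"
      if w: "w \<in> permutations_of_multiset L" "2 \<le> length w" for w
    proof -
      from w(2) obtain z l where z: "w = z @ [l]" "z \<noteq> []"
        by (cases w rule: rev_cases) (auto simp: Suc_le_eq)
      have "set w \<subseteq> ?I"
        using w(1) True by (auto simp: permutations_of_multiset_def)
      then have "graded GB (?b z @ [(fs ! l, dfs ! l)])"
        using B.graded_basis_word[of w] by (simp add: z basis_word_def)
      moreover have "?b z \<noteq> []"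
        using z by (simp add: basis_word_def)
      ultimately have "ip (mB (vecs (?b z))) (fst (fs ! l, dfs ! l)) =
        (\<Sum>(a, y, b)\<in>cuts3 (?b z). sgn_pow (total_deg a * (total_deg y + total_deg b + snd (fs ! l, dfs ! l))) *
           (\<Sum>ps\<in>blocks y. potential_form mA \<phi> (map (hom_vec h) ps @ [hom_vec h (b @ (fs ! l, dfs ! l) # a)])))"
        using hom.cyclic_form_eq_potential_form[OF A.A_infinity_dual_bimodule_map_axioms assms(5)] by blast
      also have "\<dots> = ?E w"
        unfolding basis_word_def sum_cuts3_map sum_blocks_map z F_def
        by (simp add: comp_def word_deg_map basis_word_def)
      finally show ?thesis
        by (simp add: z)
    qed
    \<comment> \<open>The averaging runs over all nonempty words, the cyclic potential only over
      those of length at least 2. They agree, since a form with a single entry leaves no string for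
      the operation.\<close>
    have E_singleton: "?E [l] = 0" for l
    proof -
      have "cuts3 ([] :: nat list) = {([], [], [])}" "blocks ([] :: nat list) = {[]}"
        by (auto simp: cuts3_def blocks_def) (metis list.set_intros(1) neq_Nil_conv)
      moreover have "ncuts3 ([] :: ('a \<times> int) list) = {}"
        by (auto simp: ncuts3_def)
      ultimately show ?thesis
        by (simp add: F_def potential_form_def)
    qed
    have "cyclic_potential scaleB mB ip fs dfs L =
      (\<Sum>w | w \<in> permutations_of_multiset L \<and> 2 \<le> length w. word_sign dfs w * (1 / of_nat (size L) * ?E w))"
      unfolding cyclic_potential_eq_sum[OF B.cyclic_A_infinity_algebra_axioms B.graded_basis_axioms]
      using True form by (intro sum.cong) (auto simp: permutations_of_multiset_def)
    also have "\<dots> = (\<Sum>w\<in>permutations_of_multiset L - {[]}. word_sign dfs w * (1 / of_nat (size L) * ?E w))"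
    proof (rule sum.mono_neutral_left)
      show "\<forall>w\<in>permutations_of_multiset L - {[]} - {w. w \<in> permutations_of_multiset L \<and> 2 \<le> length w}.
          word_sign dfs w * (1 / of_nat (size L) * ?E w) = 0"
      proof
        fix w assume "w \<in> permutations_of_multiset L - {[]} - {w. w \<in> permutations_of_multiset L \<and> 2 \<le> length w}"
        then obtain l where "w = [l]"
          by (cases w) (auto simp: Suc_le_eq)
        then show "word_sign dfs w * (1 / of_nat (size L) * ?E w) = 0"
          using E_singleton[of l] by simp
      qed
    qed auto
    also have "\<dots> = 1 / of_nat (size L) * (\<Sum>w\<in>permutations_of_multiset L - {[]}. word_sign dfs w * ?E w)"
      by (simp add: sum_distrib_left mult_ac)
    also have "\<dots> = 1 / of_nat (size L) * (of_nat (size L) * (\<Sum>r\<le>size L. \<Sum>ps\<in>factorizations r L.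
         word_sign dfs (concat ps) * (1 / of_nat r * F ps)))"
      by (subst sum_cyclic_factorizations[OF rot]) auto
    \<comment> \<open>At the empty monomial only \<open>r = 0\<close> occurs, and both sides are 0
      by division by 0.\<close>
    also have "\<dots> = (\<Sum>r\<le>size L. \<Sum>ps\<in>factorizations r L. word_sign dfs (concat ps) * (1 / of_nat r * F ps))"
      by (cases "L = {#}") simp_all
    finally show ?thesis
      unfolding pullback using True by simp
  qed
qed

end
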